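(* Let $\mathcal{X}$ be a birth-death process on $S=\{0,1,2,\dots\}$ with birth rates $\lambda_i>0$ ($i\ge0$), death rates $\mu_i>0$ ($i\ge1$), $\mu_0\ge0$, whose transition probabilities satisfy both the Kolmogorov backward and forward equations. Then for $s<0$, \[ \lim_{n\to\infty}\mathbb{E}\big[e^{sT_{0n}}\mathbb{I}_{\{T_{0n}<\infty\}}\big]=\begin{cases}\dfrac{1}{1+\mu_0L_\infty}\displaystyle\prod_{i=1}^\infty\frac{\xi_i}{\xi_i-s} & \text{if } C<\infty,\ D=\infty,\\[2mm] 0 & \text{if } C=\infty,\end{cases} \] and \[ \lim_{n\to\infty}\mathbb{E}\big[e^{sT_{n0}}\mathbb{I}_{\{T_{n0}<\infty\}}\big]=\begin{cases}0 & \text{if } C<\infty,\ D=\infty,\\ \displaystyle\prod_{i=1}^\infty\frac{\xi^{(1)}_i}{\xi^{(1)}_i-s} & \text{if } C=\infty,\ D<\infty.\end{cases} \] The infinite products are reciprocals of entire functions with simple, positive zeros $\xi_i$ and $\xi^{(1)}_i$, $i\ge1$, respectively.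
   Context: The process has $q$-matrix with $q_{i,i+1}=\lambda_i$, $q_{i+1,i}=\mu_{i+1}$, $q_{ii}=-(\lambda_i+\mu_i)$, $q_{ij}=0$ for $|i-j|>1$; if $\mu_0>0$ the process can leave $S$ from state $0$ to an absorbing state $-1$. For $i\ne j$, $T_{ij}$ is the (possibly defective) first hitting time of $j$ starting from $i$. Define $\pi_0=1$, $\pi_n=\frac{\lambda_0\cdots\lambda_{n-1}}{\mu_1\cdots\mu_n}$, $K_n=\sum_{i=0}^n\pi_i$, $L_n=\sum_{i=0}^n(\lambda_i\pi_i)^{-1}$ for $0\le n\le\infty$, $C=\sum_{n\ge0}(\lambda_n\pi_n)^{-1}K_n$, $D=\sum_{n\ge0}(\lambda_n\pi_n)^{-1}(K_\infty-K_n)$. For $l\ge0$ the polynomials $Q^{(l)}_n$ are defined by $Q^{(l)}_0=1$, $\lambda_lQ^{(l)}_1(x)=\lambda_l+\mu_l-x$, $\lambda_{n+l}Q^{(l)}_{n+1}(x)=(\lambda_{n+l}+\mu_{n+l}-x)Q^{(l)}_n(x)-\mu_{n+l}Q^{(l)}_{n-1}(x)$ ($n>0$); $Q_n:=Q^{(0)}_n$. $Q^{(l)}_n$ has $n$ simple positive zeros $x^{(l)}_{n1}<\dots<x^{(l)}_{nn}$; set $\xi^{(l)}_i=\lim_{n\to\infty}x^{(l)}_{ni}$ and $\xi_i=\xi^{(0)}_i$. *)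

theory Defs
  imports "HOL-Probability.Probability" "HOL-Complex_Analysis.Complex_Analysis"
begin

definition bd_pi :: "(nat \<Rightarrow> real) \<Rightarrow> (nat \<Rightarrow> real) \<Rightarrow> nat \<Rightarrow> real" where
  "bd_pi la mu n = (\<Prod>i<n. la i) / (\<Prod>i\<in>{1..n}. mu i)"

definition bd_K :: "(nat \<Rightarrow> real) \<Rightarrow> (nat \<Rightarrow> real) \<Rightarrow> nat \<Rightarrow> real" where
  "bd_K la mu n = (\<Sum>i\<le>n. bd_pi la mu i)"

definition bd_Kinf :: "(nat \<Rightarrow> real) \<Rightarrow> (nat \<Rightarrow> real) \<Rightarrow> ennreal" where
  "bd_Kinf la mu = (\<Sum>i. ennreal (bd_pi la mu i))"

definition bd_Linf :: "(nat \<Rightarrow> real) \<Rightarrow> (nat \<Rightarrow> real) \<Rightarrow> ennreal" where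
  "bd_Linf la mu = (\<Sum>i. ennreal (1 / (la i * bd_pi la mu i)))"

definition bd_C :: "(nat \<Rightarrow> real) \<Rightarrow> (nat \<Rightarrow> real) \<Rightarrow> ennreal" where
  "bd_C la mu = (\<Sum>n. ennreal (1 / (la n * bd_pi la mu n)) * ennreal (bd_K la mu n))"

definition bd_D :: "(nat \<Rightarrow> real) \<Rightarrow> (nat \<Rightarrow> real) \<Rightarrow> ennreal" where
  "bd_D la mu = (\<Sum>n. ennreal (1 / (la n * bd_pi la mu n)) * (bd_Kinf la mu - ennreal (bd_K la mu n)))"

fun bdQ :: "(nat \<Rightarrow> real) \<Rightarrow> (nat \<Rightarrow> real) \<Rightarrow> nat \<Rightarrow> nat \<Rightarrow> real \<Rightarrow> real" where
  "bdQ la mu l 0 x = 1"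
| "bdQ la mu l (Suc 0) x = (la l + mu l - x) / la l"
| "bdQ la mu l (Suc (Suc n)) x =
     ((la (Suc n + l) + mu (Suc n + l) - x) * bdQ la mu l (Suc n) x
       - mu (Suc n + l) * bdQ la mu l n x) / la (Suc n + l)"

definition bd_zero :: "(nat \<Rightarrow> real) \<Rightarrow> (nat \<Rightarrow> real) \<Rightarrow> nat \<Rightarrow> nat \<Rightarrow> nat \<Rightarrow> real" where
  "bd_zero la mu l n i = sorted_list_of_set {x::real. bdQ la mu l n x = 0} ! (i - 1)"

definition bd_xi :: "(nat \<Rightarrow> real) \<Rightarrow> (nat \<Rightarrow> real) \<Rightarrow> nat \<Rightarrow> nat \<Rightarrow> real" where
  "bd_xi la mu l i = lim (\<lambda>n. bd_zero la mu l n i)"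

(* q-matrix restricted to S = {0,1,2,...}; the exit 0 \<rightarrow> -1 at rate mu 0 is
   only visible through q 0 0 = -(la 0 + mu 0). *)
definition bd_q :: "(nat \<Rightarrow> real) \<Rightarrow> (nat \<Rightarrow> real) \<Rightarrow> nat \<Rightarrow> nat \<Rightarrow> real" where
  "bd_q la mu i j =
     (if j = Suc i then la i
      else if i = Suc j then mu i
      else if i = j then - (la i + mu i) else 0)"

definition transition_function :: "(real \<Rightarrow> nat \<Rightarrow> nat \<Rightarrow> real) \<Rightarrow> bool" where
  "transition_function P \<longleftrightarrow>
     (\<forall>t\<ge>0. \<forall>i j. 0 \<le> P t i j) \<and>
     (\<forall>t\<ge>0. \<forall>i n. (\<Sum>j\<le>n. P t i j) \<le> 1) \<and>
     (\<forall>i j. P 0 i j = (if i = j then 1 else 0)) \<and>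
     (\<forall>s\<ge>0. \<forall>t\<ge>0. \<forall>i j. P (s + t) i j = (\<Sum>k. P s i k * P t k j))"

definition kolmogorov_backward ::
  "(nat \<Rightarrow> real) \<Rightarrow> (nat \<Rightarrow> real) \<Rightarrow> (real \<Rightarrow> nat \<Rightarrow> nat \<Rightarrow> real) \<Rightarrow> bool" where
  "kolmogorov_backward la mu P \<longleftrightarrow>
     (\<forall>i j. \<forall>t\<ge>0. ((\<lambda>u. P u i j) has_real_derivative
                       (\<Sum>k\<le>Suc i. bd_q la mu i k * P t k j)) (at t within {0..}))"

definition kolmogorov_forward ::
  "(nat \<Rightarrow> real) \<Rightarrow> (nat \<Rightarrow> real) \<Rightarrow> (real \<Rightarrow> nat \<Rightarrow> nat \<Rightarrow> real) \<Rightarrow> bool" where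
  "kolmogorov_forward la mu P \<longleftrightarrow>
     (\<forall>i j. \<forall>t\<ge>0. ((\<lambda>u. P u i j) has_real_derivative
                       (\<Sum>k\<le>Suc j. P t i k * bd_q la mu k j)) (at t within {0..}))"

text \<open>A process X on a probability space M, started at state i, with transition
function P: states of S are the integers \<ge> 0; any negative value stands for
having left S (absorption in -1, or the cemetery after explosion), which is
absorbing.  Paths are right-constant, and the finite-dimensional distributions
are given by P.\<close>

definition markov_process_from ::
  "'a measure \<Rightarrow> (real \<Rightarrow> 'a \<Rightarrow> int) \<Rightarrow> (real \<Rightarrow> nat \<Rightarrow> nat \<Rightarrow> real) \<Rightarrow> nat \<Rightarrow> bool" where
  "markov_process_from M X P i \<longleftrightarrow>
     prob_space M \<and>
     (\<forall>t\<ge>0. X t \<in> measurable M (count_space UNIV)) \<and>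
     (\<forall>\<omega>\<in>space M. \<forall>t\<ge>0. \<exists>e>0. \<forall>u. t \<le> u \<and> u < t + e \<longrightarrow> X u \<omega> = X t \<omega>) \<and>
     (\<forall>\<omega>\<in>space M. \<forall>t u. 0 \<le> t \<and> t \<le> u \<and> X t \<omega> < 0 \<longrightarrow> X u \<omega> < 0) \<and>
     (\<forall>k (ts::nat \<Rightarrow> real) (js::nat \<Rightarrow> nat).
        ts 0 = 0 \<and> js 0 = i \<and> (\<forall>m<k. ts m \<le> ts (Suc m)) \<longrightarrow>
        measure M {\<omega>\<in>space M. \<forall>m\<le>k. X (ts m) \<omega> = int (js m)}
          = (\<Prod>m<k. P (ts (Suc m) - ts m) (js m) (js (Suc m))))"

definition hit_laplace :: "'a measure \<Rightarrow> (real \<Rightarrow> 'a \<Rightarrow> int) \<Rightarrow> nat \<Rightarrow> real \<Rightarrow> real" where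
  "hit_laplace M X j s =
     integral\<^sup>L M (\<lambda>\<omega>. if \<exists>t\<ge>0. X t \<omega> = int j
                       then exp (s * Inf {t. 0 \<le> t \<and> X t \<omega> = int j}) else 0)"

definition reciprocal_entire_simple_pos_zeros :: "(nat \<Rightarrow> real) \<Rightarrow> bool" where
  "reciprocal_entire_simple_pos_zeros xi \<longleftrightarrow>
     (\<exists>F. F holomorphic_on UNIV \<and>
          (\<forall>s<0. F (complex_of_real s) = complex_of_real (1 / (\<Prod>i. xi (Suc i) / (xi (Suc i) - s)))) \<and>
          {z. F z = 0} = range (\<lambda>i. complex_of_real (xi (Suc i))) \<and>
          (\<forall>z. F z = 0 \<longrightarrow> deriv F z \<noteq> 0) \<and>
          (\<forall>i. 0 < xi (Suc i)))"

end

theory Submission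
  imports Defs "HOL-Real_Asymp.Real_Asymp"
begin

text \<open>
  Put \<open>\<theta> = -s\<close>. Sampling the process on the grid \<open>h\<nat>\<close> and using the renewal identity for the first
  grid visit to \<open>n\<close> shows that \<open>E\<^sub>i[exp(sT\<^sub>n)]\<close> is a limit of quotients of Abel sums of \<open>P\<close>, so that
  the Kolmogorov equations give three-term recursions without any integration. Hence the transform of
  \<open>T\<^sub>0\<^sub>n\<close> is \<open>1 / Q\<^sub>n(s)\<close>, while \<open>n \<mapsto> E\<^sub>n[exp(sT\<^sub>0)]\<close> is a bounded solution of the recursion, which by the
  forward equation is also \<open>\<pi>\<close>-summable.

  With \<open>a\<^sub>n = 1 / (\<lambda>\<^sub>n\<pi>\<^sub>n)\<close>, \<open>p\<^sub>n = \<pi>\<^sub>n\<close> the polynomials satisfy \<open>f\<^sub>n\<^sub>+\<^sub>1 = f\<^sub>n + a\<^sub>n W\<^sub>n\<close>,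
  \<open>W\<^sub>n = m - x(p\<^sub>0f\<^sub>0 + ... + p\<^sub>nf\<^sub>n)\<close>. If \<open>C < \<infinity>\<close> they converge locally uniformly to an entire function. It
  has no double zero on the positive axis, since at such a point \<open>W\<close> and its derivative stay bounded while \<open>f\<close> and its
  derivative tend to 0, contradicting the confluent Christoffel-Darboux identity. The case \<open>D < \<infinity>\<close> is
  the same statement for the dual system, in which \<open>a\<close> and \<open>p\<close> are exchanged (up to an index shift).

  No Hadamard factorization is needed: the zeros of \<open>Q\<^sub>n\<close> decrease in \<open>n\<close>, so for negative \<open>s\<close> the finite products
  over the zeros of \<open>Q\<^sub>n\<close> and over their limits squeeze each other.
\<close>

section \<open>Limits of finite products over decreasing zeros\<close>

text \<open>The process is given by finite-dimensional distributions and right-constant paths, with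
  no strong Markov property at hand; at grid times a finite inclusion-exclusion takes its place. The
  Abel sums are not shown to converge. Relations between them hold up to null sequences, and
  dividing is legitimate because the diagonal sums are bounded and eventually bounded away from 0.
  The second obstacle is uniqueness. If C < infinity, all solutions of the recursion for
  E[exp(sT_n0)] are bounded, so boundedness does not identify the transform; the \<pi>-summability,
  together with divergence of the sum of \<pi>_n, forces its limit to be 0. If C = infinity and D <
  infinity the limit is positive, and it is read off from a Casoratian with Q^(1) whose error term
  is a tail of a convergent series equivalent to D. Finally, \<open>bdQ\<close> is a real function
  while the limits must be entire. The abstract system is therefore complex from the start, is
  matched with \<open>bdQ\<close> on the real axis, and the product over the zeros is carried to the
  plane by the identity theorem.\<close>

lemma norm_prod_one_minus_le_exp:
  fixes w :: "'b \<Rightarrow> 'a::{real_normed_field}"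
  shows "norm (\<Prod>i\<in>A. 1 - w i) \<le> exp (\<Sum>i\<in>A. norm (w i))"
proof -
  have "norm (\<Prod>i\<in>A. 1 - w i) = (\<Prod>i\<in>A. norm (1 - w i))"
    by (simp add: prod_norm)
  also have "\<dots> \<le> (\<Prod>i\<in>A. 1 + norm (w i))"
    by (intro prod_mono) (auto intro: norm_triangle_ineq4[THEN order_trans])
  also have "\<dots> \<le> exp (\<Sum>i\<in>A. norm (w i))"
    by (rule prod_le_exp_sum) auto
  finally show ?thesis .
qed

text \<open>Row n holds the n zeros of the n-th polynomial, normalised to the value 1 at 0, so
  entries with \<open>i \<ge> n\<close> are junk. Convergence is asked for pointwise in z; that the
  limits of the columns are the zeros of \<open>F\<close> has to be proved.\<close>

locale zero_array =
  fixes x :: "nat \<Rightarrow> nat \<Rightarrow> real" and F :: "complex \<Rightarrow> complex" and xi :: "nat \<Rightarrow> real"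
  assumes pos: "\<And>n i. i < n \<Longrightarrow> 0 < x n i"
    and dec: "\<And>n i. i < n \<Longrightarrow> x (Suc n) i \<le> x n i"
    and conv: "\<And>z. (\<lambda>n. \<Prod>i<n. 1 - z / of_real (x n i)) \<longlonglongrightarrow> F z"
    and xi_lim: "\<And>i. xi i = lim (\<lambda>n. x n i)"
begin

lemma xi_tendsto: "(\<lambda>n. x n i) \<longlonglongrightarrow> xi i"
  and xi_le: "i < n \<Longrightarrow> xi i \<le> x n i"
proof -
  \<comment> \<open>Column i carries information from row i + 1 on, hence the shift.\<close>
  have d: "decseq (\<lambda>n. x (n + Suc i) i)"
    unfolding decseq_Suc_iff using dec by simp
  obtain L where L: "(\<lambda>n. x (n + Suc i) i) \<longlonglongrightarrow> L" "\<forall>n. L \<le> x (n + Suc i) i"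
  proof (rule decseq_convergent[OF d, of 0])
    show "\<forall>n. 0 \<le> x (n + Suc i) i"
      using pos[of i] by (simp add: less_imp_le)
  qed blast
  have *: "(\<lambda>n. x n i) \<longlonglongrightarrow> L"
    using L(1) by (rule LIMSEQ_offset)
  then have "xi i = L" by (simp add: xi_lim limI)
  with * show "(\<lambda>n. x n i) \<longlonglongrightarrow> xi i" by simp
  show "xi i \<le> x n i" if "i < n"
    using L(2)[rule_format, of "n - Suc i"] \<open>xi i = L\<close> that by simp
qed

lemma real_conv: "(\<lambda>n. \<Prod>i<n. 1 - s / x n i) \<longlonglongrightarrow> Re (F (of_real s))"
  and F_real: "F (of_real s) = of_real (Re (F (of_real s)))"
proof -
  have eq: "(\<lambda>n. \<Prod>i<n. 1 - complex_of_real s / of_real (x n i))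
        = (\<lambda>n. complex_of_real (\<Prod>i<n. 1 - s / x n i))"
    by (intro ext) simp
  have c: "(\<lambda>n. complex_of_real (\<Prod>i<n. 1 - s / x n i)) \<longlonglongrightarrow> F (of_real s)"
    using conv[of "of_real s"] unfolding eq .
  show r: "(\<lambda>n. \<Prod>i<n. 1 - s / x n i) \<longlonglongrightarrow> Re (F (of_real s))"
    using tendsto_Re[OF c] unfolding Re_complex_of_real .
  show "F (of_real s) = of_real (Re (F (of_real s)))"
    by (rule LIMSEQ_unique[OF c tendsto_of_real[OF r]])
qed

text \<open>At z = -1 all factors are 1 + 1 / x, and their product dominates the sum of the
  reciprocals; convergence at this single point already bounds the sums uniformly in the
  row.\<close>

lemma sum_inverse_bounded: "\<exists>B>0. \<forall>n. (\<Sum>i<n. 1 / x n i) \<le> B"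
proof -
  have "Bseq (\<lambda>n. \<Prod>i<n. 1 - (-1) / x n i)"
    using real_conv[of "-1"] convergent_imp_Bseq convergentI by blast
  then obtain B where B: "B > 0" "\<And>n. norm (\<Prod>i<n. 1 - (-1) / x n i) \<le> B"
    by (auto simp: Bseq_def)
  have "(\<Sum>i<n. 1 / x n i) \<le> B" for n
  proof -
    have "(\<Sum>i<n. 1 / x n i) \<le> (\<Prod>i<n. 1 + 1 / x n i)"
      by (rule sum_le_prod) (use pos in \<open>auto intro: less_imp_le\<close>)
    also have "\<dots> \<le> B" using B(2)[of n] by simp
    finally show ?thesis .
  qed
  with B(1) show ?thesis by blast
qed

text \<open>One reciprocal is at most the bound B for the whole row, so no zero falls below 1 /
  B.\<close>

lemma xi_pos: "0 < xi i"
proof -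
  obtain B where B: "0 < B" "\<And>n. (\<Sum>i<n. 1 / x n i) \<le> B" using sum_inverse_bounded by blast
  have "1 / B \<le> x n i" if "n \<ge> Suc i" for n
  proof -
    have "1 / x n i \<le> (\<Sum>i<n. 1 / x n i)"
      by (rule member_le_sum) (use pos that in \<open>auto intro: less_imp_le\<close>)
    with B(2)[of n] have "1 / x n i \<le> B" by linarith
    then show ?thesis using pos[of i n] that B(1) by (simp add: field_simps)
  qed
  then have "1 / B \<le> xi i" by (intro LIMSEQ_le_const[OF xi_tendsto]) blast
  with B(1) show ?thesis by (smt (verit) divide_pos_pos)
qed

lemma sum_inverse_xi_bounded: "\<exists>B>0. \<forall>n. (\<Sum>i<n. 1 / xi i) \<le> B"
proof -
  obtain B where B: "0 < B" "\<And>n. (\<Sum>i<n. 1 / x n i) \<le> B" using sum_inverse_bounded by blast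
  have "(\<Sum>i<m. 1 / xi i) \<le> B" for m
  proof (rule LIMSEQ_le_const2)
    show "(\<lambda>n. \<Sum>i<m. 1 / x n i) \<longlonglongrightarrow> (\<Sum>i<m. 1 / xi i)"
      by (intro tendsto_intros xi_tendsto) (metis xi_pos less_irrefl)
    have "(\<Sum>i<m. 1 / x n i) \<le> B" if "n \<ge> m" for n
    proof -
      have "(\<Sum>i<m. 1 / x n i) \<le> (\<Sum>i<n. 1 / x n i)"
        by (rule sum_mono2) (use pos that in \<open>auto intro: less_imp_le\<close>)
      with B(2)[of n] show ?thesis by linarith
    qed
    then show "\<exists>N. \<forall>n\<ge>N. (\<Sum>i<m. 1 / x n i) \<le> B" by blast
  qed
  with B(1) show ?thesis by blast
qed

text \<open>In row n the factor of column j tends to 0 at \<open>xi j\<close>, and the product of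
  the other factors stays below exp (xi j * B). This replaces an appeal to Hurwitz.\<close>

lemma F_xi: "F (of_real (xi j)) = 0"
proof -
  obtain B where B: "0 < B" "\<And>n. (\<Sum>i<n. 1 / x n i) \<le> B" using sum_inverse_bounded by blast
  have bd: "\<bar>\<Prod>i<n. 1 - xi j / x n i\<bar> \<le> \<bar>1 - xi j / x n j\<bar> * exp (xi j * B)" if "n \<ge> Suc j" for n
  proof -
    have "(\<Prod>i<n. 1 - xi j / x n i) = (1 - xi j / x n j) * (\<Prod>i\<in>{..<n}-{j}. 1 - xi j / x n i)"
      using that by (subst prod.remove[of _ j]) auto
    moreover have "\<bar>\<Prod>i\<in>{..<n}-{j}. 1 - xi j / x n i\<bar> \<le> exp (\<Sum>i\<in>{..<n}-{j}. \<bar>xi j / x n i\<bar>)"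
      using norm_prod_one_minus_le_exp[of "\<lambda>i. xi j / x n i" "{..<n}-{j}"] by simp
    moreover have "(\<Sum>i\<in>{..<n}-{j}. \<bar>xi j / x n i\<bar>) \<le> (\<Sum>i<n. \<bar>xi j / x n i\<bar>)"
      by (rule sum_mono2) auto
    moreover have "(\<Sum>i<n. \<bar>xi j / x n i\<bar>) = xi j * (\<Sum>i<n. 1 / x n i)"
      unfolding sum_distrib_left using pos xi_pos[of j]
      by (intro sum.cong) (auto simp: abs_of_pos)
    moreover have "xi j * (\<Sum>i<n. 1 / x n i) \<le> xi j * B"
      using B(2) xi_pos[of j] by (intro mult_left_mono) auto
    ultimately have "\<bar>\<Prod>i\<in>{..<n}-{j}. 1 - xi j / x n i\<bar> \<le> exp (xi j * B)"
      by (smt (verit) exp_le_cancel_iff)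
    then show ?thesis
      using \<open>(\<Prod>i<n. 1 - xi j / x n i) = _\<close> by (simp add: abs_mult mult_left_mono)
  qed
  have "(\<lambda>n. \<bar>1 - xi j / x n j\<bar> * exp (xi j * B)) \<longlonglongrightarrow> \<bar>1 - xi j / xi j\<bar> * exp (xi j * B)"
    using xi_pos[of j] by (intro tendsto_intros xi_tendsto) auto
  then have "(\<lambda>n. \<bar>1 - xi j / x n j\<bar> * exp (xi j * B)) \<longlonglongrightarrow> 0"
    using xi_pos[of j] by simp
  then have "(\<lambda>n. \<Prod>i<n. 1 - xi j / x n i) \<longlonglongrightarrow> 0"
    by (rule Lim_null_comparison[rotated])
       (use bd in \<open>auto simp: eventually_sequentially intro!: exI[of _ "Suc j"]\<close>)
  then have "Re (F (of_real (xi j))) = 0"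
    using LIMSEQ_unique[OF real_conv] by blast
  then show ?thesis using F_real[of "xi j"] by simp
qed

text \<open>Split at an index I beyond which the sum of |z| / xi is below 1/2. Since
  \<open>xi i \<le> x n i\<close>, the same holds in every row, and the Weierstrass product
  inequality keeps the tail product above 1/2 in modulus. The head of length I converges to a
  nonzero number.\<close>

lemma F_nonzero:
  assumes z: "\<And>i. z \<noteq> of_real (xi i)"
  shows "F z \<noteq> 0"
proof -
  obtain B where B: "0 < B" "\<And>n. (\<Sum>i<n. 1 / xi i) \<le> B"
    using sum_inverse_xi_bounded by blast
  have "summable (\<lambda>i. 1 / xi i)"
    by (rule summableI_nonneg_bounded[of _ B]) (use B xi_pos in \<open>auto intro: less_imp_le\<close>)
  then have "summable (\<lambda>i. norm z / xi i)"
    using summable_mult[of "\<lambda>i. 1 / xi i" "norm z"] by simp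
  then have "\<exists>I. \<forall>m\<ge>I. \<forall>n. norm (\<Sum>i=m..<n. norm z / xi i) < 1/2"
    unfolding summable_Cauchy by (elim allE[of _ "1/2"]) simp
  then obtain I where I: "\<And>n. norm (\<Sum>i=I..<n. norm z / xi i) < 1/2"
    by blast
  define c where "c = (\<Prod>i<I. 1 - z / of_real (xi i))"
  have xi_nz: "complex_of_real (xi i) \<noteq> 0" for i using xi_pos[of i] by auto
  have cnz: "c \<noteq> 0" unfolding c_def using z xi_nz by (auto simp: field_simps)
  have lim1: "(\<lambda>n. \<Prod>i<I. 1 - z / of_real (x n i)) \<longlonglongrightarrow> c"
    unfolding c_def by (intro tendsto_intros xi_tendsto xi_nz)
  have lb: "norm (\<Prod>i<I. 1 - z / of_real (x n i)) / 2 \<le> norm (\<Prod>i<n. 1 - z / of_real (x n i))"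
    if "n \<ge> I" for n
  proof -
    have split: "(\<Prod>i<n. 1 - z / of_real (x n i))
       = (\<Prod>i<I. 1 - z / of_real (x n i)) * (\<Prod>i=I..<n. 1 - z / of_real (x n i))"
      using prod.atLeastLessThan_concat[of 0 I n "\<lambda>i. 1 - z / of_real (x n i)"] that
      by (simp add: lessThan_atLeast0)
    have xx: "0 < x n i" "xi i \<le> x n i" if "i \<in> {I..<n}" for i
      using that pos xi_le by auto
    have le: "norm z / x n i \<le> norm z / xi i" if "i \<in> {I..<n}" for i
      using xx[OF that] xi_pos[of i] by (intro divide_left_mono) auto
    have half: "(\<Sum>i=I..<n. norm z / x n i) < 1/2"
      using sum_mono[OF le, of "{I..<n}" "\<lambda>i. i"] I[of n] by simp
    have "1/2 \<le> 1 - (\<Sum>i=I..<n. norm z / x n i)" using half by simp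
    also have "\<dots> \<le> (\<Prod>i=I..<n. 1 - norm z / x n i)"
    proof (rule Weierstrass_prod_ineq)
      fix i assume i: "i \<in> {I..<n}"
      have "norm z / x n i \<le> (\<Sum>i=I..<n. norm z / x n i)"
        by (rule member_le_sum[OF i]) (use xx in \<open>auto intro!: divide_nonneg_pos\<close>)
      moreover have "0 \<le> norm z / x n i" using xx[OF i] by simp
      ultimately show "norm z / x n i \<in> {0..1}" using half unfolding atLeastAtMost_iff by linarith
    qed
    also have "\<dots> \<le> (\<Prod>i=I..<n. norm (1 - z / of_real (x n i)))"
    proof (rule prod_mono, safe)
      fix i assume i: "i \<in> {I..<n}"
      have "norm z / x n i \<le> (\<Sum>i=I..<n. norm z / x n i)"
        by (rule member_le_sum[OF i]) (use xx in \<open>auto intro!: divide_nonneg_pos\<close>)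
      then show "0 \<le> 1 - norm z / x n i" using half by simp
      have "norm (1::complex) - norm (z / of_real (x n i)) \<le> norm (1 - z / of_real (x n i))"
        by (rule norm_triangle_ineq2)
      then show "1 - norm z / x n i \<le> norm (1 - z / of_real (x n i))"
        using xx[OF i] by (simp add: norm_divide)
    qed
    also have "\<dots> = norm (\<Prod>i=I..<n. 1 - z / of_real (x n i))" by (simp add: prod_norm)
    finally have "norm (\<Prod>i<I. 1 - z / of_real (x n i)) * (1/2)
      \<le> norm (\<Prod>i<I. 1 - z / of_real (x n i)) * norm (\<Prod>i=I..<n. 1 - z / of_real (x n i))"
      by (intro mult_left_mono) auto
    then show ?thesis unfolding split norm_mult by simp
  qed
  have "norm c / 2 \<le> norm (F z)"
    by (rule LIMSEQ_le[OF tendsto_divide[OF tendsto_norm[OF lim1] tendsto_const] tendsto_norm[OF conv]])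
       (use lb in auto)
  with cnz show ?thesis by auto
qed

lemma F_zeros: "{z. F z = 0} = range (\<lambda>i. complex_of_real (xi i))"
  using F_xi F_nonzero by blast

lemma F_neg:
  assumes s: "s < 0"
  shows "F (of_real s) = of_real (1 / (\<Prod>i. xi i / (xi i - s)))"
    and "0 < (\<Prod>i. xi i / (xi i - s))"
proof -
  let ?f = "Re (F (of_real s))"
  \<comment> \<open>Lower half of the squeeze: m factors are frozen while the row grows, and the
    omitted factors are at least 1 because s is negative.\<close>
  have c1: "(\<Prod>i<m. 1 - s / xi i) \<le> ?f" for m
  proof (rule LIMSEQ_le[OF _ real_conv])
    show "(\<lambda>n. \<Prod>i<m. 1 - s / x n i) \<longlonglongrightarrow> (\<Prod>i<m. 1 - s / xi i)"
      by (intro tendsto_intros xi_tendsto) (metis xi_pos less_irrefl)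
    have "(\<Prod>i<m. 1 - s / x n i) \<le> (\<Prod>i<n. 1 - s / x n i)" if "n \<ge> m" for n
    proof (rule prod_mono2)
      have *: "1 \<le> 1 - s / x n i" if "i < n" for i
        using divide_nonpos_pos[OF _ pos[OF that], of s] s by auto
      show "1 \<le> 1 - s / x n i" if "i \<in> {..<n} - {..<m}" for i
        using * that by simp
      show "0 \<le> 1 - s / x n i" if "i \<in> {..<m}" for i
        using *[of i] that \<open>m \<le> n\<close> by simp
    qed (use that in auto)
    then show "\<exists>N. \<forall>n\<ge>N. (\<Prod>i<m. 1 - s / x n i) \<le> (\<Prod>i<n. 1 - s / x n i)" by blast
  qed
  \<comment> \<open>Upper half: lowering each zero to its limit enlarges the factor.\<close>
  have c2: "(\<Prod>i<n. 1 - s / x n i) \<le> (\<Prod>i<n. 1 - s / xi i)" for n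
  proof (rule prod_mono, safe)
    fix i assume i: "i < n"
    show "0 \<le> 1 - s / x n i" using pos[OF i] s by (simp add: divide_nonpos_pos add_increasing)
    have "(-s) / x n i \<le> (-s) / xi i"
      by (rule divide_left_mono) (use xi_le[OF i] xi_pos[of i] pos[OF i] s in auto)
    then show "1 - s / x n i \<le> 1 - s / xi i" by simp
  qed
  have lim: "(\<lambda>n. \<Prod>i<n. 1 - s / xi i) \<longlonglongrightarrow> ?f"
    by (rule tendsto_sandwich[OF _ _ real_conv tendsto_const]) (use c1 c2 in auto)
  have f1: "1 \<le> ?f" using c1[of 0] by simp
  have inv: "xi i / (xi i - s) = inverse (1 - s / xi i)" for i
    using xi_pos[of i] s by (simp add: field_simps)
  have "(\<lambda>n. inverse (\<Prod>i<n. 1 - s / xi i)) \<longlonglongrightarrow> inverse ?f"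
    by (rule tendsto_inverse[OF lim]) (use f1 in auto)
  then have "(\<lambda>n. \<Prod>i<n. xi i / (xi i - s)) \<longlonglongrightarrow> inverse ?f"
    unfolding inv by (simp add: prod_inversef[symmetric] comp_def)
  then have l2: "(\<lambda>n. \<Prod>i\<le>n. xi i / (xi i - s)) \<longlonglongrightarrow> inverse ?f"
    by (simp add: LIMSEQ_lessThan_iff_atMost)
  \<comment> \<open>\<open>convergent_prod\<close> demands a nonzero limit; nonvanishing factors and
    \<open>f1\<close> secure this, so that \<open>prodinf\<close> really is the limit of the partial
    products.\<close>
  have "xi i / (xi i - s) \<noteq> 0" for i using xi_pos[of i] s by auto
  then have "convergent_prod (\<lambda>i. xi i / (xi i - s))"
    using l2 f1 by (subst convergent_prod_iff_nz_lim) auto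
  then have eq: "(\<Prod>i. xi i / (xi i - s)) = inverse ?f"
    using convergent_prod_tendsto_imp_has_prod[OF _ l2] has_prod_iff by blast
  show "F (of_real s) = of_real (1 / (\<Prod>i. xi i / (xi i - s)))"
    unfolding eq by (subst F_real) (simp add: divide_inverse)
  show "0 < (\<Prod>i. xi i / (xi i - s))" unfolding eq using f1 by simp
qed

end

section \<open>Zeros of the birth-death polynomials\<close>

text \<open>The same recursion as \<open>bdQ\<close>, valued in polynomials, where degree, leading
  coefficient and number of roots make sense.\<close>

fun bdp :: "(nat \<Rightarrow> real) \<Rightarrow> (nat \<Rightarrow> real) \<Rightarrow> nat \<Rightarrow> nat \<Rightarrow> real poly" where
  "bdp la mu l 0 = 1"
| "bdp la mu l (Suc 0) = smult (1 / la l) [:la l + mu l, -1:]"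
| "bdp la mu l (Suc (Suc n)) = smult (1 / la (Suc n + l))
     ([:la (Suc n + l) + mu (Suc n + l), -1:] * bdp la mu l (Suc n)
       - smult (mu (Suc n + l)) (bdp la mu l n))"

lemma poly_bdp: "poly (bdp la mu l n) x = bdQ la mu l n x"
  by (induction la mu l n x rule: bdQ.induct) (simp_all add: algebra_simps diff_divide_distrib add_divide_distrib)

lemma degree_bdp: "degree (bdp la mu l n) \<le> n"
  and coeff_bdp: "coeff (bdp la mu l n) n = (-1) ^ n * (1 / (\<Prod>k<n. la (k + l)))"
proof (induction la mu l n rule: bdp.induct)
  case (3 la mu l n)
  let ?a = "la (Suc n + l) + mu (Suc n + l)" and ?p = "bdp la mu l (Suc n)" and ?q = "bdp la mu l n"
  have *: "[:?a, -1:] * ?p = smult ?a ?p + pCons 0 (- ?p)" by simp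
  {
    case 1
    have "degree ([:?a, -1:] * ?p) \<le> degree [:?a, -1:] + degree ?p" by (rule degree_mult_le)
    also have "\<dots> \<le> Suc (Suc n)" using 3(1) by simp
    finally have "degree ([:?a, -1:] * ?p - smult (mu (Suc n + l)) ?q) \<le> Suc (Suc n)"
      using 3(3) degree_smult_le[of "mu (Suc n + l)" ?q]
      by (intro degree_diff_le) linarith+
    then show ?case
      unfolding bdp.simps by (rule order_trans[OF degree_smult_le])
  next
    case 2
    have "coeff ?p (Suc (Suc n)) = 0" "coeff ?q (Suc (Suc n)) = 0"
      using 3(1,3) by (intro coeff_eq_0; linarith)+
    with 3(2) show ?case unfolding bdp.simps * by (simp add: mult.commute)
  }
qed (simp_all add: coeff_1)

lemma prod_linear_coeff:
  fixes z :: "nat \<Rightarrow> 'a::{comm_ring_1}"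
  shows "degree (\<Prod>i<m. [:z i, -1:]) \<le> m" "coeff (\<Prod>i<m. [:z i, -1:]) m = (-1) ^ m"
proof (induction m)
  case (Suc m)
  let ?p = "\<Prod>i<m. [:z i, -1:]"
  have *: "(\<Prod>i<Suc m. [:z i, -1:]) = smult (z m) ?p + pCons 0 (- ?p)"
    by (simp add: mult.commute)
  {
    case 1
    have "degree (pCons 0 (- ?p)) \<le> Suc m"
      using degree_pCons_le[of 0 "- ?p"] Suc(1) by simp
    moreover have "degree (smult (z m) ?p) \<le> Suc m"
      using degree_smult_le[of "z m" ?p] Suc(1) by linarith
    ultimately show ?case unfolding * by (intro degree_add_le)
  next
    case 2
    have "coeff ?p (Suc m) = 0" using Suc(1) by (intro coeff_eq_0) linarith
    then show ?case unfolding * by (simp add: Suc(2))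
  }
qed simp_all

text \<open>The difference of the two sides has degree below m, as the coefficients at m cancel, but
  vanishes at m distinct points.\<close>

lemma poly_eq_prod_roots:
  fixes p :: "'a::{comm_ring_1,ring_no_zero_divisors} poly"
  assumes "degree p \<le> m" "coeff p m = (-1) ^ m * c" "inj_on z {..<m}"
    and root: "\<And>i. i < m \<Longrightarrow> poly p (z i) = 0"
  shows "p = smult c (\<Prod>i<m. [:z i, -1:])"
proof (rule ccontr)
  let ?q = "smult c (\<Prod>i<m. [:z i, -1:])"
  assume "p \<noteq> ?q"
  then have nz: "p - ?q \<noteq> 0" by simp
  have "degree (p - ?q) \<le> m"
    using assms(1) degree_smult_le[of c "\<Prod>i<m. [:z i, -1:]"] prod_linear_coeff(1)[of z m]
    by (intro degree_diff_le) linarith+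
  moreover have "degree (p - ?q) \<noteq> m"
  proof
    assume "degree (p - ?q) = m"
    moreover have "coeff (p - ?q) m = 0"
      using assms(2) prod_linear_coeff(2)[of z m] by (simp add: mult.commute)
    ultimately show False using nz by (metis leading_coeff_0_iff)
  qed
  ultimately have "degree (p - ?q) < m" by simp
  moreover have "z ` {..<m} \<subseteq> {x. poly (p - ?q) x = 0}"
  proof
    fix y assume "y \<in> z ` {..<m}"
    then obtain i where i: "i < m" "y = z i" by auto
    then have "(\<Prod>j<m. z j - z i) = 0" by (intro prod_zero) auto
    then show "y \<in> {x. poly (p - ?q) x = 0}" using root[OF i(1)] i(2) by (simp add: poly_prod)
  qed
  then have "card (z ` {..<m}) \<le> card {x. poly (p - ?q) x = 0}"
    by (intro card_mono poly_roots_finite nz)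
  then have "m \<le> degree (p - ?q)"
    using card_poly_roots_bound[OF nz] assms(3) by (simp add: card_image)
  ultimately show False by simp
qed

lemma bdQ_factor:
  assumes "inj_on z {..<n}" "\<And>i. i < n \<Longrightarrow> bdQ la mu l n (z i) = 0"
  shows "bdQ la mu l n x = (1 / (\<Prod>k<n. la (k + l))) * (\<Prod>i<n. z i - x)"
proof -
  have "bdp la mu l n = smult (1 / (\<Prod>k<n. la (k + l))) (\<Prod>i<n. [:z i, -1:])"
    by (rule poly_eq_prod_roots[OF degree_bdp coeff_bdp]) (use assms in \<open>auto simp: poly_bdp\<close>)
  then have "poly (bdp la mu l n) x = poly (smult (1 / (\<Prod>k<n. la (k + l))) (\<Prod>i<n. [:z i, -1:])) x"
    by simp
  then show ?thesis by (simp add: poly_bdp poly_prod)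
qed

lemma sgn_prod_diff:
  fixes z :: "nat \<Rightarrow> real"
  assumes "i \<le> n" "\<And>j. j < i \<Longrightarrow> z j < x" "\<And>j. i \<le> j \<Longrightarrow> j < n \<Longrightarrow> x < z j"
  shows "0 < (-1) ^ i * (\<Prod>j<n. z j - x)"
proof -
  have "(\<Prod>j<n. z j - x) = (\<Prod>j<i. z j - x) * (\<Prod>j=i..<n. z j - x)"
    using prod.atLeastLessThan_concat[of 0 i n "\<lambda>j. z j - x"] assms(1)
    by (simp add: lessThan_atLeast0)
  moreover have "(-1) ^ i * (\<Prod>j<i. z j - x) = (\<Prod>j<i. x - z j)"
    by (induction i) (auto simp: algebra_simps)
  ultimately have "(-1) ^ i * (\<Prod>j<n. z j - x) = (\<Prod>j<i. x - z j) * (\<Prod>j=i..<n. z j - x)"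
    by (simp add: mult.assoc[symmetric])
  moreover have "0 < (\<Prod>j<i. x - z j) * (\<Prod>j=i..<n. z j - x)"
    using assms by (intro mult_pos_pos prod_pos) auto
  ultimately show ?thesis by simp
qed

lemma poly_sign_at_infinity:
  fixes p :: "real poly"
  assumes "degree p \<le> m" "coeff p m = (-1) ^ m * c" "0 < c"
  obtains y where "b < y" "0 < (-1) ^ m * poly p y"
proof -
  have nz: "coeff p m \<noteq> 0" using assms by simp
  then have deg: "degree p = m" using assms(1) le_degree[OF nz] by simp
  let ?q = "smult ((-1) ^ m) p"
  have "lead_coeff ?q = c" using assms(2) deg by (simp add: power_mult_distrib[symmetric] mult.assoc[symmetric])
  then have "\<exists>n. \<forall>x\<ge>n. poly ?q x \<ge> lead_coeff ?q"
    using assms(3) by (intro poly_pinfty_gt_lc) simp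
  then obtain n where "\<And>x. x \<ge> n \<Longrightarrow> poly ?q x \<ge> c" using \<open>lead_coeff ?q = c\<close> by auto
  then show ?thesis using assms(3) by (intro that[of "max (b+1) n"]) (auto intro: less_le_trans)
qed

section \<open>Interlacing and monotonicity of the zeros\<close>

locale bd_rates =
  fixes la mu :: "nat \<Rightarrow> real"
  assumes la: "\<And>i. 0 < la i" and mu: "\<And>i. 1 \<le> i \<Longrightarrow> 0 < mu i" "0 \<le> mu 0"
begin

text \<open>Written for increments, the recursion is la (Q_(n+2) - Q_(n+1)) = mu (Q_(n+1) - Q_n) - x
  Q_(n+1), whose right side is nonnegative for x <= 0. The case x = 0 gives the normalising
  constants, x = -\<theta> the denominators of the upward transforms.\<close>

lemma bdQ_nonpos_mono:
  assumes x: "x \<le> 0"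
  shows "bdQ la mu l n x \<le> bdQ la mu l (Suc n) x \<and> 1 \<le> bdQ la mu l n x"
proof (induction n)
  case 0
  have "0 \<le> mu l" using mu by (cases "l = 0") (auto intro: less_imp_le)
  then show ?case using la[of l] x by (simp add: field_simps)
next
  case (Suc n)
  let ?k = "Suc n + l"
  let ?q0 = "bdQ la mu l n x" and ?q1 = "bdQ la mu l (Suc n) x"
  have m: "0 < mu ?k" using mu by simp
  have "la ?k * ?q1 \<le> (la ?k + mu ?k - x) * ?q1 - mu ?k * ?q0"
  proof -
    have "0 \<le> mu ?k * (?q1 - ?q0)" using m Suc by (intro mult_nonneg_nonneg) auto
    moreover have "0 \<le> (- x) * ?q1" using x Suc by (intro mult_nonneg_nonneg) auto
    ultimately show ?thesis by (simp add: ring_distribs)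
  qed
  then have "?q1 \<le> bdQ la mu l (Suc (Suc n)) x"
    using la[of ?k] by (simp add: pos_le_divide_eq mult.commute)
  with Suc show ?case by auto
qed

text \<open>Two consecutive degrees are carried through the induction. At a zero of Q_(n+1) the
  recursion gives Q_(n+2) the sign opposite to Q_n, and interlacing determines that sign; the
  intermediate value theorem then places a zero of Q_(n+2) in each gap.\<close>

lemma bdQ_interlacing:
  shows "\<exists>z z'. strict_mono_on {..<n} z \<and> strict_mono_on {..n} z' \<and>
    (\<forall>i<n. 0 < z i) \<and> (\<forall>i\<le>n. 0 < z' i) \<and> (\<forall>i<n. z' i < z i \<and> z i < z' (Suc i)) \<and>
    (\<forall>i<n. bdQ la mu l n (z i) = 0) \<and> (\<forall>i\<le>n. bdQ la mu l (Suc n) (z' i) = 0)"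
proof (induction n)
  case 0
  have "0 \<le> mu l" using mu by (cases "l = 0") (auto intro: less_imp_le)
  then have p: "0 < la l + mu l" using la[of l] by simp
  show ?case
    by (rule exI[of _ "\<lambda>_. 1"], rule exI[of _ "\<lambda>_. la l + mu l"])
       (simp add: monotone_on_def p)
next
  case (Suc n)
  from Suc.IH obtain z z' where I: "strict_mono_on {..<n} z \<and> strict_mono_on {..n} z' \<and>
    (\<forall>i<n. 0 < z i) \<and> (\<forall>i\<le>n. 0 < z' i) \<and> (\<forall>i<n. z' i < z i \<and> z i < z' (Suc i)) \<and>
    (\<forall>i<n. bdQ la mu l n (z i) = 0) \<and> (\<forall>i\<le>n. bdQ la mu l (Suc n) (z' i) = 0)"
    by (elim exE)
  then have z: "strict_mono_on {..<n} z" "strict_mono_on {..n} z'"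
    "\<And>i. i < n \<Longrightarrow> 0 < z i" "\<And>i. i \<le> n \<Longrightarrow> 0 < z' i" "\<And>i. i < n \<Longrightarrow> z' i < z i"
    "\<And>i. i < n \<Longrightarrow> z i < z' (Suc i)"
    "\<And>i. i < n \<Longrightarrow> bdQ la mu l n (z i) = 0" "\<And>i. i \<le> n \<Longrightarrow> bdQ la mu l (Suc n) (z' i) = 0"
    by simp_all
  define Q where "Q = bdQ la mu l (Suc (Suc n))"
  have mono': "i < j \<Longrightarrow> j \<le> n \<Longrightarrow> z' i < z' j" for i j
    using z(2) by (auto simp: strict_mono_on_def)
  have injz: "inj_on z {..<n}" using z(1) by (rule strict_mono_on_imp_inj_on)
  have sgn: "0 < (-1) ^ Suc i * Q (z' i)" if i: "i \<le> n" for i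
  proof -
    let ?k = "Suc n + l"
    have "0 < (-1) ^ i * (\<Prod>j<n. z j - z' i)"
    proof (rule sgn_prod_diff[OF i])
      show "z j < z' i" if "j < i" for j
        using z(6)[of j] mono'[of "Suc j" i] that i by (cases "Suc j = i") auto
      show "z' i < z j" if "i \<le> j" "j < n" for j
        using z(5)[of j] mono'[of i j] that by (cases "i = j") auto
    qed
    moreover have "0 < 1 / (\<Prod>k<n. la (k + l))"
      using la by (simp add: prod_pos)
    ultimately have "0 < (1 / (\<Prod>k<n. la (k + l))) * ((-1) ^ i * (\<Prod>j<n. z j - z' i))"
      by (rule mult_pos_pos[rotated])
    also have "\<dots> = (-1) ^ i * bdQ la mu l n (z' i)"
      using bdQ_factor[OF injz z(7), of "z' i"] by simp
    finally have "0 < (-1) ^ i * bdQ la mu l n (z' i)" .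
    moreover have "0 < mu ?k / la ?k" using la mu by simp
    ultimately have "0 < (mu ?k / la ?k) * ((-1) ^ i * bdQ la mu l n (z' i))"
      by (rule mult_pos_pos[rotated])
    also have "\<dots> = (-1) ^ Suc i * Q (z' i)"
      using z(8)[OF i] la[of ?k] by (simp add: Q_def field_simps)
    finally show ?thesis .
  qed
  obtain y where y: "z' n < y" "0 < (-1) ^ Suc (Suc n) * Q y"
  proof (rule poly_sign_at_infinity[OF degree_bdp coeff_bdp])
    show "0 < 1 / (\<Prod>k<Suc (Suc n). la (k + l))" using la by (simp only: zero_less_divide_1_iff) (intro prod_pos; simp)
  qed (auto simp only: poly_bdp Q_def)
  \<comment> \<open>End points of the n + 2 gaps: 0, where Q is at least 1, the zeros of Q_(n+1),
    and a point y beyond them where the leading term decides the sign.\<close>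
  define b where "b i = (if i = 0 then 0 else if i \<le> Suc n then z' (i - 1) else y)" for i
  have b0: "b i < b (Suc i)" if "i \<le> Suc n" for i
    using that y(1) mono'[of "i - 1" i] z(4)[of 0] unfolding b_def by (cases "i = Suc n") auto
  have bs: "0 < (-1) ^ i * Q (b i)" if "i \<le> Suc (Suc n)" for i
  proof -
    have "i = 0 \<or> (1 \<le> i \<and> i \<le> Suc n) \<or> i = Suc (Suc n)"
      using that by arith
    then consider "i = 0" | "1 \<le> i \<and> i \<le> Suc n" | "i = Suc (Suc n)" by blast
    then show ?thesis
    proof cases
      case 1
      have "1 \<le> Q 0" using bdQ_nonpos_mono[of 0 l "Suc (Suc n)"] unfolding Q_def by simp
      with 1 show ?thesis by (simp add: b_def)
    next
      case 2
      then have "i - 1 \<le> n" "Suc (i - 1) = i" by linarith+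
      with 2 show ?thesis using sgn[of "i - 1"] by (simp add: b_def)
    next
      case 3
      then show ?thesis using y(2) by (simp add: b_def)
    qed
  qed
  have "\<exists>r. b i < r \<and> r < b (Suc i) \<and> Q r = 0" if i: "i \<le> Suc n" for i
  proof -
    have "Q (b i) * Q (b (Suc i)) < 0"
      using bs[of i] bs[of "Suc i"] i by (cases "even i") (auto simp: mult_pos_neg mult_neg_pos)
    then show ?thesis
      using poly_IVT[OF b0[OF i], of "bdp la mu l (Suc (Suc n))"]
      by (simp only: poly_bdp Q_def)
  qed
  then obtain r where r: "\<And>i. i \<le> Suc n \<Longrightarrow> b i < r i" "\<And>i. i \<le> Suc n \<Longrightarrow> r i < b (Suc i)"
    "\<And>i. i \<le> Suc n \<Longrightarrow> Q (r i) = 0" by metis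
  have b_mono: "b i \<le> b j" if "i \<le> j" "j \<le> Suc (Suc n)" for i j
    using that
  proof (induction j)
    case (Suc j)
    then show ?case using b0[of j] by (cases "i = Suc j") auto
  qed simp
  have r_mono: "strict_mono_on {..Suc n} r"
  proof (rule strict_mono_onI)
    fix i j assume ij: "i \<in> {..Suc n}" "j \<in> {..Suc n}" "i < j"
    then show "r i < r j" using r(1)[of j] r(2)[of i] b_mono[of "Suc i" j] by simp
  qed
  have bz: "b (Suc i) = z' i" if "i \<le> n" for i using that by (simp add: b_def)
  show ?case
  proof (rule exI[of _ z'], rule exI[of _ r], intro conjI allI impI)
    show "strict_mono_on {..<Suc n} z'" using z(2) by (simp add: lessThan_Suc_atMost)
    show "strict_mono_on {..Suc n} r" by (rule r_mono)
    show "0 < z' i" if "i < Suc n" for i using z(4) that by simp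
    show "bdQ la mu l (Suc n) (z' i) = 0" if "i < Suc n" for i using z(8) that by simp
    show "bdQ la mu l (Suc (Suc n)) (r i) = 0" if "i \<le> Suc n" for i
      using r(3)[OF that] by (simp only: Q_def)
    show "0 < r i" if "i \<le> Suc n" for i
      using r(1)[OF that] b_mono[of 0 i] that by (simp add: b_def)
    show "r i < z' i" if "i < Suc n" for i using r(2)[of i] bz[of i] that by simp
    show "z' i < r (Suc i)" if "i < Suc n" for i using r(1)[of "Suc i"] bz[of i] that by simp
  qed
qed

lemma bd_zero_eq:
  assumes "strict_mono_on {..<n} z" "\<And>i. i < n \<Longrightarrow> bdQ la mu l n (z i) = 0" "i < n"
  shows "bd_zero la mu l n (Suc i) = z i"
proof -
  have inj: "inj_on z {..<n}" using assms(1) by (rule strict_mono_on_imp_inj_on)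
  have "{x. bdQ la mu l n x = 0} = z ` {..<n}"
    using bdQ_factor[OF inj assms(2)] la by (auto simp: prod_zero_iff less_imp_neq[symmetric])
  moreover have "sorted_list_of_set (z ` {..<n}) = map z [0..<n]"
  proof (rule sorted_list_of_set_unique[THEN iffD1])
    show "sorted_wrt (<) (map z [0..<n]) \<and> set (map z [0..<n]) = z ` {..<n} \<and> length (map z [0..<n]) = card (z ` {..<n})"
      using assms(1) inj by (auto simp: sorted_wrt_iff_nth_less strict_mono_on_def card_image)
  qed simp
  ultimately show ?thesis using assms(3) by (simp add: bd_zero_def)
qed

text \<open>The decrease in n is one half of the interlacing. The factors are normalised at 0
  because the constants \<open>bdQ la mu l n 0\<close> have to be treated separately: in the
  entrance case with l = 1 they tend to infinity.\<close>

lemma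
  shows bd_zero_pos: "i < n \<Longrightarrow> 0 < bd_zero la mu l n (Suc i)"
    and bd_zero_decreasing: "i < n \<Longrightarrow> bd_zero la mu l (Suc n) (Suc i) \<le> bd_zero la mu l n (Suc i)"
    and bdp_product: "bdp la mu l n = smult (bdQ la mu l n 0) (\<Prod>i<n. [:1, - 1 / bd_zero la mu l n (Suc i):])"
proof -
  obtain z z' where I: "strict_mono_on {..<n} z \<and> strict_mono_on {..n} z' \<and>
    (\<forall>i<n. 0 < z i) \<and> (\<forall>i\<le>n. 0 < z' i) \<and> (\<forall>i<n. z' i < z i \<and> z i < z' (Suc i)) \<and>
    (\<forall>i<n. bdQ la mu l n (z i) = 0) \<and> (\<forall>i\<le>n. bdQ la mu l (Suc n) (z' i) = 0)"
    using bdQ_interlacing[where n=n and l=l] by (elim exE)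
  then have z: "strict_mono_on {..<n} z" "strict_mono_on {..<Suc n} z'"
    "\<And>i. i < n \<Longrightarrow> 0 < z i" "\<And>i. i < n \<Longrightarrow> z' i < z i"
    "\<And>i. i < n \<Longrightarrow> bdQ la mu l n (z i) = 0" "\<And>i. i < Suc n \<Longrightarrow> bdQ la mu l (Suc n) (z' i) = 0"
    unfolding lessThan_Suc_atMost less_Suc_eq_le by simp_all
  have eq: "bd_zero la mu l n (Suc i) = z i" if "i < n" for i
    using bd_zero_eq[OF z(1,5) that] .
  have eq': "bd_zero la mu l (Suc n) (Suc i) = z' i" if "i < Suc n" for i
    using bd_zero_eq[OF z(2,6) that] .
  show "i < n \<Longrightarrow> 0 < bd_zero la mu l n (Suc i)" using eq z(3) by simp
  show "i < n \<Longrightarrow> bd_zero la mu l (Suc n) (Suc i) \<le> bd_zero la mu l n (Suc i)"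
    using eq eq' z(4) by (simp add: less_imp_le)
  let ?c = "1 / (\<Prod>k<n. la (k + l))"
  have inj: "inj_on z {..<n}" using z(1) by (rule strict_mono_on_imp_inj_on)
  have 1: "bdp la mu l n = smult ?c (\<Prod>i<n. [:z i, -1:])"
    by (rule poly_eq_prod_roots[OF degree_bdp coeff_bdp inj]) (use z in \<open>auto simp: poly_bdp\<close>)
  have "[:z i, -1:] = smult (z i) [:1, - 1 / bd_zero la mu l n (Suc i):]" if "i < n" for i
    using eq[OF that] z(3)[OF that] by simp
  then have "(\<Prod>i<n. [:z i, -1:]) = (\<Prod>i<n. smult (z i) [:1, - 1 / bd_zero la mu l n (Suc i):])"
    by (intro prod.cong refl) (metis lessThan_iff)
  also have "\<dots> = smult (\<Prod>i<n. z i) (\<Prod>i<n. [:1, - 1 / bd_zero la mu l n (Suc i):])"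
    by (rule prod_smult)
  finally show "bdp la mu l n = smult (bdQ la mu l n 0) (\<Prod>i<n. [:1, - 1 / bd_zero la mu l n (Suc i):])"
    using 1 bdQ_factor[OF inj z(5), of 0] by simp
qed

end

section \<open>Solutions at an exit boundary\<close>

text \<open>Nonnegative \<open>a\<close> and \<open>p\<close> with a summable product
  \<open>a n * K n\<close> suffice, which lets the locale serve twice: for resistances and masses
  with \<open>m0 = mu 0\<close>, and for the dual system, where the roles are exchanged and
  \<open>m0 = 0\<close>.\<close>

locale exit_system =
  fixes a p :: "nat \<Rightarrow> real" and m0 :: real and K :: "nat \<Rightarrow> real"
  assumes a_nonneg: "\<And>n. 0 \<le> a n" and p_nonneg: "\<And>n. 0 \<le> p n" and p0: "0 < p 0"
    and m0: "0 \<le> m0"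
    and K_def: "\<And>n. K n = (\<Sum>k\<le>n. p k)"
    and summ: "summable (\<lambda>n. a n * K n)"
begin

section \<open>Flux bounds for solutions tending to 0\<close>

lemma K_mono: "m \<le> n \<Longrightarrow> K m \<le> K n"
  unfolding K_def using p_nonneg by (intro sum_mono2) auto

lemma K_pos: "0 < K n"
  using K_mono[of 0 n] p0 by (simp add: K_def)

lemma summable_a: "summable a"
proof (rule summable_comparison_test)
  have "norm (a n) \<le> (1 / p 0) * (a n * K n)" for n
    using mult_left_mono[OF K_mono[of 0 n] a_nonneg[of n]] p0 a_nonneg[of n] by (simp add: K_def field_simps)
  then show "\<exists>N. \<forall>n\<ge>N. norm (a n) \<le> (1 / p 0) * (a n * K n)" by blast
qed (intro summable_mult summ)

lemma summable_lin: "summable (\<lambda>n. a n * (c + d * K n))"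
  using summable_add[OF summable_mult[OF summable_a, of c] summable_mult[OF summ, of d]]
  by (simp add: algebra_simps)

definition tail :: "nat \<Rightarrow> real" where
  "tail N = (\<Sum>m. a (m + N) * K (m + N))"

lemma tail_small: "0 < e \<Longrightarrow> \<exists>N. tail N < e"
  using order_tendstoD(2)[OF suminf_exist_split2[OF summ], of e]
  unfolding tail_def eventually_sequentially by blast

text \<open>As f tends to 0, f k is minus the sum of all later increments
  \<open>a m * W m\<close>.\<close>

lemma increment_le_tail:
  fixes f W :: "nat \<Rightarrow> complex"
  assumes lim: "f \<longlonglongrightarrow> 0" and rec: "\<And>n. f (Suc n) = f n + of_real (a n) * W n"
    and W: "\<And>m. k \<le> m \<Longrightarrow> norm (W m) \<le> b m" and b: "summable (\<lambda>m. a m * b m)"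
  shows "norm (f k) \<le> (\<Sum>m. a (m + k) * b (m + k))"
proof -
  have part: "norm (f k - f (k + j)) \<le> (\<Sum>m<j. a (m + k) * b (m + k))" for j
  proof (induction j)
    case (Suc j)
    have "f k - f (k + Suc j) = (f k - f (k + j)) - of_real (a (k + j)) * W (k + j)"
      using rec[of "k + j"] by simp
    then have "norm (f k - f (k + Suc j)) \<le> norm (f k - f (k + j)) + norm (of_real (a (k + j)) * W (k + j))"
      by (metis norm_triangle_ineq4)
    also have "norm (of_real (a (k + j)) * W (k + j)) \<le> a (k + j) * b (k + j)"
      unfolding norm_mult using W[of "k + j"] a_nonneg[of "k + j"] by (simp add: mult_left_mono)
    finally show ?case using Suc by (simp add: add.commute)
  qed simp
  have sm: "summable (\<lambda>m. a (m + k) * b (m + k))"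
    using b summable_ignore_initial_segment by blast
  have nn: "0 \<le> a (m + k) * b (m + k)" for m
    using a_nonneg order_trans[OF norm_ge_zero W[of "m + k"]]
    by (intro mult_nonneg_nonneg) auto
  have "norm (f k - f (k + j)) \<le> (\<Sum>m. a (m + k) * b (m + k))" for j
    using part[of j] sum_le_suminf[OF sm, of "{..<j}"] nn by fastforce
  moreover have "(\<lambda>j. norm (f k - f (k + j))) \<longlonglongrightarrow> norm (f k - 0)"
    using LIMSEQ_ignore_initial_segment[OF lim, of k] by (intro tendsto_intros) (simp add: add.commute)
  ultimately show ?thesis
    by (intro LIMSEQ_le_const2[of "\<lambda>j. norm (f k - f (k + j))"]) auto
qed

text \<open>Bound norm (f k) by the tail T k of the increments and exchange the order of summation:
  the term \<open>a m * b m\<close> is counted with total mass at most K m if m <= n, and at most K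
  n if m > n.\<close>

lemma weighted_sum_le_tail:
  fixes f W :: "nat \<Rightarrow> complex"
  assumes lim: "f \<longlonglongrightarrow> 0" and rec: "\<And>n. f (Suc n) = f n + of_real (a n) * W n"
    and W: "\<And>m. N \<le> m \<Longrightarrow> norm (W m) \<le> c * (1 + e * K m)" and e: "0 \<le> e" and c: "0 \<le> c"
  shows "(\<Sum>k=N..n. p k * norm (f k)) \<le> c * (1 + e * K n) * tail N"
proof (cases "N \<le> n")
  case True
  define b where "b m = c * (1 + e * K m)" for m
  have b_nonneg: "0 \<le> b m" for m
    unfolding b_def using e c less_imp_le[OF K_pos, of m] by (simp add: mult_nonneg_nonneg add_nonneg_nonneg)
  have b_mono: "m \<le> n \<Longrightarrow> b m \<le> b n" for m n
    unfolding b_def using e c K_mono[of m n] by (intro mult_left_mono add_left_mono) auto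
  have sb: "summable (\<lambda>m. a m * b m)"
    using summable_lin[of c "c * e"] by (simp add: b_def algebra_simps)
  define T where "T k = (\<Sum>m. a (m + k) * b (m + k))" for k
  have sT: "summable (\<lambda>m. a (m + k) * b (m + k))" for k
    using sb summable_ignore_initial_segment by blast
  have T_Suc: "T k = a k * b k + T (Suc k)" for k
    using suminf_split_head[OF sT[of k]] by (simp add: T_def)
  have fT: "norm (f k) \<le> T k" if "N \<le> k" for k
    unfolding T_def by (rule increment_le_tail[OF lim rec _ sb]) (use W that in \<open>auto simp: b_def\<close>)
  have T_nonneg: "0 \<le> T k" for k
    unfolding T_def by (intro suminf_nonneg sT mult_nonneg_nonneg a_nonneg b_nonneg)
  \<comment> \<open>This is the exchange of summation, done by induction on n: raising n moves one
    term out of the tail T (n + 1), and K grows by exactly the new mass.\<close>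
  have claim: "(\<Sum>k=N..n. p k * T k) \<le> (\<Sum>m=N..n. a m * b m * K m) + K n * T (Suc n)"
    using True
  proof (induction n rule: dec_induct)
    case base
    have "p N \<le> K N" unfolding K_def using p_nonneg by (intro member_le_sum) auto
    then have "p N * T N \<le> K N * T N" using T_nonneg by (intro mult_right_mono)
    then show ?case using T_Suc[of N] by (simp add: algebra_simps)
  next
    case (step n)
    have "K (Suc n) = K n + p (Suc n)" by (simp add: K_def)
    then show ?case using step T_Suc[of "Suc n"] by (simp add: algebra_simps)
  qed
  have sK: "summable (\<lambda>m. a (m + k) * K (m + k))" for k
    using summ summable_ignore_initial_segment by blast
  have 1: "(\<Sum>m=N..n. a m * b m * K m) \<le> (\<Sum>m=N..n. b n * (a m * K m))"
  proof (rule sum_mono)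
    fix m assume "m \<in> {N..n}"
    then have "b m * (a m * K m) \<le> b n * (a m * K m)"
      using b_mono[of m n] a_nonneg[of m] less_imp_le[OF K_pos, of m] by (intro mult_right_mono) auto
    then show "a m * b m * K m \<le> b n * (a m * K m)" by (simp add: mult_ac)
  qed
  \<comment> \<open>The quotient b m / K m = c (1 / K m + e) does not increase with m, so beyond n
    one has K n * b m <= b n * K m.\<close>
  have 2: "K n * T (Suc n) \<le> b n * tail (Suc n)"
    unfolding T_def tail_def suminf_mult[OF sT, symmetric] suminf_mult[OF sK, symmetric]
  proof (rule suminf_le)
    fix m
    let ?m = "m + Suc n"
    have "K n * (1 + e * K ?m) \<le> (1 + e * K n) * K ?m"
      using K_mono[of n ?m] by (simp add: algebra_simps)
    then have "c * (K n * (1 + e * K ?m)) \<le> c * ((1 + e * K n) * K ?m)"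
      using c by (rule mult_left_mono)
    then have "a ?m * (c * (K n * (1 + e * K ?m))) \<le> a ?m * (c * ((1 + e * K n) * K ?m))"
      using a_nonneg by (rule mult_left_mono)
    then show "K n * (a ?m * b ?m) \<le> b n * (a ?m * K ?m)"
      by (simp add: b_def mult_ac)
  qed (intro summable_mult sT sK)+
  have tail_split: "tail N = (\<Sum>m=N..n. a m * K m) + tail (Suc n)"
    using True
  proof (induction n rule: dec_induct)
    case base
    show ?case using suminf_split_head[OF sK[of N]] by (simp add: tail_def)
  next
    case (step n)
    then show ?case using suminf_split_head[OF sK[of "Suc n"]] by (simp add: tail_def)
  qed
  have "(\<Sum>k=N..n. p k * norm (f k)) \<le> (\<Sum>k=N..n. p k * T k)"
    using fT p_nonneg by (intro sum_mono mult_left_mono) auto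
  also note claim
  also have "(\<Sum>m=N..n. a m * b m * K m) + K n * T (Suc n)
      \<le> b n * (\<Sum>m=N..n. a m * K m) + b n * tail (Suc n)"
    using 1 2 by (simp add: sum_distrib_left)
  also have "\<dots> = b n * tail N" by (simp add: tail_split algebra_simps)
  finally show ?thesis by (simp add: b_def)
next
  case False
  have "0 \<le> tail N"
    unfolding tail_def using summ a_nonneg less_imp_le[OF K_pos]
    by (intro suminf_nonneg mult_nonneg_nonneg summable_ignore_initial_segment) auto
  moreover have "0 \<le> c * (1 + e * K n)"
    using e c less_imp_le[OF K_pos, of n] by (simp add: mult_nonneg_nonneg add_nonneg_nonneg)
  ultimately show ?thesis using False by simp
qed

text \<open>The weights \<open>1 + e K\<close> make the supremum finite a priori; letting \<open>e\<close> tend to 0 then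
  removes them.\<close>

lemma flux_bounded:
  fixes f W :: "nat \<Rightarrow> complex"
  assumes lim: "f \<longlonglongrightarrow> 0" and rec: "\<And>n. f (Suc n) = f n + of_real (a n) * W n"
    and W: "\<And>n. norm (W n) \<le> c0 + x * (\<Sum>k\<le>n. p k * norm (f k))" and x: "0 < x" and c0: "0 \<le> c0"
  shows "\<exists>B\<ge>0. \<forall>n. norm (W n) \<le> B"
proof -
  obtain b where b: "b > 0" "\<And>n. norm (f n) \<le> b"
    using convergent_imp_Bseq[OF convergentI[OF lim]] by (auto simp: Bseq_def)
  define c2 where "c2 = c0 / p 0 + x * b"
  have apriori: "norm (W n) \<le> c2 * K n" for n
  proof -
    have "(\<Sum>k\<le>n. p k * norm (f k)) \<le> (\<Sum>k\<le>n. p k * b)"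
      using b p_nonneg by (intro sum_mono mult_left_mono)
    then have "x * (\<Sum>k\<le>n. p k * norm (f k)) \<le> x * (K n * b)"
      using x by (simp add: K_def sum_distrib_right)
    moreover have "c0 \<le> c0 / p 0 * K n"
      using mult_left_mono[OF K_mono[of 0 n], of "c0 / p 0"] c0 p0 by (simp add: K_def)
    ultimately show ?thesis using W[of n] by (simp add: c2_def algebra_simps)
  qed
  \<comment> \<open>The threshold 1 / (2x) makes the contribution of the levels from N on reproduce
    at most half of the bound that is put in.\<close>
  obtain N where N: "tail N < 1 / (2 * x)" using tail_small[of "1 / (2 * x)"] x by auto
  define c1 where "c1 = c0 + x * (\<Sum>k<N. p k * norm (f k))"
  have c1: "0 \<le> c1" unfolding c1_def using c0 x p_nonneg
    by (intro add_nonneg_nonneg mult_nonneg_nonneg sum_nonneg) auto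
  have W1: "norm (W n) \<le> c1 + x * (\<Sum>k=N..n. p k * norm (f k))" if "N \<le> n" for n
  proof -
    have "{..n} = {..<N} \<union> {N..n}" using that by auto
    then have "(\<Sum>k\<le>n. p k * norm (f k)) = (\<Sum>k<N. p k * norm (f k)) + (\<Sum>k=N..n. p k * norm (f k))"
      by (metis (no_types, lifting) finite_lessThan finite_atLeastAtMost ivl_disj_int_one(8) ivl_disj_int_one(7) sum.union_disjoint ivl_disj_int_two(7) lessThan_iff atLeastAtMost_iff disjoint_iff linorder_not_less)
    then show ?thesis using W[of n] by (simp add: c1_def algebra_simps)
  qed
  have main: "norm (W n) \<le> 2 * c1 * (1 + e * K n)" if e: "0 < e" and n: "N \<le> n" for e n
  proof -
    let ?r = "\<lambda>m. norm (W m) / (1 + e * K m)"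
    have d: "0 < 1 + e * K m" for m using e K_pos[of m] by (simp add: add_pos_pos)
    have rb: "?r m \<le> c2 / e" for m
    proof -
      have "0 \<le> c2 * K m" using apriori[of m] norm_ge_zero order_trans by blast
      then have "0 \<le> c2" using K_pos[of m] by (simp add: zero_le_mult_iff)
      have "norm (W m) * e \<le> c2 * K m * e" using apriori e by simp
      also have "\<dots> \<le> c2 * (1 + e * K m)" using \<open>0 \<le> c2\<close> by (simp add: algebra_simps)
      finally show ?thesis using d[of m] e by (simp add: field_simps)
    qed
    have bdd: "bdd_above (?r ` {N..})" using rb by (intro bdd_aboveI[of _ "c2 / e"]) auto
    define c where "c = (SUP m\<in>{N..}. ?r m)"
    have rc: "?r m \<le> c" if "N \<le> m" for m
      unfolding c_def using that bdd by (intro cSUP_upper) auto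
    have "0 \<le> ?r N" using d[of N] by simp
    then have c: "0 \<le> c" using rc[of N] by simp
    have Wc: "norm (W m) \<le> c * (1 + e * K m)" if "N \<le> m" for m
      using rc[OF that] d[of m] by (simp add: divide_simps)
    have "?r m \<le> c1 + c / 2" if m: "N \<le> m" for m
    proof -
      have "(\<Sum>k=N..m. p k * norm (f k)) \<le> c * (1 + e * K m) * tail N"
        by (rule weighted_sum_le_tail[OF lim rec Wc less_imp_le[OF e] c])
      also have "\<dots> \<le> c * (1 + e * K m) * (1 / (2 * x))"
        using N c d[of m] by (intro mult_left_mono) auto
      finally have "x * (\<Sum>k=N..m. p k * norm (f k)) \<le> x * (c * (1 + e * K m) * (1 / (2 * x)))"
        using x by (intro mult_left_mono) auto
      then have "norm (W m) \<le> c1 + c / 2 * (1 + e * K m)"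
        using W1[OF m] x by simp
      also have "c1 \<le> c1 * (1 + e * K m)" using c1 e K_pos[of m] by (simp add: mult_nonneg_nonneg algebra_simps)
      finally have "norm (W m) \<le> (c1 + c / 2) * (1 + e * K m)" by (simp add: algebra_simps)
      then show ?thesis using d[of m] by (simp add: pos_divide_le_eq)
    qed
    \<comment> \<open>Half of the supremum is absorbed on the left, which is legitimate as
      \<open>bdd\<close> makes c a genuine supremum. The resulting 2 * c1 does not depend on
      e.\<close>
    then have "c \<le> c1 + c / 2" unfolding c_def by (intro cSUP_least) auto
    then have "c \<le> 2 * c1" by simp
    then have "c * (1 + e * K n) \<le> 2 * c1 * (1 + e * K n)" using d[of n] by (intro mult_right_mono) auto
    then show ?thesis using Wc[OF n] by linarith
  qed
  have big: "norm (W n) \<le> 2 * c1" if n: "N \<le> n" for n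
  proof (rule LIMSEQ_le_const)
    have "(\<lambda>j. 2 * c1 * (1 + inverse (real (Suc j)) * K n)) \<longlonglongrightarrow> 2 * c1 * (1 + 0 * K n)"
      by (intro tendsto_intros LIMSEQ_inverse_real_of_nat)
    then show "(\<lambda>j. 2 * c1 * (1 + inverse (real (Suc j)) * K n)) \<longlonglongrightarrow> 2 * c1" by simp
    show "\<exists>M. \<forall>j\<ge>M. norm (W n) \<le> 2 * c1 * (1 + inverse (real (Suc j)) * K n)"
      using main[OF _ n] by auto
  qed
  have "norm (W n) \<le> 2 * c1 + c2 * K N" for n
  proof (cases "N \<le> n")
    case True
    have "0 \<le> c2 * K N" using apriori[of N] norm_ge_zero order_trans by blast
    then show ?thesis using big[OF True] by simp
  next
    case False
    have "0 \<le> c2 * K n" using apriori[of n] norm_ge_zero order_trans by blast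
    then have "0 \<le> c2" using K_pos[of n] by (simp add: zero_le_mult_iff)
    then have "c2 * K n \<le> c2 * K N" using K_mono[of n N] False by (intro mult_left_mono) auto
    then show ?thesis using apriori[of n] c1 by simp
  qed
  moreover have "0 \<le> 2 * c1 + c2 * K N"
    using c1 order_trans[OF norm_ge_zero apriori[of N]] by simp
  ultimately show ?thesis by blast
qed

section \<open>The fundamental solution and its entire limit\<close>

primrec fW :: "nat \<Rightarrow> complex \<Rightarrow> complex \<times> complex" where
  "fW 0 x = (1, of_real m0 - x * of_real (p 0))"
| "fW (Suc n) x = (let f = fst (fW n x) + of_real (a n) * snd (fW n x)
     in (f, snd (fW n x) - x * of_real (p (Suc n)) * f))"

definition f :: "nat \<Rightarrow> complex \<Rightarrow> complex" where "f n x = fst (fW n x)"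
definition W :: "nat \<Rightarrow> complex \<Rightarrow> complex" where "W n x = snd (fW n x)"

lemma f0: "f 0 x = 1"
  and f_Suc: "f (Suc n) x = f n x + of_real (a n) * W n x"
  by (simp_all add: f_def W_def Let_def)

lemma W_eq: "W n x = of_real m0 - x * (\<Sum>k\<le>n. of_real (p k) * f k x)"
  by (induction n) (simp_all add: f_def W_def Let_def algebra_simps)

lemma f_of_real:
  assumes "y 0 = 1" "v 0 = m0 - x * p 0"
    and "\<And>n. y (Suc n) = y n + a n * v n" "\<And>n. v (Suc n) = v n - x * p (Suc n) * y (Suc n)"
  shows "f n (of_real x) = of_real (y n)"
proof -
  have "fW n (of_real x) = (of_real (y n), of_real (v n))"
    by (induction n) (simp_all add: assms Let_def)
  then show ?thesis by (simp add: f_def)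
qed

definition finf :: "complex \<Rightarrow> complex" where
  "finf x = 1 + (\<Sum>n. of_real (a n) * W n x)"

lemma f_sum: "f n x = 1 + (\<Sum>k<n. of_real (a k) * W k x)"
  by (induction n) (simp_all add: f0 f_Suc)

text \<open>A discrete Gronwall argument: \<open>M\<close> grows by the factor 1 + a n (m0 + R K n),
  which dominates the growth of f since W n involves f up to index n. The product stays below the
  exponential of a convergent series.\<close>

lemma W_bound:
  assumes R: "norm x \<le> R"
  shows "norm (W n x) \<le> (m0 + R * K n) * exp (\<Sum>k. a k * (m0 + R * K k))"
proof -
  have R0: "0 \<le> R" using R norm_ge_zero order_trans by blast
  define M where "M n = (\<Prod>k<n. 1 + a k * (m0 + R * K k))" for n
  have t0: "0 \<le> m0 + R * K k" for k using m0 R0 less_imp_le[OF K_pos, of k] by simp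
  have M1: "1 \<le> M n" for n
    unfolding M_def using a_nonneg t0 by (intro prod_ge_1) simp
  have M_mono: "M n \<le> M (Suc n)" for n
    using M1[of n] a_nonneg[of n] t0[of n] unfolding M_def by simp
  have M_mono': "m \<le> n \<Longrightarrow> M m \<le> M n" for m n
    using M_mono by (rule lift_Suc_mono_le)
  have WM: "norm (W n x) \<le> (m0 + R * K n) * M n" if "\<And>k. k \<le> n \<Longrightarrow> norm (f k x) \<le> M k" for n
  proof -
    have "norm (\<Sum>k\<le>n. of_real (p k) * f k x) \<le> (\<Sum>k\<le>n. p k * M n)"
    proof (rule sum_norm_le)
      fix k assume "k \<in> {..n}"
      then have "norm (f k x) \<le> M n" using that[of k] M_mono'[of k n] by force
      then show "norm (of_real (p k) * f k x) \<le> p k * M n"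
        using p_nonneg[of k] by (simp add: norm_mult mult_left_mono)
    qed
    also have "\<dots> = K n * M n" by (simp add: K_def sum_distrib_right)
    finally have "norm x * norm (\<Sum>k\<le>n. of_real (p k) * f k x) \<le> R * (K n * M n)"
      using R R0 by (intro mult_mono) auto
    moreover have "norm (W n x) \<le> m0 + norm x * norm (\<Sum>k\<le>n. of_real (p k) * f k x)"
      unfolding W_eq using norm_triangle_ineq4[of "of_real m0 :: complex" "x * (\<Sum>k\<le>n. of_real (p k) * f k x)"] m0
      by (simp add: norm_mult)
    moreover have "m0 \<le> m0 * M n" using m0 M1[of n] by (simp add: mult_le_cancel_left1)
    ultimately show ?thesis by (simp add: algebra_simps)
  qed
  have fM: "norm (f n x) \<le> M n" for n
  proof (induction n rule: less_induct)
    case (less n)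
    show ?case
    proof (cases n)
      case 0
      then show ?thesis by (simp add: f0 M_def)
    next
      case (Suc n')
      have "norm (f n x) \<le> norm (f n' x) + norm (of_real (a n') * W n' x)"
        unfolding Suc f_Suc by (rule norm_triangle_ineq)
      also have "\<dots> \<le> M n' + a n' * ((m0 + R * K n') * M n')"
        using less[of n'] WM[of n'] less Suc a_nonneg[of n']
        by (intro add_mono) (auto simp: norm_mult intro!: mult_left_mono)
      also have "\<dots> = M n" unfolding Suc M_def by (simp add: algebra_simps)
      finally show ?thesis .
    qed
  qed
  define B where "B = exp (\<Sum>k. a k * (m0 + R * K k))"
  have MB: "M n \<le> B" for n
  proof -
    have "M n \<le> exp (\<Sum>k<n. a k * (m0 + R * K k))"
      unfolding M_def by (rule prod_le_exp_sum) (simp add: a_nonneg t0)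
    also have "\<dots> \<le> B"
      unfolding B_def exp_le_cancel_iff
      by (rule sum_le_suminf[OF summable_lin]) (auto simp: a_nonneg t0)
    finally show ?thesis .
  qed
  show ?thesis
    using order_trans[OF WM[OF fM] mult_left_mono[OF MB t0]] unfolding B_def .
qed

lemma uniform_limit_f:
  "uniform_limit (cball 0 R) f finf sequentially"
proof -
  define B where "B = exp (\<Sum>k. a k * (m0 + R * K k))"
  have "uniform_limit (cball 0 R) (\<lambda>n x. \<Sum>k<n. of_real (a k) * W k x) (\<lambda>x. \<Sum>k. of_real (a k) * W k x) sequentially"
  proof (rule Weierstrass_m_test[where M="\<lambda>n. a n * ((m0 + R * K n) * B)"])
    fix n and x :: complex assume "x \<in> cball 0 R"
    then have "norm (W n x) \<le> (m0 + R * K n) * B"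
      using W_bound[of x R n] unfolding B_def by simp
    then show "norm (of_real (a n) * W n x) \<le> a n * ((m0 + R * K n) * B)"
      using a_nonneg[of n] by (simp add: norm_mult mult_left_mono)
  next
    show "summable (\<lambda>n. a n * ((m0 + R * K n) * B))"
      using summable_mult2[OF summable_lin[of m0 R], of B] by (simp add: mult.assoc)
  qed
  then have "uniform_limit (cball 0 R) (\<lambda>n x. 1 + (\<Sum>k<n. of_real (a k) * W k x)) (\<lambda>x. 1 + (\<Sum>k. of_real (a k) * W k x)) sequentially"
    by (intro uniform_limit_intros)
  then show ?thesis unfolding finf_def f_sum[symmetric] .
qed

lemma uniform_limit_ball: "\<exists>d>0. cball x d \<subseteq> UNIV \<and> uniform_limit (cball x d) f finf sequentially"
proof -
  have "cball x 1 \<subseteq> cball 0 (norm x + 1)"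
    by (auto simp: dist_norm) (metis add.commute add_le_cancel_left norm_minus_commute norm_triangle_sub order_trans)
  then have "uniform_limit (cball x 1) f finf sequentially"
    by (rule uniform_limit_on_subset[OF uniform_limit_f])
  then show ?thesis by (intro exI[of _ 1]) auto
qed

lemma f_tendsto: "(\<lambda>n. f n x) \<longlonglongrightarrow> finf x"
  by (rule tendsto_uniform_limitI[OF uniform_limit_f[of "norm x"]]) simp

lemma differentiable_f: "f n field_differentiable (at x)"
proof (induction n rule: less_induct)
  case (less n)
  show ?case
  proof (cases n)
    case 0
    have "f 0 = (\<lambda>_. 1)" by (simp add: f0 fun_eq_iff)
    then show ?thesis using 0 by simp
  next
    case (Suc m)
    have "f n = (\<lambda>x. f m x + of_real (a m) * (of_real m0 - x * (\<Sum>k\<le>m. of_real (p k) * f k x)))"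
      by (simp add: fun_eq_iff Suc f_Suc W_eq)
    moreover have "(\<lambda>x. f m x + of_real (a m) * (of_real m0 - x * (\<Sum>k\<le>m. of_real (p k) * f k x))) field_differentiable (at x)"
      using less Suc
      by (intro derivative_intros field_differentiable_sum) auto
    ultimately show ?thesis by simp
  qed
qed

section \<open>Derivatives in the spectral parameter and simplicity of zeros\<close>

definition g :: "nat \<Rightarrow> complex \<Rightarrow> complex" where "g n x = deriv (f n) x"
definition V :: "nat \<Rightarrow> complex \<Rightarrow> complex" where
  "V n x = - (\<Sum>k\<le>n. of_real (p k) * f k x) - x * (\<Sum>k\<le>n. of_real (p k) * g k x)"

lemma f_deriv: "(f n has_field_derivative g n x) (at x)"
  unfolding g_def using differentiable_f field_differentiable_derivI by blast

lemma W_deriv: "(W n has_field_derivative V n x) (at x)"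
proof -
  have "W n = (\<lambda>x. of_real m0 - x * (\<Sum>k\<le>n. of_real (p k) * f k x))"
    by (simp add: W_eq fun_eq_iff)
  moreover have "((\<lambda>x. of_real m0 - x * (\<Sum>k\<le>n. of_real (p k) * f k x)) has_field_derivative V n x) (at x)"
    unfolding V_def by (auto intro!: derivative_eq_intros f_deriv simp: algebra_simps sum_distrib_left sum.distrib)
  ultimately show ?thesis by simp
qed

lemma g0: "g 0 x = 0"
proof -
  have "f 0 = (\<lambda>_. 1)" by (simp add: f0 fun_eq_iff)
  then show ?thesis by (simp add: g_def)
qed

lemma g_Suc: "g (Suc n) x = g n x + of_real (a n) * V n x"
proof -
  have "((\<lambda>x. f n x + of_real (a n) * W n x) has_field_derivative g n x + of_real (a n) * V n x) (at x)"
    by (intro derivative_intros f_deriv W_deriv DERIV_cmult)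
  moreover have "f (Suc n) = (\<lambda>x. f n x + of_real (a n) * W n x)" by (simp add: f_Suc fun_eq_iff)
  ultimately show ?thesis using DERIV_unique[OF f_deriv] by metis
qed

lemma finf_deriv: "(finf has_field_derivative deriv finf x) (at x)"
  and g_tendsto: "(\<lambda>n. g n x) \<longlonglongrightarrow> deriv finf x"
proof -
  obtain g' where g': "\<forall>x. (finf has_field_derivative g' x) (at x) \<and> (\<lambda>n. g n x) \<longlonglongrightarrow> g' x"
    using has_complex_derivative_uniform_sequence[of UNIV f g finf] f_deriv uniform_limit_ball
    by auto
  then have "deriv finf x = g' x" using DERIV_imp_deriv by blast
  with g' show "(finf has_field_derivative deriv finf x) (at x)" "(\<lambda>n. g n x) \<longlonglongrightarrow> deriv finf x"
    by auto
qed

lemma finf_holomorphic: "finf holomorphic_on UNIV"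
  using finf_deriv by (auto simp: holomorphic_on_open)

text \<open>The right side is a Casoratian of the solution and its derivative in x. Advancing f and
  g leaves it unchanged; advancing W and V adds exactly the square with weight p (n + 1).\<close>

lemma christoffel_darboux:
  "(\<Sum>k\<le>n. of_real (p k) * (f k x)\<^sup>2) = W n x * g n x - V n x * f n x"
proof (induction n)
  case 0
  show ?case by (simp add: f0 g0 V_def)
next
  case (Suc n)
  have W1: "W (Suc n) x = W n x - x * of_real (p (Suc n)) * f (Suc n) x" by (simp add: W_eq algebra_simps)
  have V1: "V (Suc n) x = V n x - of_real (p (Suc n)) * f (Suc n) x - x * of_real (p (Suc n)) * g (Suc n) x"
    by (simp add: V_def algebra_simps)
  have "W n x * g n x - V n x * f n x = W n x * g (Suc n) x - V n x * f (Suc n) x"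
    by (simp add: f_Suc g_Suc algebra_simps)
  then have "(\<Sum>k\<le>Suc n. of_real (p k) * (f k x)\<^sup>2)
      = (W n x * g (Suc n) x - V n x * f (Suc n) x) + of_real (p (Suc n)) * (f (Suc n) x)\<^sup>2"
    by (simp add: Suc)
  also have "\<dots> = W (Suc n) x * g (Suc n) x - V (Suc n) x * f (Suc n) x"
    unfolding W1 V1 by (simp add: algebra_simps power2_eq_square)
  finally show ?case .
qed

lemma f_real: "f n (of_real x) = of_real (Re (f n (of_real x)))"
proof (induction n rule: less_induct)
  case (less n)
  show ?case
  proof (cases n)
    case 0
    then show ?thesis by (simp add: f0)
  next
    case (Suc m)
    have s: "(\<Sum>k\<le>m. of_real (p k) * f k (of_real x)) = complex_of_real (\<Sum>k\<le>m. p k * Re (f k (of_real x)))"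
      unfolding of_real_sum of_real_mult using less Suc by (intro sum.cong refl) (metis atMost_iff less_Suc_eq_le)
    have "f n (of_real x) = complex_of_real (Re (f m (of_real x)) + a m * (m0 - x * (\<Sum>k\<le>m. p k * Re (f k (of_real x)))))"
      unfolding Suc f_Suc W_eq s using less[of m] Suc by simp
    then show ?thesis by (metis Re_complex_of_real)
  qed
qed

lemma finf_simple_zero:
  assumes x: "0 < x" and z: "finf (of_real x) = 0"
  shows "deriv finf (of_real x) \<noteq> 0"
proof
  assume z': "deriv finf (of_real x) = 0"
  let ?x = "complex_of_real x"
  let ?F = "\<lambda>n. f n ?x" and ?G = "\<lambda>n. g n ?x"
  have F: "?F \<longlonglongrightarrow> 0" using f_tendsto[of ?x] z by simp
  have G: "?G \<longlonglongrightarrow> 0" using g_tendsto[of ?x] z' by simp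
  have sum_le: "norm (\<Sum>k\<le>n. of_real (p k) * h k) \<le> (\<Sum>k\<le>n. p k * norm (h k))"
    for h :: "nat \<Rightarrow> complex" and n
    by (rule sum_norm_le) (simp add: norm_mult p_nonneg)
  have nx: "norm (?x * y) = x * norm y" for y using x by (simp add: norm_mult)
  have "norm (W n ?x) \<le> m0 + x * (\<Sum>k\<le>n. p k * norm (?F k))" for n
  proof -
    have "norm (W n ?x) \<le> m0 + x * norm (\<Sum>k\<le>n. of_real (p k) * ?F k)"
      unfolding W_eq using norm_triangle_ineq4[of "of_real m0" "?x * (\<Sum>k\<le>n. of_real (p k) * ?F k)"] m0
      unfolding nx by simp
    also have "\<dots> \<le> m0 + x * (\<Sum>k\<le>n. p k * norm (?F k))"
      using sum_le[where h="?F" and n=n] x by (intro add_left_mono mult_left_mono) auto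
    finally show ?thesis .
  qed
  then obtain B where B: "0 \<le> B" "\<And>n. norm (W n ?x) \<le> B"
    using flux_bounded[OF F f_Suc, of m0 x] x m0 by blast
  \<comment> \<open>Once W is bounded, \<open>weighted_sum_le_tail\<close> applies with e = 0 and N
    = 0. The bound on this sum is the constant that \<open>flux_bounded\<close> needs for the
    differentiated system, where the sum appears as an inhomogeneous term.\<close>
  have pF: "(\<Sum>k\<le>n. p k * norm (?F k)) \<le> B * tail 0" for n
    using weighted_sum_le_tail[OF F f_Suc, of 0 B 0 n] B by (simp add: atLeast0AtMost)
  have BT: "0 \<le> B * tail 0"
    using pF[of 0] order_trans[OF _ pF[of 0]] p0 by (simp add: f0)
  have "norm (V n ?x) \<le> B * tail 0 + x * (\<Sum>k\<le>n. p k * norm (?G k))" for n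
  proof -
    have "norm (V n ?x) \<le> norm (\<Sum>k\<le>n. of_real (p k) * ?F k) + x * norm (\<Sum>k\<le>n. of_real (p k) * ?G k)"
      unfolding V_def using norm_triangle_ineq4[of "- (\<Sum>k\<le>n. of_real (p k) * ?F k)" "?x * (\<Sum>k\<le>n. of_real (p k) * ?G k)"]
      unfolding nx by simp
    also have "\<dots> \<le> B * tail 0 + x * (\<Sum>k\<le>n. p k * norm (?G k))"
      using order_trans[OF sum_le pF] sum_le[where h="?G" and n=n] x by (intro add_mono mult_left_mono) auto
    finally show ?thesis .
  qed
  then obtain B' where B': "\<And>n. norm (V n ?x) \<le> B'"
    using flux_bounded[OF G g_Suc, of "B * tail 0" x] x BT by blast
  have "(\<lambda>n. W n ?x * ?G n - V n ?x * ?F n) \<longlonglongrightarrow> 0 - 0"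
  proof (rule tendsto_diff)
    show "(\<lambda>n. W n ?x * ?G n) \<longlonglongrightarrow> 0"
      by (rule Lim_null_comparison[where g="\<lambda>n. B * norm (?G n)"])
         (use B G in \<open>auto simp: norm_mult intro!: always_eventually mult_right_mono tendsto_mult_right_zero tendsto_norm_zero\<close>)
    show "(\<lambda>n. V n ?x * ?F n) \<longlonglongrightarrow> 0"
      by (rule Lim_null_comparison[where g="\<lambda>n. B' * norm (?F n)"])
         (use B' F in \<open>auto simp: norm_mult intro!: always_eventually mult_right_mono tendsto_mult_right_zero tendsto_norm_zero\<close>)
  qed
  then have lim: "(\<lambda>n. Re (\<Sum>k\<le>n. of_real (p k) * (?F k)\<^sup>2)) \<longlonglongrightarrow> 0"
    unfolding christoffel_darboux using tendsto_Re by fastforce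
  \<comment> \<open>On the real axis all squares are nonnegative, and the term k = 0 equals p 0
    because f starts at 1. So the sum cannot tend to 0.\<close>
  have "p 0 \<le> Re (\<Sum>k\<le>n. of_real (p k) * (?F k)\<^sup>2)" for n
  proof -
    have eq: "of_real (p k) * (?F k)\<^sup>2 = of_real (p k * (Re (?F k))\<^sup>2)" for k
      by (subst f_real) simp
    have "p 0 * (Re (?F 0))\<^sup>2 \<le> (\<Sum>k\<le>n. p k * (Re (?F k))\<^sup>2)"
      by (rule member_le_sum) (auto simp: p_nonneg)
    then show ?thesis unfolding eq by (simp add: f0)
  qed
  then have "p 0 \<le> 0" using LIMSEQ_le_const[OF lim] by blast
  with p0 show False by simp
qed

text \<open>At x = 0 the flux stays constant at m0. With m0 = mu 0 and a the resistances this is the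
  factor 1 + mu_0 L_infinity of the limit formula.\<close>

lemma finf_0: "finf 0 = of_real (1 + m0 * suminf a)"
proof -
  have "(\<Sum>n. of_real (a n) * W n 0) = (\<Sum>n. of_real m0 * complex_of_real (a n))"
    by (simp add: W_eq mult.commute)
  also have "\<dots> = of_real (m0 * suminf a)"
    using summable_a by (simp add: suminf_mult suminf_of_real)
  finally show ?thesis by (simp add: finf_def)
qed

lemma finf_0_ge: "1 \<le> 1 + m0 * suminf a"
  using m0 a_nonneg summable_a by (simp add: suminf_nonneg)

lemma tail_tendsto: "tail \<longlonglongrightarrow> 0"
proof -
  have "tail = (\<lambda>N. \<Sum>m. a (m + N) * K (m + N))" by (simp add: tail_def fun_eq_iff)
  then show ?thesis using suminf_exist_split2[OF summ] by simp
qed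

lemma f_holomorphic: "f n holomorphic_on UNIV"
  using differentiable_f by (simp add: holomorphic_on_def field_differentiable_at_within)

end

section \<open>Abel sums on shrinking grids\<close>

definition mesh :: "nat \<Rightarrow> real" where "mesh N = 1 / real (Suc N)"

text \<open>A Riemann sum, on the grid of width \<open>mesh N\<close>, for the Laplace transform of
  \<phi> at \<theta>.\<close>

definition abel :: "real \<Rightarrow> (real \<Rightarrow> real) \<Rightarrow> nat \<Rightarrow> real" where
  "abel \<theta> \<phi> N = mesh N * (\<Sum>m. exp (- \<theta> * mesh N) ^ m * \<phi> (real m * mesh N))"

lemma mesh_pos: "0 < mesh N" by (simp add: mesh_def)

lemma mesh_tendsto: "mesh \<longlonglongrightarrow> 0"
  unfolding mesh_def by real_asymp

context
  fixes \<theta> :: real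
  assumes \<theta>: "0 < \<theta>"
begin

lemma mesh_exp: "0 < exp (- \<theta> * mesh N)" "exp (- \<theta> * mesh N) < 1"
  using \<theta> mesh_pos[of N] by auto

lemma summable_abel:
  assumes "\<And>t. 0 \<le> t \<Longrightarrow> \<bar>\<phi> t\<bar> \<le> b"
  shows "summable (\<lambda>m. norm (exp (- \<theta> * mesh N) ^ m * \<phi> (real m * mesh N)))"
    and "\<bar>\<Sum>m. exp (- \<theta> * mesh N) ^ m * \<phi> (real m * mesh N)\<bar> \<le> b / (1 - exp (- \<theta> * mesh N))"
proof -
  let ?z = "exp (- \<theta> * mesh N)"
  have g: "(\<lambda>m. ?z ^ m * b) sums (1 / (1 - ?z) * b)"
    by (intro sums_mult2 geometric_sums) (use mesh_exp in simp)
  have le: "norm (?z ^ m * \<phi> (real m * mesh N)) \<le> ?z ^ m * b" for m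
    using assms[of "real m * mesh N"] less_imp_le[OF mesh_pos[of N]] by (simp add: abs_mult)
  show s: "summable (\<lambda>m. norm (?z ^ m * \<phi> (real m * mesh N)))"
    by (rule summable_comparison_test'[OF sums_summable[OF g], of 0]) (use le in simp)
  have "\<bar>\<Sum>m. ?z ^ m * \<phi> (real m * mesh N)\<bar> \<le> (\<Sum>m. norm (?z ^ m * \<phi> (real m * mesh N)))"
    using summable_norm[OF s] by simp
  also have "\<dots> \<le> (\<Sum>m. ?z ^ m * b)"
    by (rule suminf_le[OF le s sums_summable[OF g]])
  finally show "\<bar>\<Sum>m. ?z ^ m * \<phi> (real m * mesh N)\<bar> \<le> b / (1 - ?z)"
    using sums_unique[OF g] by simp
qed

lemma abel_le:
  assumes "\<And>t. 0 \<le> t \<Longrightarrow> \<bar>\<phi> t\<bar> \<le> b"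
  shows "\<bar>abel \<theta> \<phi> N\<bar> \<le> b * (mesh N / (1 - exp (- \<theta> * mesh N)))"
  using mult_left_mono[OF summable_abel(2)[OF assms, where N=N] less_imp_le[OF mesh_pos[of N]]] mesh_pos[of N]
  by (simp add: abel_def abs_mult mult_ac)

lemma mesh_ratio_tendsto: "(\<lambda>N. mesh N / (1 - exp (- \<theta> * mesh N))) \<longlonglongrightarrow> 1 / \<theta>"
proof -
  have "(\<lambda>N. mesh N / (1 - exp (- \<theta> * mesh N))) \<longlonglongrightarrow> inverse \<theta>"
    unfolding mesh_def using \<theta> by real_asymp
  then show ?thesis by (simp add: inverse_eq_divide)
qed

lemma abel_bounded:
  assumes "\<And>t. 0 \<le> t \<Longrightarrow> \<bar>\<phi> t\<bar> \<le> b"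
  shows "Bseq (abel \<theta> \<phi>)"
proof -
  have "Bseq (\<lambda>N. b * (mesh N / (1 - exp (- \<theta> * mesh N))))"
    using tendsto_mult_left[OF mesh_ratio_tendsto] convergentI convergent_imp_Bseq by blast
  then obtain B where B: "\<And>N. norm (b * (mesh N / (1 - exp (- \<theta> * mesh N)))) \<le> B"
    by (auto simp: Bseq_def)
  have "norm (abel \<theta> \<phi> N) \<le> B" for N
    using order_trans[OF abel_le[where \<phi>=\<phi> and b=b, OF assms] order_trans[OF abs_ge_self B[unfolded real_norm_def]]]
    by simp
  then show ?thesis by (rule BseqI')
qed

lemma abel_lincomb:
  assumes "\<And>k t. k \<in> A \<Longrightarrow> 0 \<le> t \<Longrightarrow> \<bar>\<phi> k t\<bar> \<le> b"
  shows "abel \<theta> (\<lambda>t. \<Sum>k\<in>A. c k * \<phi> k t) N = (\<Sum>k\<in>A. c k * abel \<theta> (\<phi> k) N)"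
proof -
  let ?z = "exp (- \<theta> * mesh N)"
  have s: "summable (\<lambda>m. ?z ^ m * \<phi> k (real m * mesh N))" if "k \<in> A" for k
    by (rule summable_norm_cancel[OF summable_abel(1)[of "\<phi> k" b N]]) (use assms that in auto)
  have "(\<Sum>m. ?z ^ m * (\<Sum>k\<in>A. c k * \<phi> k (real m * mesh N)))
      = (\<Sum>m. \<Sum>k\<in>A. c k * (?z ^ m * \<phi> k (real m * mesh N)))"
    by (simp add: sum_distrib_left mult_ac)
  also have "\<dots> = (\<Sum>k\<in>A. \<Sum>m. c k * (?z ^ m * \<phi> k (real m * mesh N)))"
    by (rule suminf_sum) (use s in \<open>auto intro: summable_mult\<close>)
  also have "\<dots> = (\<Sum>k\<in>A. c k * (\<Sum>m. ?z ^ m * \<phi> k (real m * mesh N)))"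
    by (intro sum.cong refl suminf_mult s)
  finally show ?thesis unfolding abel_def by (simp add: sum_distrib_left mult_ac)
qed

text \<open>Summation by parts replaces the rule that the transform of the derivative is \<theta>
  times the transform minus the initial value. The Lipschitz bound on \<psi> makes each grid
  increment of \<phi> equal to h \<psi> up to c h^2; after weighting, the total error is of order
  h.\<close>

lemma abel_derivative:
  assumes d: "\<And>t. 0 \<le> t \<Longrightarrow> (\<phi> has_real_derivative \<psi> t) (at t within {0..})"
    and b: "\<And>t. 0 \<le> t \<Longrightarrow> \<bar>\<phi> t\<bar> \<le> b" and b': "\<And>t. 0 \<le> t \<Longrightarrow> \<bar>\<psi> t\<bar> \<le> b'"
    and lip: "\<And>t u. 0 \<le> t \<Longrightarrow> t \<le> u \<Longrightarrow> \<bar>\<psi> u - \<psi> t\<bar> \<le> c * (u - t)"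
  shows "(\<lambda>N. \<theta> * abel \<theta> \<phi> N - \<phi> 0 - abel \<theta> \<psi> N) \<longlonglongrightarrow> 0"
proof -
  have c0: "0 \<le> c" using lip[of 0 1] by simp
  have taylor: "\<bar>\<phi> (t + h) - \<phi> t - h * \<psi> t\<bar> \<le> c * h\<^sup>2" if t: "0 \<le> t" and h: "0 \<le> h" for t h
  proof -
    have "norm ((\<lambda>v. \<phi> v - v * \<psi> t) (t + h) - (\<lambda>v. \<phi> v - v * \<psi> t) t) \<le> (c * h) * norm (t + h - t)"
    proof (rule field_differentiable_bound[where S="{t..t+h}" and f'="\<lambda>v. \<psi> v - \<psi> t"])
      fix v assume v: "v \<in> {t..t+h}"
      have "(\<phi> has_real_derivative \<psi> v) (at v within {t..t+h})"
        by (rule DERIV_subset[OF d]) (use v t in auto)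
      then show "((\<lambda>v. \<phi> v - v * \<psi> t) has_real_derivative \<psi> v - \<psi> t) (at v within {t..t+h})"
        by (auto intro!: derivative_eq_intros)
      have "\<bar>\<psi> v - \<psi> t\<bar> \<le> c * (v - t)" using lip v t by auto
      also have "\<dots> \<le> c * h" using v c0 by (intro mult_left_mono) auto
      finally show "norm (\<psi> v - \<psi> t) \<le> c * h" by simp
    qed (use h in auto)
    then show ?thesis using h by (simp add: algebra_simps power2_eq_square)
  qed
  \<comment> \<open>Shifting the index produces (exp (\<theta> h) - 1) / h in place of \<theta> and
    exp (\<theta> h) in place of 1 before \<phi> 0. Subtracting these two discrepancies leaves
    exactly the weighted sum of the Taylor errors.\<close>
  define \<epsilon> where "\<epsilon> N = \<theta> * abel \<theta> \<phi> N - \<phi> 0 - abel \<theta> \<psi> N - (\<theta> - (exp (\<theta> * mesh N) - 1) / mesh N) * abel \<theta> \<phi> N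
     - (exp (\<theta> * mesh N) - 1) * \<phi> 0" for N
  have eps: "\<bar>\<epsilon> N\<bar> \<le> c * mesh N * (mesh N / (1 - exp (- \<theta> * mesh N)))" for N
  proof -
    let ?h = "mesh N" and ?z = "exp (- \<theta> * mesh N)"
    define E where "E m = \<phi> (real (Suc m) * ?h) - \<phi> (real m * ?h) - ?h * \<psi> (real m * ?h)" for m
    have E: "\<bar>E m\<bar> \<le> c * ?h\<^sup>2" for m
      using taylor[of "real m * ?h" ?h] mesh_pos[of N] unfolding E_def by (simp add: algebra_simps)
    have s\<phi>: "summable (\<lambda>m. ?z ^ m * \<phi> (real m * ?h))"
      by (rule summable_norm_cancel[OF summable_abel(1)[OF b]])
    have s\<psi>: "summable (\<lambda>m. ?z ^ m * \<psi> (real m * ?h))"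
      by (rule summable_norm_cancel[OF summable_abel(1)[OF b']])
    let ?S = "\<Sum>m. ?z ^ m * \<phi> (real m * ?h)"
    have "summable (\<lambda>m. ?z ^ Suc m * \<phi> (real (Suc m) * ?h))"
      using s\<phi> by (rule summable_Suc_iff[THEN iffD2])
    moreover have "(\<Sum>m. ?z ^ Suc m * \<phi> (real (Suc m) * ?h)) = ?S - \<phi> 0"
      using suminf_split_head[OF s\<phi>] by simp
    ultimately have "(\<lambda>m. ?z ^ Suc m * \<phi> (real (Suc m) * ?h)) sums (?S - \<phi> 0)"
      by (simp add: sums_iff)
    from sums_mult[OF this, of "exp (\<theta> * ?h)"]
    have "(\<lambda>m. ?z ^ m * \<phi> (real (Suc m) * ?h)) sums (exp (\<theta> * ?h) * (?S - \<phi> 0))"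
      by (simp add: mult.assoc[symmetric] exp_add[symmetric])
    from sums_diff[OF sums_diff[OF this summable_sums[OF s\<phi>]] sums_mult[OF summable_sums[OF s\<psi>], of ?h]]
    have "(\<lambda>m. ?z ^ m * E m) sums (exp (\<theta> * ?h) * (?S - \<phi> 0) - ?S - abel \<theta> \<psi> N)"
      unfolding E_def abel_def by (simp add: algebra_simps)
    moreover have "exp (\<theta> * ?h) * (?S - \<phi> 0) - ?S - abel \<theta> \<psi> N = \<epsilon> N"
      unfolding \<epsilon>_def abel_def[of \<theta> \<phi>] using mesh_pos[of N] by (simp add: field_simps)
    ultimately have sE: "(\<lambda>m. ?z ^ m * E m) sums \<epsilon> N" by simp
    have g: "(\<lambda>m. ?z ^ m * (c * ?h\<^sup>2)) sums (1 / (1 - ?z) * (c * ?h\<^sup>2))"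
      by (intro sums_mult2 geometric_sums) (use mesh_exp in simp)
    have le: "norm (?z ^ m * E m) \<le> ?z ^ m * (c * ?h\<^sup>2)" for m
      using E[of m] by (simp add: abs_mult)
    have sn: "summable (\<lambda>m. norm (?z ^ m * E m))"
      by (rule summable_comparison_test'[OF sums_summable[OF g], of 0]) (use le in simp)
    have "\<bar>\<epsilon> N\<bar> \<le> (\<Sum>m. norm (?z ^ m * E m))"
      using summable_norm[OF sn] sums_unique[OF sE] by simp
    also have "\<dots> \<le> 1 / (1 - ?z) * (c * ?h\<^sup>2)"
      using suminf_le[OF le sn sums_summable[OF g]] sums_unique[OF g] by simp
    finally show ?thesis by (simp add: power2_eq_square mult_ac)
  qed
  have "(\<lambda>N. c * mesh N * (mesh N / (1 - exp (- \<theta> * mesh N)))) \<longlonglongrightarrow> c * 0 * (1 / \<theta>)"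
    by (intro tendsto_intros mesh_tendsto mesh_ratio_tendsto)
  then have e0: "\<epsilon> \<longlonglongrightarrow> 0"
    by (intro Lim_null_comparison[where f=\<epsilon> and g="\<lambda>N. c * mesh N * (mesh N / (1 - exp (- \<theta> * mesh N)))"]) (use eps in auto)
  have z0: "(\<lambda>N. \<theta> - (exp (\<theta> * mesh N) - 1) / mesh N) \<longlonglongrightarrow> 0"
    unfolding mesh_def using \<theta> by real_asymp
  obtain B where B: "\<And>N. norm (abel \<theta> \<phi> N) \<le> B"
    using abel_bounded[where \<phi>=\<phi> and b=b, OF b] by (auto simp: Bseq_def)
  have e1: "(\<lambda>N. (\<theta> - (exp (\<theta> * mesh N) - 1) / mesh N) * abel \<theta> \<phi> N) \<longlonglongrightarrow> 0"
    by (rule lim_null_mult_right_bounded[where B=B, OF z0]) (intro always_eventually allI B)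
  have "(\<lambda>N. exp (\<theta> * mesh N) - 1) \<longlonglongrightarrow> 0"
    unfolding mesh_def using \<theta> by real_asymp
  then have e2: "(\<lambda>N. (exp (\<theta> * mesh N) - 1) * \<phi> 0) \<longlonglongrightarrow> 0"
    by (rule tendsto_mult_left_zero)
  have "(\<lambda>N. \<epsilon> N + (\<theta> - (exp (\<theta> * mesh N) - 1) / mesh N) * abel \<theta> \<phi> N + (exp (\<theta> * mesh N) - 1) * \<phi> 0) \<longlonglongrightarrow> 0 + 0 + 0"
    by (intro tendsto_add e0 e1 e2)
  moreover have "\<epsilon> N + (\<theta> - (exp (\<theta> * mesh N) - 1) / mesh N) * abel \<theta> \<phi> N + (exp (\<theta> * mesh N) - 1) * \<phi> 0
      = \<theta> * abel \<theta> \<phi> N - \<phi> 0 - abel \<theta> \<psi> N" for N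
    unfolding \<epsilon>_def by simp
  ultimately show ?thesis by simp
qed

end

section \<open>Hitting times of a Markov process\<close>

locale markov_from =
  fixes M :: "'a measure" and X :: "real \<Rightarrow> 'a \<Rightarrow> int" and P :: "real \<Rightarrow> nat \<Rightarrow> nat \<Rightarrow> real" and i :: nat
  assumes tf: "transition_function P" and mp: "markov_process_from M X P i"
begin

sublocale prob_space M
  using mp by (simp add: markov_process_from_def)

lemma P_nonneg: "0 \<le> t \<Longrightarrow> 0 \<le> P t j k"
  using tf by (simp add: transition_function_def)

lemma P_le_1: "0 \<le> t \<Longrightarrow> P t j k \<le> 1"
proof -
  assume t: "0 \<le> t"
  have "P t j k \<le> (\<Sum>l\<le>k. P t j l)"
    by (rule member_le_sum) (use P_nonneg t in auto)
  also have "\<dots> \<le> 1" using tf t by (simp add: transition_function_def)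
  finally show ?thesis .
qed

lemma X_measurable [measurable]: "0 \<le> t \<Longrightarrow> X t \<in> measurable M (count_space UNIV)"
  using mp by (simp add: markov_process_from_def)

lemma X_sets: "0 \<le> t \<Longrightarrow> {\<omega> \<in> space M. X t \<omega> = c} \<in> sets M"
  by measurable

lemma right_constant:
  "\<omega> \<in> space M \<Longrightarrow> 0 \<le> t \<Longrightarrow> \<exists>e>0. \<forall>u. t \<le> u \<and> u < t + e \<longrightarrow> X u \<omega> = X t \<omega>"
  using mp unfolding markov_process_from_def by blast

lemma fdd:
  assumes "ts 0 = 0" "js 0 = i" "\<And>m. m < k \<Longrightarrow> ts m \<le> ts (Suc m)"
  shows "prob {\<omega>\<in>space M. \<forall>m\<le>k. X (ts m) \<omega> = int (js m)}
          = (\<Prod>m<k. P (ts (Suc m) - ts m) (js m) (js (Suc m)))"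
  using mp assms unfolding markov_process_from_def by blast

lemma prob_start: "prob {\<omega>\<in>space M. X 0 \<omega> = int i} = 1"
  using fdd[of "\<lambda>_. 0" "\<lambda>_. i" 0] by simp

lemma AE_start: "AE \<omega> in M. X 0 \<omega> = int i"
  using prob_start AE_prob_1[of "{\<omega>\<in>space M. X 0 \<omega> = int i}"] by auto

text \<open>\<open>fdd\<close> speaks about events that include the start in i at time 0; since this
  has probability 1, it may be added or dropped.\<close>

lemma prob_start_conj:
  assumes "{\<omega>\<in>space M. Q \<omega>} \<in> sets M"
  shows "prob {\<omega>\<in>space M. X 0 \<omega> = int i \<and> Q \<omega>} = prob {\<omega>\<in>space M. Q \<omega>}"
proof (rule finite_measure_eq_AE)
  show "{\<omega>\<in>space M. X 0 \<omega> = int i \<and> Q \<omega>} \<in> sets M"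
  proof -
    have "{\<omega>\<in>space M. X 0 \<omega> = int i \<and> Q \<omega>} = {\<omega>\<in>space M. X 0 \<omega> = int i} \<inter> {\<omega>\<in>space M. Q \<omega>}"
      by auto
    then show ?thesis using X_sets[of 0 "int i"] assms by (simp only: sets.Int order_refl)
  qed
  show "AE \<omega> in M. (\<omega> \<in> {\<omega>\<in>space M. X 0 \<omega> = int i \<and> Q \<omega>}) = (\<omega> \<in> {\<omega>\<in>space M. Q \<omega>})"
    using AE_start by eventually_elim simp
qed (rule assms)

lemma prob_at:
  assumes "0 \<le> t"
  shows "prob {\<omega>\<in>space M. X t \<omega> = int n} = P t i n"
proof -
  define ts where "ts m = (if m = 0 then 0 else t)" for m :: nat
  define js where "js m = (if m = 0 then i else n)" for m :: nat
  have "prob {\<omega>\<in>space M. X t \<omega> = int n} = prob {\<omega>\<in>space M. X 0 \<omega> = int i \<and> X t \<omega> = int n}"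
    by (rule prob_start_conj[symmetric]) (rule X_sets[OF assms])
  also have "\<dots> = prob {\<omega>\<in>space M. \<forall>m\<le>1. X (ts m) \<omega> = int (js m)}"
  proof -
    have "(\<forall>m\<le>1. X (ts m) \<omega> = int (js m)) \<longleftrightarrow> X 0 \<omega> = int i \<and> X t \<omega> = int n" for \<omega>
      by (auto simp: le_Suc_eq ts_def js_def)
    then show ?thesis by simp
  qed
  also have "\<dots> = P t i n"
    using fdd[of ts js 1] assms by (simp add: ts_def js_def)
  finally show ?thesis .
qed

section \<open>Renewal at the times of a grid\<close>

context
  fixes h :: real and n :: nat
  assumes h: "0 < h"
begin

definition hits :: "nat set \<Rightarrow> nat set \<Rightarrow> 'a set" where
  "hits A S = {\<omega>\<in>space M. (\<forall>a\<in>A. X (h * real a) \<omega> = int n) \<and> (\<forall>a\<in>S. X (h * real a) \<omega> \<noteq> int n)}"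

lemma h_nonneg: "0 \<le> h * real a" using h by simp

lemma hits_sets: "finite A \<Longrightarrow> finite S \<Longrightarrow> hits A S \<in> sets M"
proof -
  assume "finite A" "finite S"
  have 1: "{\<omega>\<in>space M. \<forall>a\<in>A. X (h * real a) \<omega> = int n} \<in> sets M"
    by (rule sets.sets_Collect_finite_All) (use X_sets h_nonneg \<open>finite A\<close> in auto)
  have 2: "{\<omega>\<in>space M. \<forall>a\<in>S. X (h * real a) \<omega> \<noteq> int n} \<in> sets M"
    by (rule sets.sets_Collect_finite_All) (use X_sets h_nonneg \<open>finite S\<close> in \<open>auto intro: sets.sets_Collect_neg\<close>)
  show ?thesis unfolding hits_def using sets.sets_Collect_conj[OF 2 1] .
qed

lemma renewal_hits_only:
  assumes A: "A \<subseteq> {..k}" and k: "k \<in> A" and m: "k \<le> m"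
  shows "prob (hits (insert m A) {}) = prob (hits A {}) * P (h * real (m - k)) n n"
proof -
  \<comment> \<open>\<open>fdd\<close> wants the times as a monotone sequence. Instead of
    enumerating A, each index is sent to the next element of A; repeated times are harmless.\<close>
  define nxt where "nxt j = (LEAST a. a \<in> A \<and> j \<le> a)" for j
  have nxt: "nxt j \<in> A \<and> j \<le> nxt j" if "j \<le> k" for j
    unfolding nxt_def by (rule LeastI[of _ k]) (use that k in auto)
  have nxt_le: "nxt j \<le> a" if "a \<in> A" "j \<le> a" for j a
    unfolding nxt_def by (rule Least_le) (use that in auto)
  have nxt_id: "nxt a = a" if "a \<in> A" for a
    using nxt[of a] nxt_le[of a a] that A by (auto intro: antisym)
  \<comment> \<open>Slot 0 is the start, slot j + 1 belongs to grid index j, and slot k + 2 is the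
    additional time m. The products for A and for \<open>insert m A\<close> thus differ by their
    last factor.\<close>
  define ts where "ts j = (if j = 0 then 0 else if j \<le> Suc k then h * real (nxt (j - 1)) else h * real m)" for j
  define js where "js j = (if j = 0 then i else n)" for j :: nat
  have mono: "ts j \<le> ts (Suc j)" if "j < Suc (Suc k)" for j
  proof -
    have "j = 0 \<or> (1 \<le> j \<and> j \<le> k) \<or> j = Suc k" using that by arith
    then consider "j = 0" | "1 \<le> j \<and> j \<le> k" | "j = Suc k" by blast
    then show ?thesis
    proof cases
      case 1
      then show ?thesis using h_nonneg by (simp add: ts_def)
    next
      case 2
      have "nxt (j - 1) \<le> nxt j" by (rule nxt_le) (use nxt[of j] 2 in auto)
      then show ?thesis using 2 h by (simp add: ts_def)
    next
      case 3
      then show ?thesis using h m by (simp add: ts_def nxt_id[OF k])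
    qed
  qed
  have start: "ts 0 = 0" "js 0 = i" by (simp_all add: ts_def js_def)
  have ev: "(\<forall>j\<le>Suc k. X (ts j) \<omega> = int (js j)) \<longleftrightarrow> X 0 \<omega> = int i \<and> (\<forall>a\<in>A. X (h * real a) \<omega> = int n)" for \<omega>
  proof safe
    assume H: "\<forall>j\<le>Suc k. X (ts j) \<omega> = int (js j)"
    show "X 0 \<omega> = int i" using H[rule_format, of 0] by (simp add: ts_def js_def)
    fix a assume a: "a \<in> A"
    then have "a \<le> k" using A by auto
    then show "X (h * real a) \<omega> = int n"
      using H[rule_format, of "Suc a"] nxt_id[OF a] by (simp add: ts_def js_def)
  next
    fix j assume H: "X 0 \<omega> = int i" "\<forall>a\<in>A. X (h * real a) \<omega> = int n" "j \<le> Suc k"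
    show "X (ts j) \<omega> = int (js j)"
    proof (cases j)
      case 0
      then show ?thesis using H by (simp add: ts_def js_def)
    next
      case (Suc j')
      then show ?thesis using H nxt[of j'] by (simp add: ts_def js_def)
    qed
  qed
  have fin: "finite A" using A finite_subset by blast
  have e1: "prob (hits A {}) = prob {\<omega>\<in>space M. \<forall>j\<le>Suc k. X (ts j) \<omega> = int (js j)}"
    unfolding ev using hits_sets[OF fin, of "{}"]
    by (subst prob_start_conj) (simp_all add: hits_def)
  have ev2: "(\<forall>j\<le>Suc (Suc k). X (ts j) \<omega> = int (js j)) \<longleftrightarrow>
      X 0 \<omega> = int i \<and> (\<forall>a\<in>insert m A. X (h * real a) \<omega> = int n)" for \<omega>
  proof -
    have "(\<forall>j\<le>Suc (Suc k). R j) \<longleftrightarrow> (\<forall>j\<le>Suc k. R j) \<and> R (Suc (Suc k))" for R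
      by (auto simp: le_Suc_eq)
    moreover have "ts (Suc (Suc k)) = h * real m" "js (Suc (Suc k)) = n" by (simp_all add: ts_def js_def)
    ultimately show ?thesis using ev[of \<omega>] by auto
  qed
  have e2: "prob (hits (insert m A) {}) = prob {\<omega>\<in>space M. \<forall>j\<le>Suc (Suc k). X (ts j) \<omega> = int (js j)}"
    unfolding ev2 using hits_sets[of "insert m A" "{}"] fin
    by (subst prob_start_conj) (simp_all add: hits_def)
  have "prob {\<omega>\<in>space M. \<forall>j\<le>Suc k. X (ts j) \<omega> = int (js j)} =
      (\<Prod>j<Suc k. P (ts (Suc j) - ts j) (js j) (js (Suc j)))"
    by (rule fdd[of ts js, OF start]) (simp_all add: mono)
  moreover have "prob {\<omega>\<in>space M. \<forall>j\<le>Suc (Suc k). X (ts j) \<omega> = int (js j)} =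
      (\<Prod>j<Suc (Suc k). P (ts (Suc j) - ts j) (js j) (js (Suc j)))"
    by (rule fdd[of ts js, OF start]) (simp_all add: mono)
  moreover have "P (ts (Suc (Suc k)) - ts (Suc k)) (js (Suc k)) (js (Suc (Suc k))) = P (h * real (m - k)) n n"
    using m by (simp add: ts_def js_def nxt_id[OF k] of_nat_diff algebra_simps)
  ultimately show ?thesis unfolding e1 e2 by simp
qed

text \<open>The Markov property at time k for a past with forbidden visits. A forbidden time x is
  removed by subtracting the event in which x is a required visit, and the induction hypothesis
  covers both terms because A is arbitrary.\<close>

lemma renewal_hits:
  assumes "finite S" "S \<subseteq> {..k}" and A: "A \<subseteq> {..k}" "k \<in> A" and m: "k \<le> m"
  shows "prob (hits (insert m A) S) = prob (hits A S) * P (h * real (m - k)) n n"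
  using assms(1,2) A
proof (induction S arbitrary: A rule: finite_induct)
  case empty
  then show ?case using renewal_hits_only m by simp
next
  case (insert x S)
  have fin: "finite A" using insert finite_subset by blast
  have "hits A (insert x S) = hits A S - hits (insert x A) S" for A
    by (auto simp: hits_def)
  then have d: "prob (hits A (insert x S)) = prob (hits A S) - prob (hits (insert x A) S)" if "finite A" for A
    using finite_measure_Diff[OF hits_sets[of A S] hits_sets[of "insert x A" S]] that insert(1)
    by (auto simp: hits_def)
  have "prob (hits (insert m A) (insert x S)) = prob (hits (insert m A) S) - prob (hits (insert m (insert x A)) S)"
    using d[of "insert m A"] fin by (simp add: insert_commute)
  also have "\<dots> = prob (hits A S) * P (h * real (m - k)) n n - prob (hits (insert x A) S) * P (h * real (m - k)) n n"
    using insert.IH[of A] insert.IH[of "insert x A"] insert.prems by simp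
  also have "\<dots> = prob (hits A (insert x S)) * P (h * real (m - k)) n n"
    unfolding d[OF fin] by (simp add: algebra_simps)
  finally show ?case .
qed

definition first_hit :: "nat \<Rightarrow> 'a set" where "first_hit k = hits {k} {..<k}"

lemma first_hit_sets: "first_hit k \<in> sets M"
  unfolding first_hit_def by (rule hits_sets) auto

lemma first_hit_unique: "\<omega> \<in> first_hit k \<Longrightarrow> \<omega> \<in> first_hit l \<Longrightarrow> k = l"
  unfolding first_hit_def hits_def by (cases k l rule: linorder_cases) auto

lemma first_hit_exists:
  assumes "\<omega> \<in> space M" "X (h * real m) \<omega> = int n"
  shows "\<exists>k\<le>m. \<omega> \<in> first_hit k"
proof -
  let ?k = "LEAST k. X (h * real k) \<omega> = int n"
  have "X (h * real ?k) \<omega> = int n" by (rule LeastI[of _ m]) (rule assms)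
  moreover have "\<forall>j<?k. X (h * real j) \<omega> \<noteq> int n" using not_less_Least by blast
  moreover have "?k \<le> m" by (rule Least_le) (rule assms)
  ultimately show ?thesis using assms(1) unfolding first_hit_def hits_def by auto
qed

lemma renewal: "P (h * real m) i n = (\<Sum>k\<le>m. prob (first_hit k) * P (h * real (m - k)) n n)"
proof -
  have "P (h * real m) i n = prob {\<omega>\<in>space M. X (h * real m) \<omega> = int n}"
    using prob_at h_nonneg by simp
  also have "{\<omega>\<in>space M. X (h * real m) \<omega> = int n} = (\<Union>k\<in>{..m}. hits (insert m {k}) {..<k})"
  proof safe
    fix \<omega> assume "\<omega> \<in> space M" "X (h * real m) \<omega> = int n"
    then show "\<omega> \<in> (\<Union>k\<in>{..m}. hits (insert m {k}) {..<k})"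
      using first_hit_exists[of \<omega> m] by (fastforce simp: first_hit_def hits_def)
  qed (auto simp: hits_def)
  also have "prob \<dots> = (\<Sum>k\<le>m. prob (hits (insert m {k}) {..<k}))"
  proof (rule finite_measure_finite_Union)
    show "disjoint_family_on (\<lambda>k. hits (insert m {k}) {..<k}) {..m}"
      unfolding disjoint_family_on_def
      by (auto simp: hits_def) (metis lessThan_iff linorder_neqE_nat)
  qed (auto intro: hits_sets)
  also have "\<dots> = (\<Sum>k\<le>m. prob (first_hit k) * P (h * real (m - k)) n n)"
    unfolding first_hit_def by (intro sum.cong refl renewal_hits) auto
  finally show ?thesis .
qed

text \<open>At most one term of the series is nonzero: the value is z to the index of the first grid
  visit, and 0 if there is none. The series form gives measurability and termwise
  integration.\<close>

definition grid_laplace :: "real \<Rightarrow> 'a \<Rightarrow> real" where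
  "grid_laplace z \<omega> = (\<Sum>k. z ^ k * indicator (first_hit k) \<omega>)"

lemma grid_laplace_eq:
  assumes "\<omega> \<in> first_hit k" shows "grid_laplace z \<omega> = z ^ k"
proof -
  have *: "z ^ l * indicator (first_hit l) \<omega> = (if l = k then z ^ k else 0)" for l
  proof (cases "l = k")
    case False
    then have "\<omega> \<notin> first_hit l" using first_hit_unique[OF assms] by metis
    with False show ?thesis by simp
  qed (use assms in simp)
  have "grid_laplace z \<omega> = (\<Sum>l. if l = k then z ^ k else 0)"
    unfolding grid_laplace_def * by (rule refl)
  also have "\<dots> = z ^ k" using sums_unique[OF sums_single[of k "\<lambda>_. z ^ k"]] by simp
  finally show ?thesis .
qed

lemma grid_laplace_0: "(\<And>k. \<omega> \<notin> first_hit k) \<Longrightarrow> grid_laplace z \<omega> = 0"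
  by (simp add: grid_laplace_def)

lemma grid_laplace_measurable: "grid_laplace z \<in> borel_measurable M"
proof -
  note [measurable] = first_hit_sets
  show ?thesis unfolding grid_laplace_def by measurable
qed

lemma grid_laplace_bounds:
  assumes "0 < z" "z < 1" shows "0 \<le> grid_laplace z \<omega>" "grid_laplace z \<omega> \<le> 1"
proof -
  have "0 \<le> grid_laplace z \<omega> \<and> grid_laplace z \<omega> \<le> 1"
  proof (cases "\<exists>k. \<omega> \<in> first_hit k")
    case True
    then obtain k where "\<omega> \<in> first_hit k" by blast
    from grid_laplace_eq[OF this] show ?thesis using assms by (simp add: power_le_one)
  qed (simp add: grid_laplace_0)
  then show "0 \<le> grid_laplace z \<omega>" "grid_laplace z \<omega> \<le> 1" by auto
qed

text \<open>The renewal identity is a convolution, so its generating function is a Cauchy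
  product.\<close>

lemma abel_renewal:
  assumes z: "0 < z" "z < 1"
  shows "(\<Sum>m. z ^ m * P (h * real m) i n) = expectation (grid_laplace z) * (\<Sum>m. z ^ m * P (h * real m) n n)"
proof -
  have sz: "summable (\<lambda>k. z ^ k)" using z by (intro summable_geometric) simp
  have s1: "summable (\<lambda>k. norm (z ^ k * prob (first_hit k)))"
    by (rule summable_comparison_test'[OF sz, of 0]) (use z in \<open>auto simp: abs_mult intro!: mult_left_le\<close>)
  have s2: "summable (\<lambda>k. norm (z ^ k * P (h * real k) n n))"
    by (rule summable_comparison_test'[OF sz, of 0])
       (use z P_nonneg[OF h_nonneg] P_le_1[OF h_nonneg] in \<open>auto simp: abs_mult intro!: mult_left_le\<close>)
  have int: "integrable M (\<lambda>\<omega>. z ^ k * indicator (first_hit k) \<omega>)" for k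
    using first_hit_sets by (intro integrable_mult_right integrable_real_indicator) (auto simp: emeasure_eq_measure)
  have "expectation (grid_laplace z) = (\<Sum>k. expectation (\<lambda>\<omega>. z ^ k * indicator (first_hit k) \<omega>))"
    unfolding grid_laplace_def
  proof (rule integral_suminf[OF int])
    show "AE \<omega> in M. summable (\<lambda>k. norm (z ^ k * indicator (first_hit k) \<omega>))"
      using z by (intro AE_I2 summable_comparison_test'[OF sz, of 0]) (auto simp: indicator_def)
    have "(\<integral>\<omega>. norm (z ^ k * indicator (first_hit k) \<omega>) \<partial>M) = norm (z ^ k * prob (first_hit k))" for k
      using z first_hit_sets[of k] by (simp add: abs_mult)
    then show "summable (\<lambda>k. \<integral>\<omega>. norm (z ^ k * indicator (first_hit k) \<omega>) \<partial>M)" using s1 by presburger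
  qed
  also have "\<dots> = (\<Sum>k. z ^ k * prob (first_hit k))"
    using first_hit_sets by simp
  finally have e: "expectation (grid_laplace z) = (\<Sum>k. z ^ k * prob (first_hit k))" .
  have conv: "(\<Sum>k\<le>m. (z ^ k * prob (first_hit k)) * (z ^ (m - k) * P (h * real (m - k)) n n)) = z ^ m * P (h * real m) i n" for m
    unfolding renewal[of m] sum_distrib_left
  proof (intro sum.cong refl)
    fix k assume "k \<in> {..m}"
    then have "z ^ m = z ^ k * z ^ (m - k)" by (simp add: power_add[symmetric])
    then show "(z ^ k * prob (first_hit k)) * (z ^ (m - k) * P (h * real (m - k)) n n)
        = z ^ m * (prob (first_hit k) * P (h * real (m - k)) n n)" by simp
  qed
  have "(\<Sum>k. z ^ k * prob (first_hit k)) * (\<Sum>k. z ^ k * P (h * real k) n n)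
      = (\<Sum>m. \<Sum>k\<le>m. (z ^ k * prob (first_hit k)) * (z ^ (m - k) * P (h * real (m - k)) n n))"
    by (rule Cauchy_product[OF s1 s2])
  then show ?thesis unfolding e conv by simp
qed

end

section \<open>From grid visits to hitting times\<close>

lemma grid_laplace_tendsto:
  assumes \<theta>: "0 < \<theta>" and \<omega>: "\<omega> \<in> space M"
  shows "(\<lambda>N. grid_laplace (mesh N) n (exp (- \<theta> * mesh N)) \<omega>) \<longlonglongrightarrow>
     (if \<exists>t\<ge>0. X t \<omega> = int n then exp (- \<theta> * Inf {t. 0 \<le> t \<and> X t \<omega> = int n}) else 0)"
proof (cases "\<exists>t\<ge>0. X t \<omega> = int n")
  case False
  have "grid_laplace (mesh N) n (exp (- \<theta> * mesh N)) \<omega> = 0" for N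
  proof (rule grid_laplace_0[OF mesh_pos])
    show "\<omega> \<notin> first_hit (mesh N) n k" for k
      using False mesh_pos[of N] unfolding first_hit_def[OF mesh_pos] hits_def[OF mesh_pos] by auto
  qed
  then show ?thesis unfolding if_not_P[OF False] by simp
next
  case True
  define H where "H = {t. 0 \<le> t \<and> X t \<omega> = int n}"
  define T where "T = Inf H"
  have H: "H \<noteq> {}" "bdd_below H" using True by (auto simp: H_def intro: bdd_belowI[of _ 0])
  have le: "T \<le> t" if "t \<in> H" for t unfolding T_def using H(2) that by (rule cInf_lower[rotated])
  \<comment> \<open>Here right-constancy enters: the path stays in n for some time d after a visit,
    so a grid finer than d cannot miss it. Grid visits never precede T.\<close>
  have ex: "eventually (\<lambda>N. \<exists>k. \<omega> \<in> first_hit (mesh N) n k \<and> T \<le> mesh N * real k \<and> mesh N * real k < T + e) sequentially"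
    if e: "0 < e" for e
  proof -
    obtain t where t: "t \<in> H" "t < T + e / 2"
      using cInf_lessD[OF H(1), of "T + e / 2"] e unfolding T_def by auto
    obtain d where d: "0 < d" "\<And>u. t \<le> u \<Longrightarrow> u < t + d \<Longrightarrow> X u \<omega> = int n"
      using right_constant[OF \<omega>, of t] t(1) unfolding H_def by auto
    have "eventually (\<lambda>N. mesh N < min d (e / 2)) sequentially"
      using order_tendstoD(2)[OF mesh_tendsto, of "min d (e / 2)"] d e by simp
    then show ?thesis
    proof eventually_elim
      case (elim N)
      have t0: "0 \<le> t" using t(1) by (simp add: H_def)
      let ?m = "nat \<lceil>t / mesh N\<rceil>"
      have m: "t / mesh N \<le> real ?m" "real ?m < t / mesh N + 1"
        using t0 mesh_pos[of N] by (auto simp: of_nat_nat le_of_int_ceiling) linarith+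
      then have m': "t \<le> mesh N * real ?m" "mesh N * real ?m < t + mesh N"
        using mesh_pos[of N] by (auto simp: field_simps)
      then have "X (mesh N * real ?m) \<omega> = int n" using d(2) elim by auto
      then obtain k where k: "k \<le> ?m" "\<omega> \<in> first_hit (mesh N) n k"
        using first_hit_exists[OF mesh_pos \<omega>] by blast
      have "mesh N * real k \<in> H"
        using k(2) mesh_pos[of N] unfolding first_hit_def[OF mesh_pos] hits_def[OF mesh_pos] H_def by auto
      moreover have "mesh N * real k \<le> mesh N * real ?m"
        using k(1) mesh_pos[of N] by simp
      ultimately have "T \<le> mesh N * real k" "mesh N * real k < T + e"
        using le m'(2) t(2) elim by (simp, linarith)
      with k(2) show ?case by blast
    qed
  qed
  define L where "L N = (THE k. \<omega> \<in> first_hit (mesh N) n k)" for N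
  have L: "L N = k" if "\<omega> \<in> first_hit (mesh N) n k" for N k
    unfolding L_def using that first_hit_unique[OF mesh_pos] by blast
  have lim: "(\<lambda>N. mesh N * real (L N)) \<longlonglongrightarrow> T"
  proof (rule LIMSEQ_I)
    fix e :: real assume "0 < e"
    from ex[OF this] have "eventually (\<lambda>N. norm (mesh N * real (L N) - T) < e) sequentially"
      by eventually_elim (use L in auto)
    then show "\<exists>no. \<forall>N\<ge>no. norm (mesh N * real (L N) - T) < e" by (simp add: eventually_sequentially)
  qed
  have "eventually (\<lambda>N. exp (- \<theta> * (mesh N * real (L N))) = grid_laplace (mesh N) n (exp (- \<theta> * mesh N)) \<omega>) sequentially"
    using ex[of 1, simplified]
  proof eventually_elim
    case (elim N)
    then obtain k where k: "\<omega> \<in> first_hit (mesh N) n k" by blast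
    show ?case unfolding grid_laplace_eq[OF mesh_pos k] L[OF k]
      by (simp add: exp_of_nat_mult[symmetric] mult_ac)
  qed
  moreover have "(\<lambda>N. exp (- \<theta> * (mesh N * real (L N)))) \<longlonglongrightarrow> exp (- \<theta> * T)"
    by (intro tendsto_intros lim)
  ultimately have "(\<lambda>N. grid_laplace (mesh N) n (exp (- \<theta> * mesh N)) \<omega>) \<longlonglongrightarrow> exp (- \<theta> * T)"
    by (rule Lim_transform_eventually[rotated])
  then show ?thesis using True by (simp add: T_def H_def)
qed

text \<open>Dominated convergence with bound 1. Measurability of the hitting functional, which
  quantifies over uncountably many times, is inherited from the grid functionals as their pointwise
  limit.\<close>

lemma hit_laplace_tendsto:
  assumes \<theta>: "0 < \<theta>"
  shows "(\<lambda>N. expectation (grid_laplace (mesh N) n (exp (- \<theta> * mesh N)))) \<longlonglongrightarrow> hit_laplace M X n (- \<theta>)"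
  unfolding hit_laplace_def
proof (rule integral_dominated_convergence[where w="\<lambda>_. 1"])
  let ?F = "\<lambda>\<omega>. if \<exists>t\<ge>0. X t \<omega> = int n then exp (- \<theta> * Inf {t. 0 \<le> t \<and> X t \<omega> = int n}) else 0"
  show "grid_laplace (mesh N) n (exp (- \<theta> * mesh N)) \<in> borel_measurable M" for N
    by (rule grid_laplace_measurable[OF mesh_pos])
  then show "?F \<in> borel_measurable M"
    by (rule borel_measurable_LIMSEQ_real[rotated]) (rule grid_laplace_tendsto[OF \<theta>])
  show "AE \<omega> in M. (\<lambda>N. grid_laplace (mesh N) n (exp (- \<theta> * mesh N)) \<omega>) \<longlonglongrightarrow> ?F \<omega>"
    by (intro AE_I2 grid_laplace_tendsto[OF \<theta>])
  show "AE \<omega> in M. norm (grid_laplace (mesh N) n (exp (- \<theta> * mesh N)) \<omega>) \<le> 1" for N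
    using grid_laplace_bounds[where n=n, OF mesh_pos[of N] mesh_exp[OF \<theta>, of N]] by (intro AE_I2) simp
qed simp

text \<open>On each grid the relation is exact with \<open>e N\<close> as factor; replacing
  \<open>e N\<close> by its limit costs a null sequence times a bounded one. The difference form
  avoids any claim that the Abel sums converge.\<close>

lemma abel_hit:
  assumes \<theta>: "0 < \<theta>"
  shows "(\<lambda>N. abel \<theta> (\<lambda>t. P t i n) N - hit_laplace M X n (- \<theta>) * abel \<theta> (\<lambda>t. P t n n) N) \<longlonglongrightarrow> 0"
    and "0 \<le> hit_laplace M X n (- \<theta>)" "hit_laplace M X n (- \<theta>) \<le> 1"
proof -
  define e where "e N = expectation (grid_laplace (mesh N) n (exp (- \<theta> * mesh N)))" for N
  have lim: "e \<longlonglongrightarrow> hit_laplace M X n (- \<theta>)"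
    unfolding e_def by (rule hit_laplace_tendsto[OF \<theta>])
  have int: "integrable M (grid_laplace (mesh N) n (exp (- \<theta> * mesh N)))" for N
    by (rule integrable_const_bound[where B=1])
       (use grid_laplace_bounds[where n=n, OF mesh_pos[of N] mesh_exp[OF \<theta>, of N]] grid_laplace_measurable[OF mesh_pos] in auto)
  have e: "0 \<le> e N" "e N \<le> 1" for N
  proof -
    show "0 \<le> e N" unfolding e_def
      by (intro Bochner_Integration.integral_nonneg grid_laplace_bounds(1)[OF mesh_pos mesh_exp[OF \<theta>]])
    have "e N \<le> expectation (\<lambda>_. 1)" unfolding e_def
      by (intro Bochner_Integration.integral_mono int integrable_const grid_laplace_bounds(2)[OF mesh_pos mesh_exp[OF \<theta>]])
    then show "e N \<le> 1" by (simp add: prob_space)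
  qed
  show "0 \<le> hit_laplace M X n (- \<theta>)" by (rule LIMSEQ_le_const[OF lim]) (use e in auto)
  show "hit_laplace M X n (- \<theta>) \<le> 1" by (rule LIMSEQ_le_const2[OF lim]) (use e in auto)
  have "abel \<theta> (\<lambda>t. P t i n) N = e N * abel \<theta> (\<lambda>t. P t n n) N" for N
    using abel_renewal[where n=n, OF mesh_pos[of N] mesh_exp[OF \<theta>, of N]]
    by (simp add: abel_def e_def mult.commute[of _ "mesh N"])
  then have eq: "abel \<theta> (\<lambda>t. P t i n) N - hit_laplace M X n (- \<theta>) * abel \<theta> (\<lambda>t. P t n n) N
     = (e N - hit_laplace M X n (- \<theta>)) * abel \<theta> (\<lambda>t. P t n n) N" for N
    by (simp add: algebra_simps)
  have "Bseq (abel \<theta> (\<lambda>t. P t n n))"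
    by (rule abel_bounded[OF \<theta>, where b=1]) (use P_nonneg P_le_1 in auto)
  then obtain B where B: "\<And>N. norm (abel \<theta> (\<lambda>t. P t n n) N) \<le> B" by (auto simp: Bseq_def)
  have "(\<lambda>N. e N - hit_laplace M X n (- \<theta>)) \<longlonglongrightarrow> 0" using lim by (rule LIM_zero)
  then show "(\<lambda>N. abel \<theta> (\<lambda>t. P t i n) N - hit_laplace M X n (- \<theta>) * abel \<theta> (\<lambda>t. P t n n) N) \<longlonglongrightarrow> 0"
    unfolding eq by (rule lim_null_mult_right_bounded[where B=B]) (intro always_eventually allI B)
qed

end

section \<open>The limiting entire functions\<close>

lemma (in zero_array) reciprocal_entire:
  assumes "F holomorphic_on UNIV" "\<And>i. deriv F (of_real (xi i)) \<noteq> 0" "\<And>i. b (Suc i) = xi i"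
  shows "reciprocal_entire_simple_pos_zeros b"
proof -
  have "deriv F z \<noteq> 0" if "F z = 0" for z
  proof -
    from that obtain i where "z = of_real (xi i)" using F_zeros by blast
    then show ?thesis using assms(2) by simp
  qed
  then show ?thesis
    unfolding reciprocal_entire_simple_pos_zeros_def assms(3)
    using assms(1) F_neg(1) F_zeros xi_pos by (intro exI[of _ F]) simp
qed

text \<open>Transfers the factorisation of \<open>bdQ\<close>, known for real arguments, to the
  complex extension.\<close>

lemma holomorphic_eqI_reals:
  assumes "f holomorphic_on UNIV" "g holomorphic_on UNIV" "\<And>x. f (complex_of_real x) = g (of_real x)"
  shows "f z = g z"
proof -
  have l: "0 islimpt range complex_of_real"
    unfolding islimpt_approachable
  proof (intro allI impI)
    fix e :: real assume "0 < e"
    then show "\<exists>x'\<in>range complex_of_real. x' \<noteq> 0 \<and> dist x' 0 < e"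
      by (intro bexI[OF _ rangeI[of _ "e / 2"]]) (simp add: norm_divide)
  qed
  have "f z - g z = 0"
    by (rule analytic_continuation[where f="\<lambda>z. f z - g z" and S=UNIV and U="range complex_of_real" and \<xi>=0])
       (use assms l in \<open>auto intro!: holomorphic_intros\<close>)
  then show ?thesis by simp
qed

text \<open>A weighted Cesaro theorem. It is applied to Q^(1)_n divided by its value at 0, which is
  a mean of the dual solution with the resistances as weights.\<close>

lemma weighted_mean_tendsto:
  fixes c :: "nat \<Rightarrow> complex"
  assumes p: "\<And>k. 0 \<le> p k" and K: "filterlim (\<lambda>n. \<Sum>k\<le>n. p k) at_top sequentially" and c: "c \<longlonglongrightarrow> l"
  shows "(\<lambda>n. (\<Sum>k\<le>n. of_real (p k) * c k) / of_real (\<Sum>k\<le>n. p k)) \<longlonglongrightarrow> l"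
proof (rule LIMSEQ_I)
  fix e :: real assume e: "0 < e"
  obtain N where N: "\<And>k. k \<ge> N \<Longrightarrow> norm (c k - l) < e / 2"
    using LIMSEQ_D[OF c, of "e / 2"] e by auto
  define A where "A = (\<Sum>k<N. p k * norm (c k - l))"
  have "eventually (\<lambda>n. 2 * A / e + 1 \<le> (\<Sum>k\<le>n. p k)) sequentially"
    using K by (simp add: filterlim_at_top)
  then obtain N' where N': "\<And>n. n \<ge> N' \<Longrightarrow> 2 * A / e + 1 \<le> (\<Sum>k\<le>n. p k)"
    by (auto simp: eventually_sequentially)
  have A0: "0 \<le> A" unfolding A_def using p by (intro sum_nonneg) simp
  show "\<exists>no. \<forall>n\<ge>no. norm ((\<Sum>k\<le>n. of_real (p k) * c k) / of_real (\<Sum>k\<le>n. p k) - l) < e"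
  proof (intro exI allI impI)
    fix n assume n: "max N N' \<le> n"
    define S where "S = (\<Sum>k\<le>n. p k)"
    have S: "2 * A / e + 1 \<le> S" using N' n by (simp add: S_def)
    have "0 \<le> 2 * A / e" using A0 e by simp
    then have S0: "0 < S" using S by linarith
    have "2 * A < e * S"
    proof -
      have "2 * A / e < S" using S by linarith
      then show ?thesis using e by (simp add: field_simps)
    qed
    have "(\<Sum>k\<le>n. of_real (p k) * c k) - l * of_real S = (\<Sum>k\<le>n. of_real (p k) * (c k - l))"
      unfolding S_def by (simp add: sum_subtractf right_diff_distrib sum_distrib_left mult.commute)
    moreover have "norm (\<Sum>k\<le>n. of_real (p k) * (c k - l)) \<le> (\<Sum>k\<le>n. p k * norm (c k - l))"
      by (rule sum_norm_le) (simp add: norm_mult p)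
    moreover have "(\<Sum>k\<le>n. p k * norm (c k - l)) \<le> A + e / 2 * S"
    proof -
      have "(\<Sum>k\<le>n. p k * norm (c k - l)) = A + (\<Sum>k=N..n. p k * norm (c k - l))"
      proof -
        have "{..n} = {..<N} \<union> {N..n}" using n by auto
        then show ?thesis unfolding A_def by (simp only:) (rule sum.union_disjoint; auto)
      qed
      also have "(\<Sum>k=N..n. p k * norm (c k - l)) \<le> (\<Sum>k=N..n. p k * (e / 2))"
        by (intro sum_mono mult_left_mono p) (use N in \<open>auto intro: less_imp_le\<close>)
      also have "\<dots> \<le> (\<Sum>k\<le>n. p k * (e / 2))"
        by (rule sum_mono2) (use p e in auto)
      also have "\<dots> = e / 2 * S" by (simp add: S_def sum_distrib_left mult.commute)
      finally show ?thesis by simp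
    qed
    ultimately have "norm ((\<Sum>k\<le>n. of_real (p k) * c k) - l * of_real S) < e * S"
      using \<open>2 * A < e * S\<close> by simp
    moreover have "(\<Sum>k\<le>n. of_real (p k) * c k) / of_real S - l = ((\<Sum>k\<le>n. of_real (p k) * c k) - l * of_real S) / of_real S"
      using S0 by (simp add: field_simps)
    ultimately show "norm ((\<Sum>k\<le>n. of_real (p k) * c k) / of_real (\<Sum>k\<le>n. p k) - l) < e"
      using S0 unfolding S_def[symmetric] by (simp add: norm_divide field_simps)
  qed
qed

lemma not_summable_at_top:
  fixes b :: "nat \<Rightarrow> real"
  assumes "\<And>n. 0 \<le> b n" "\<not> summable b"
  shows "filterlim (\<lambda>n. \<Sum>k<n. b k) at_top sequentially"
  unfolding filterlim_at_top eventually_sequentially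
proof
  fix Z
  have "\<exists>N. Z < (\<Sum>k<N. b k)"
    using summableI_nonneg_bounded[of b Z] assms by (meson not_le)
  then obtain N where N: "Z < (\<Sum>k<N. b k)" by blast
  have "Z \<le> (\<Sum>k<n. b k)" if "n \<ge> N" for n
  proof -
    have "(\<Sum>k<N. b k) \<le> (\<Sum>k<n. b k)" using that assms by (intro sum_mono2) auto
    then show ?thesis using N by simp
  qed
  then show "\<exists>N. \<forall>n\<ge>N. Z \<le> (\<Sum>k<n. b k)" by blast
qed

section \<open>The birth-death system in flux form\<close>

context bd_rates
begin

abbreviation pp :: "nat \<Rightarrow> real" where "pp \<equiv> bd_pi la mu"
abbreviation KK :: "nat \<Rightarrow> real" where "KK \<equiv> bd_K la mu"

definition resist :: "nat \<Rightarrow> real" where "resist n = 1 / (la n * pp n)"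

lemma pp_0 [simp]: "pp 0 = 1" by (simp add: bd_pi_def)

lemma pp_Suc: "pp (Suc n) = pp n * la n / mu (Suc n)"
proof -
  have "{1..Suc n} = insert (Suc n) {1..n}" by auto
  then show ?thesis by (simp add: bd_pi_def)
qed

lemma pp_pos: "0 < pp n"
  by (induction n) (use la mu in \<open>simp_all add: pp_Suc\<close>)

lemma pp_balance: "pp (Suc n) * mu (Suc n) = la n * pp n"
  using mu(1)[of "Suc n"] by (simp add: pp_Suc)

lemma resist_pos: "0 < resist n"
  using la pp_pos by (simp add: resist_def)

lemma resist_mult: "resist n * (la n * pp n * y) = y"
  using la[of n] pp_pos[of n] by (simp add: resist_def)

lemma bdQ_0_flux:
  "la 0 * pp 0 * (bdQ la mu 0 (Suc 0) x - bdQ la mu 0 0 x) = mu 0 - x * pp 0"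
  using la[of 0] by (simp add: field_simps)

text \<open>Multiplying the recursion by \<pi> and using \<pi>_(n+1) mu_(n+1) = la_n \<pi>_n turns
  it into a balance of fluxes through neighbouring edges. The shift l moves the edges, since Q^(l)_n
  lives at state n + l.\<close>

lemma bdQ_flux:
  "la (Suc n + l) * pp (Suc n + l) * (bdQ la mu l (Suc (Suc n)) x - bdQ la mu l (Suc n) x)
     = la (n + l) * pp (n + l) * (bdQ la mu l (Suc n) x - bdQ la mu l n x) - x * pp (Suc n + l) * bdQ la mu l (Suc n) x"
proof -
  define X Y where "X = bdQ la mu l (Suc (Suc n)) x - bdQ la mu l (Suc n) x"
    and "Y = bdQ la mu l (Suc n) x - bdQ la mu l n x"
  have "la (Suc n + l) * X = mu (Suc n + l) * Y - x * bdQ la mu l (Suc n) x"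
    unfolding X_def Y_def using la[of "Suc n + l"] by (simp add: field_simps)
  then have "pp (Suc n + l) * (la (Suc n + l) * X)
     = pp (Suc n + l) * (mu (Suc n + l) * Y - x * bdQ la mu l (Suc n) x)"
    by (rule arg_cong)
  then have "la (Suc n + l) * pp (Suc n + l) * X
     = pp (Suc n + l) * mu (Suc n + l) * Y - x * pp (Suc n + l) * bdQ la mu l (Suc n) x"
    by (simp only: right_diff_distrib mult_ac)
  then show ?thesis using pp_balance[of "n + l"] unfolding X_def[symmetric] Y_def[symmetric] by simp
qed

lemma bdQ_product: "bdQ la mu l n x = bdQ la mu l n 0 * (\<Prod>i<n. 1 - x / bd_zero la mu l n (Suc i))"
proof -
  have "poly (bdp la mu l n) x = poly (smult (bdQ la mu l n 0) (\<Prod>i<n. [:1, - 1 / bd_zero la mu l n (Suc i):])) x"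
    using bdp_product[of l n] by simp
  then show ?thesis by (simp add: poly_bdp poly_prod)
qed

lemma bdQ_at_0_pos: "0 < bdQ la mu l n 0"
  using bdQ_nonpos_mono[of 0 l n] by simp

lemma bd_zero_array:
  assumes "\<And>n. G n holomorphic_on UNIV"
    and "\<And>n x. G n (complex_of_real x) = of_real (bdQ la mu l n x / bdQ la mu l n 0)"
    and "\<And>z. (\<lambda>n. G n z) \<longlonglongrightarrow> F z"
  shows "zero_array (\<lambda>n i. bd_zero la mu l n (Suc i)) F (\<lambda>i. bd_xi la mu l (Suc i))"
proof
  fix z
  have "G n z = (\<Prod>i<n. 1 - z / of_real (bd_zero la mu l n (Suc i)))" for n
  proof (rule holomorphic_eqI_reals[where f="G n"])
    show "(\<lambda>z. \<Prod>i<n. 1 - z / of_real (bd_zero la mu l n (Suc i))) holomorphic_on UNIV"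
      using bd_zero_pos[of _ n l] by (intro holomorphic_intros) (metis less_irrefl lessThan_iff of_real_eq_0_iff)
    show "G n (complex_of_real x) = (\<Prod>i<n. 1 - of_real x / of_real (bd_zero la mu l n (Suc i)))" for x
      unfolding assms(2) bdQ_product[of l n x] using bdQ_at_0_pos[of l n] by simp
  qed (rule assms)
  then show "(\<lambda>n. \<Prod>i<n. 1 - z / of_real (bd_zero la mu l n (Suc i))) \<longlonglongrightarrow> F z"
    using assms(3)[of z] by simp
qed (use bd_zero_pos bd_zero_decreasing in \<open>auto simp: bd_xi_def\<close>)

lemma exit_case:
  assumes C: "summable (\<lambda>n. resist n * KK n)"
  shows "reciprocal_entire_simple_pos_zeros (bd_xi la mu 0)"
    and "s < 0 \<Longrightarrow> (\<lambda>n. 1 / bdQ la mu 0 n s) \<longlonglongrightarrow>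
         1 / (1 + mu 0 * suminf resist) * (\<Prod>i. bd_xi la mu 0 (Suc i) / (bd_xi la mu 0 (Suc i) - s))"
proof -
  interpret E: exit_system resist pp "mu 0" KK
  proof
    show "KK n = (\<Sum>k\<le>n. pp k)" for n by (simp add: bd_K_def)
  qed (use resist_pos pp_pos mu C in \<open>auto intro: less_imp_le\<close>)
  have fQ: "E.f n (of_real x) = of_real (bdQ la mu 0 n x)" for n x
  proof (rule E.f_of_real[where v="\<lambda>n. la n * pp n * (bdQ la mu 0 (Suc n) x - bdQ la mu 0 n x)"])
    show "la 0 * pp 0 * (bdQ la mu 0 (Suc 0) x - bdQ la mu 0 0 x) = mu 0 - x * pp 0" by (rule bdQ_0_flux)
    show "bdQ la mu 0 (Suc n) x = bdQ la mu 0 n x + resist n * (la n * pp n * (bdQ la mu 0 (Suc n) x - bdQ la mu 0 n x))" for n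
      unfolding resist_mult by simp
    show "la (Suc n) * pp (Suc n) * (bdQ la mu 0 (Suc (Suc n)) x - bdQ la mu 0 (Suc n) x) =
      la n * pp n * (bdQ la mu 0 (Suc n) x - bdQ la mu 0 n x) - x * pp (Suc n) * bdQ la mu 0 (Suc n) x" for n
      using bdQ_flux[of n 0 x] unfolding add_0_right .
  qed simp
  let ?c = "1 + mu 0 * suminf resist"
  have c: "0 < ?c" using E.finf_0_ge by simp
  have fn: "E.finf 0 \<noteq> 0" unfolding E.finf_0 of_real_eq_0_iff using c by simp
  define F where "F z = E.finf z / E.finf 0" for z
  interpret Z: zero_array "\<lambda>n i. bd_zero la mu 0 n (Suc i)" F "\<lambda>i. bd_xi la mu 0 (Suc i)"
  proof (rule bd_zero_array[where G="\<lambda>n z. E.f n z / E.f n 0"])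
    show "(\<lambda>z. E.f n z / E.f n 0) holomorphic_on UNIV" for n
      using fQ[of n 0] bdQ_at_0_pos[of 0 n] by (intro holomorphic_intros E.f_holomorphic) simp
    show "E.f n (of_real x) / E.f n 0 = of_real (bdQ la mu 0 n x / bdQ la mu 0 n 0)" for n x
      using fQ[of n x] fQ[of n 0] by simp
    show "(\<lambda>n. E.f n z / E.f n 0) \<longlonglongrightarrow> F z" for z
      unfolding F_def by (intro tendsto_divide E.f_tendsto fn)
  qed
  have hF: "F holomorphic_on UNIV"
    unfolding F_def using fn by (intro holomorphic_intros E.finf_holomorphic)
  have dF: "deriv F z = deriv E.finf z / E.finf 0" for z
    unfolding F_def by (rule DERIV_imp_deriv) (rule DERIV_cdivide[OF E.finf_deriv])
  show "reciprocal_entire_simple_pos_zeros (bd_xi la mu 0)"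
  proof (rule Z.reciprocal_entire[OF hF])
    show "deriv F (of_real (bd_xi la mu 0 (Suc i))) \<noteq> 0" for i
      using E.finf_simple_zero[OF Z.xi_pos[of i]] Z.F_xi[of i] fn unfolding dF by (simp add: F_def)
  qed simp
  assume s: "s < 0"
  let ?p = "\<Prod>i. bd_xi la mu 0 (Suc i) / (bd_xi la mu 0 (Suc i) - s)"
  have p: "0 < ?p" by (rule Z.F_neg(2)[OF s])
  have "E.finf (of_real s) = of_real (?c * (1 / ?p))"
    using Z.F_neg(1)[OF s] fn unfolding F_def E.finf_0 of_real_mult by (simp add: field_simps)
  then have "(\<lambda>n. complex_of_real (bdQ la mu 0 n s)) \<longlonglongrightarrow> of_real (?c * (1 / ?p))"
    using E.f_tendsto[of "of_real s"] fQ by simp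
  then have "(\<lambda>n. bdQ la mu 0 n s) \<longlonglongrightarrow> ?c * (1 / ?p)"
    by (simp only: tendsto_of_real_iff)
  then have "(\<lambda>n. 1 / bdQ la mu 0 n s) \<longlonglongrightarrow> 1 / (?c * (1 / ?p))"
    using c p by (intro tendsto_intros) auto
  then show "(\<lambda>n. 1 / bdQ la mu 0 n s) \<longlonglongrightarrow> 1 / ?c * ?p" by simp
qed

text \<open>The fluxes of Q^(1) form the fundamental solution of the dual system, and the
  summability assumption \<open>D\<close> is its exit condition. The sequence \<open>v\<close>
  stands for the downward transform and \<open>w\<close> for its flux; the limit of \<open>v\<close>
  is the reciprocal of the dual entire function at -\<theta>.\<close>

lemma entrance_case:
  assumes D: "summable (\<lambda>n. pp (Suc n) * (\<Sum>k\<le>n. resist k))" and L: "\<not> summable resist"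
    and S: "summable pp"
    and \<theta>: "0 < \<theta>"
    and v: "\<And>n. 0 \<le> v n" "\<And>n. v n \<le> 1" "v 0 = 1"
    and w: "\<And>n. v (Suc n) = v n + resist n * w n" "\<And>n. w (Suc n) = w n + \<theta> * pp (Suc n) * v (Suc n)"
  shows "reciprocal_entire_simple_pos_zeros (bd_xi la mu 1)"
    and "v \<longlonglongrightarrow> (\<Prod>i. bd_xi la mu 1 (Suc i) / (bd_xi la mu 1 (Suc i) - (- \<theta>)))"
proof -
  define LL where "LL n = (\<Sum>k\<le>n. resist k)" for n
  interpret E: exit_system "\<lambda>n. pp (Suc n)" resist 0 LL
    by standard (use resist_pos pp_pos D in \<open>auto simp: LL_def intro: less_imp_le\<close>)
  \<comment> \<open>The flux of Q^(1), scaled by la 0. The value at 0 is the flux through the edge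
    from state 0 to state 1 when the solution is extended by 0 to state 0, namely la 0 / la
    0.\<close>
  define y where "y x n = (case n of 0 \<Rightarrow> 1 | Suc m \<Rightarrow> la (Suc m) * pp (Suc m) * (bdQ la mu 1 (Suc m) x - bdQ la mu 1 m x) / la 0)"
    for x :: real and n
  have pm: "pp (Suc 0) * mu (Suc 0) = la 0" using pp_balance[of 0] by simp
  have y_Suc: "y x (Suc n) = y x n + pp (Suc n) * (- x * bdQ la mu 1 n x / la 0)" for x n
  proof (cases n)
    case 0
    define X where "X = bdQ la mu 1 (Suc 0) x - 1"
    have "la (Suc 0) * X = mu (Suc 0) - x"
      unfolding X_def using la[of "Suc 0"] by (simp add: field_simps)
    then have "pp (Suc 0) * (la (Suc 0) * X) = pp (Suc 0) * (mu (Suc 0) - x)" by (rule arg_cong)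
    then have "la (Suc 0) * pp (Suc 0) * X = la 0 - x * pp (Suc 0)"
      using pm by (simp add: algebra_simps)
    moreover have "y x (Suc n) = la (Suc 0) * pp (Suc 0) * X / la 0" "y x n = 1"
      by (simp_all add: 0 y_def X_def)
    ultimately show ?thesis using la[of 0] 0 by (simp add: diff_divide_distrib)
  next
    case (Suc m)
    show ?thesis using bdQ_flux[of m 1 x] unfolding Suc y_def by (simp del: bdQ.simps(3) add: diff_divide_distrib)
  qed
  have fy: "E.f n (of_real x) = of_real (y x n)" for n x
  proof (rule E.f_of_real[where v="\<lambda>n. - x * bdQ la mu 1 n x / la 0"])
    show "- x * bdQ la mu 1 0 x / la 0 = 0 - x * resist 0" by (simp add: resist_def)
    show "- x * bdQ la mu 1 (Suc n) x / la 0 = - x * bdQ la mu 1 n x / la 0 - x * resist (Suc n) * y x (Suc n)" for n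
    proof -
      have "resist (Suc n) * y x (Suc n) = (bdQ la mu 1 (Suc n) x - bdQ la mu 1 n x) / la 0"
        using resist_mult[of "Suc n" "bdQ la mu 1 (Suc n) x - bdQ la mu 1 n x"] by (simp add: y_def)
      then have "x * resist (Suc n) * y x (Suc n) = x * ((bdQ la mu 1 (Suc n) x - bdQ la mu 1 n x) / la 0)"
        by (simp only: mult.assoc)
      then show ?thesis by (simp only: right_diff_distrib diff_divide_distrib) (simp add: field_simps)
    qed
  qed (use y_Suc in \<open>auto simp: y_def\<close>)
  \<comment> \<open>Resistance times flux is an increment of Q^(1), so the sum telescopes. At x = 0
    the flux is constantly 1, whence \<open>LL n\<close> is the value of Q^(1)_n at 0 up to the
    factor la 0.\<close>
  have sumy: "(\<Sum>k\<le>n. resist k * y x k) = bdQ la mu 1 n x / la 0" for n x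
  proof (induction n)
    case 0
    show ?case by (simp add: y_def resist_def)
  next
    case (Suc n)
    have "resist (Suc n) * y x (Suc n) = (bdQ la mu 1 (Suc n) x - bdQ la mu 1 n x) / la 0"
      using resist_mult[of "Suc n" "bdQ la mu 1 (Suc n) x - bdQ la mu 1 n x"] by (simp add: y_def)
    then show ?case using Suc by (simp del: bdQ.simps add: diff_divide_distrib)
  qed
  have y0: "y 0 n = 1" for n by (induction n) (use y_Suc in \<open>simp_all add: y_def\<close>)
  have LQ: "LL n = bdQ la mu 1 n 0 / la 0" for n using sumy[of 0 n] by (simp add: y0 LL_def)
  have L_top: "filterlim (\<lambda>n. \<Sum>k\<le>n. resist k) at_top sequentially"
  proof -
    have "filterlim (\<lambda>n. \<Sum>k<n. resist k) at_top sequentially"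
      by (rule not_summable_at_top) (use resist_pos L in \<open>auto intro: less_imp_le\<close>)
    then have "filterlim (\<lambda>n. \<Sum>k<Suc n. resist k) at_top sequentially"
      by (rule filterlim_compose[OF _ filterlim_Suc])
    then show ?thesis by (simp only: lessThan_Suc_atMost)
  qed
  interpret Z: zero_array "\<lambda>n i. bd_zero la mu 1 n (Suc i)" E.finf "\<lambda>i. bd_xi la mu 1 (Suc i)"
  proof (rule bd_zero_array[where G="\<lambda>n z. (\<Sum>k\<le>n. of_real (resist k) * E.f k z) / of_real (\<Sum>k\<le>n. resist k)"])
    have nz: "(\<Sum>k\<le>n. resist k) \<noteq> 0" for n using E.K_pos[of n] by (simp add: LL_def)
    show "(\<lambda>z. (\<Sum>k\<le>n. of_real (resist k) * E.f k z) / of_real (\<Sum>k\<le>n. resist k)) holomorphic_on UNIV" for n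
      using nz[of n] unfolding of_real_sum[symmetric] by (intro holomorphic_intros E.f_holomorphic) (simp only: of_real_eq_0_iff)
    show "(\<Sum>k\<le>n. of_real (resist k) * E.f k (of_real x)) / of_real (\<Sum>k\<le>n. resist k)
        = of_real (bdQ la mu 1 n x / bdQ la mu 1 n 0)" for n x
    proof -
      have "(\<Sum>k\<le>n. of_real (resist k) * E.f k (of_real x)) = complex_of_real (bdQ la mu 1 n x / la 0)"
        unfolding fy sumy[symmetric] by simp
      then show ?thesis using LQ[of n] la[of 0] unfolding LL_def by simp
    qed
    show "(\<lambda>n. (\<Sum>k\<le>n. of_real (resist k) * E.f k z) / of_real (\<Sum>k\<le>n. resist k)) \<longlonglongrightarrow> E.finf z" for z
      by (rule weighted_mean_tendsto[OF _ L_top E.f_tendsto]) (use resist_pos in \<open>auto intro: less_imp_le\<close>)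
  qed
  show "reciprocal_entire_simple_pos_zeros (bd_xi la mu 1)"
  proof (rule Z.reciprocal_entire[OF E.finf_holomorphic])
    show "deriv E.finf (of_real (bd_xi la mu 1 (Suc i))) \<noteq> 0" for i
      using E.finf_simple_zero[OF Z.xi_pos[of i] Z.F_xi[of i]] .
  qed simp

  define T where "T n = (\<Sum>k. pp (k + Suc n))" for n
  have sT: "summable (\<lambda>k. pp (k + Suc n))" for n using S summable_ignore_initial_segment by blast
  have w_mono: "w m \<le> w n" if "m \<le> n" for m n
    using that
  proof (induction n rule: dec_induct)
    case (step n)
    have "0 \<le> \<theta> * pp (Suc n) * v (Suc n)" using \<theta> pp_pos[of "Suc n"] v(1) by simp
    then show ?case using step w(2)[of n] by linarith
  qed simp
  have v_sum: "v (n + m) = v n + (\<Sum>k=n..<n+m. resist k * w k)" for n m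
    by (induction m) (simp_all add: w(1))
  have tail_top: "\<exists>m. B < (\<Sum>k=n..<n+m. resist k)" for n B
  proof -
    have "\<not> summable (\<lambda>k. resist (k + n))" using L summable_iff_shift by blast
    then obtain m where "B < (\<Sum>k<m. resist (k + n))"
      using summableI_nonneg_bounded[of "\<lambda>k. resist (k + n)" B] resist_pos by (meson less_imp_le not_le)
    moreover have "(\<Sum>k<m. resist (k + n)) = (\<Sum>k=n..<n+m. resist k)"
      using sum.shift_bounds_nat_ivl[of resist 0 n m] by (simp add: lessThan_atLeast0 add.commute)
    ultimately show ?thesis by auto
  qed
  \<comment> \<open>The flux is nondecreasing; once positive, it would push v above 1 because the
    resistances have a divergent sum.\<close>
  have w_nonpos: "w n \<le> 0" for n
  proof (rule ccontr)
    assume "\<not> w n \<le> 0"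
    then have c: "0 < w n" by simp
    obtain m where m: "1 / w n < (\<Sum>k=n..<n+m. resist k)" using tail_top by blast
    have "1 < (\<Sum>k=n..<n+m. resist k) * w n" using m c by (simp add: field_simps)
    also have "\<dots> \<le> (\<Sum>k=n..<n+m. resist k * w k)"
      unfolding sum_distrib_right using w_mono resist_pos by (intro sum_mono mult_left_mono) (auto intro: less_imp_le)
    finally show False using v_sum[of n m] v(1)[of n] v(2)[of "n + m"] by linarith
  qed
  \<comment> \<open>Conversely, a flux staying below -c would push v below 0.\<close>
  have w_gt: "\<exists>m\<ge>n. - c < w m" if c: "0 < c" for n c
  proof (rule ccontr)
    assume "\<not> (\<exists>m\<ge>n. - c < w m)"
    then have wc: "w m \<le> - c" if "m \<ge> n" for m using that by (meson not_less)
    obtain m where m: "1 / c < (\<Sum>k=n..<n+m. resist k)" using tail_top by blast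
    have "(\<Sum>k=n..<n+m. resist k * w k) \<le> (\<Sum>k=n..<n+m. resist k) * (- c)"
      unfolding sum_distrib_right using wc resist_pos by (intro sum_mono mult_left_mono) (auto intro: less_imp_le)
    moreover have "1 < (\<Sum>k=n..<n+m. resist k) * c" using m c by (simp add: field_simps)
    ultimately show False using v_sum[of n m] v(2)[of n] v(1)[of "n + m"] by simp
  qed
  \<comment> \<open>Since w comes arbitrarily close to 0, its deficit at n is at most the total
    later gain, and v <= 1 bounds this gain by \<theta> times the mass beyond n.\<close>
  have w_bound: "- w n \<le> \<theta> * T n" for n
  proof (rule field_le_epsilon)
    fix c :: real assume "0 < c"
    then obtain m where m: "n \<le> m" "- c < w m" using w_gt by blast
    have "w (n + j) \<le> w n + \<theta> * (\<Sum>k<j. pp (k + Suc n))" for j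
    proof (induction j)
      case (Suc j)
      have "\<theta> * pp (Suc (n + j)) * v (Suc (n + j)) \<le> \<theta> * pp (Suc (n + j)) * 1"
        using v(2) \<theta> pp_pos[of "Suc (n + j)"] by (intro mult_left_mono) auto
      then show ?case using Suc w(2)[of "n + j"] by (simp add: algebra_simps)
    qed simp
    from this[of "m - n"] m have "w m \<le> w n + \<theta> * (\<Sum>k<m - n. pp (k + Suc n))" by simp
    moreover have "(\<Sum>k<m - n. pp (k + Suc n)) \<le> T n"
      unfolding T_def using pp_pos by (intro sum_le_suminf[OF sT]) (auto intro: less_imp_le)
    then have "\<theta> * (\<Sum>k<m - n. pp (k + Suc n)) \<le> \<theta> * T n" using \<theta> by (intro mult_left_mono) auto
    ultimately show "- w n \<le> \<theta> * T n + c" using m(2) by linarith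
  qed
  have "decseq v"
    unfolding decseq_Suc_iff
  proof
    fix n
    have "resist n * w n \<le> 0" using resist_pos[of n] w_nonpos[of n] by (simp add: mult_nonneg_nonpos)
    then show "v (Suc n) \<le> v n" using w(1)[of n] by simp
  qed
  then obtain l where l: "v \<longlonglongrightarrow> l" using decseq_convergent[of v 0] v(1) by blast
  define r where "r n = Re (E.f n (of_real (- \<theta>)))" for n
  define R where "R = Re (E.finf (of_real (- \<theta>)))"
  have r: "r \<longlonglongrightarrow> R" unfolding r_def R_def by (intro tendsto_Re E.f_tendsto)
  have r0: "r 0 = 1" by (simp add: r_def E.f0)
  have r_y: "r n = y (- \<theta>) n" for n unfolding r_def fy by simp
  \<comment> \<open>With the strict upper limit \<open>ss n\<close> is Q^(1)_(n-1)(-\<theta>) / la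
    0, and \<open>ss 0\<close> is 0: the solution vanishing at state 0, while v is 1 there. This
    fixes the Casoratian at 1.\<close>
  define ss where "ss n = (\<Sum>k<n. resist k * r k)" for n
  have r_Suc: "r (Suc n) = r n + \<theta> * pp (Suc n) * ss (Suc n)" for n
    unfolding r_y ss_def lessThan_Suc_atMost sumy y_Suc by simp
  text \<open>The Casoratian of \<open>v\<close> and \<open>Q\<^sup>(\<^sup>1\<^sup>)\<close>, both written through the dual sequence.\<close>
  have cas: "v n * r n - w n * ss n = 1" for n
  proof (induction n)
    case 0
    show ?case by (simp add: v(3) r0 ss_def)
  next
    case (Suc n)
    have ssn: "ss (Suc n) = ss n + resist n * r n" by (simp add: ss_def)
    have "v (Suc n) * r (Suc n) - w (Suc n) * ss (Suc n) = v (Suc n) * r n - w n * ss (Suc n)"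
      unfolding r_Suc w(2)[of n] by (simp add: algebra_simps)
    also have "\<dots> = v n * r n - w n * ss n" unfolding ssn w(1)[of n] by (simp add: algebra_simps)
    finally show ?case using Suc by simp
  qed
  obtain B where B: "0 < B" "\<And>n. norm (r n) \<le> B"
    using convergent_imp_Bseq[OF convergentI[OF r]] by (auto simp: Bseq_def)
  have LT: "LL n * T n \<le> E.tail n" for n
  proof -
    have "summable (\<lambda>m. pp (Suc (m + n)) * LL (m + n))"
      using summable_ignore_initial_segment[OF E.summ, of n] by simp
    moreover have "LL n * pp (m + Suc n) \<le> pp (Suc (m + n)) * LL (m + n)" for m
      using mult_right_mono[OF E.K_mono[of n "m + n"] less_imp_le[OF pp_pos[of "Suc (m + n)"]]]
      by (simp add: mult.commute)
    ultimately show ?thesis unfolding T_def E.tail_def suminf_mult[OF sT, symmetric]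
      by (intro suminf_le summable_mult sT) auto
  qed
  \<comment> \<open>The flux w is of order T n and \<open>ss\<close> of order \<open>LL n\<close>;
    by \<open>LT\<close> the product is at most a tail of the dual series. What remains of the
    Casoratian is v * r tending to 1.\<close>
  have ws: "norm (w n * ss n) \<le> \<theta> * B * E.tail n" for n
  proof -
    have "norm (ss n) \<le> (\<Sum>k<n. resist k * B)"
      unfolding ss_def using B(2) resist_pos
      by (intro sum_norm_le) (simp add: abs_mult abs_of_pos mult_left_mono less_imp_le)
    also have "\<dots> \<le> (\<Sum>k\<le>n. resist k * B)"
      using B(1) resist_pos by (intro sum_mono2) (auto intro: less_imp_le)
    also have "\<dots> = LL n * B" by (simp add: LL_def sum_distrib_right)
    finally have 1: "norm (ss n) \<le> LL n * B" .
    have T0: "0 \<le> T n" unfolding T_def using pp_pos by (intro suminf_nonneg sT) (auto intro: less_imp_le)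
    have "norm (w n) \<le> \<theta> * T n" using w_bound[of n] w_nonpos[of n] by simp
    then have "norm (w n) * norm (ss n) \<le> (\<theta> * T n) * (LL n * B)"
      using 1 \<theta> T0 by (intro mult_mono) auto
    also have "\<dots> = \<theta> * B * (LL n * T n)" by simp
    also have "\<dots> \<le> \<theta> * B * E.tail n" using \<theta> B(1) LT by (intro mult_left_mono) auto
    finally show ?thesis by (simp add: abs_mult)
  qed
  have "(\<lambda>n. \<theta> * B * E.tail n) \<longlonglongrightarrow> \<theta> * B * 0" by (intro tendsto_intros E.tail_tendsto)
  then have tl: "(\<lambda>n. \<theta> * B * E.tail n) \<longlonglongrightarrow> 0" by simp
  have "(\<lambda>n. w n * ss n) \<longlonglongrightarrow> 0"
    by (rule Lim_null_comparison[OF _ tl]) (intro always_eventually allI ws)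
  moreover have "w n * ss n = v n * r n - 1" for n using cas[of n] by simp
  ultimately have "(\<lambda>n. v n * r n - 1) \<longlonglongrightarrow> 0" by simp
  moreover have "(\<lambda>n. v n * r n - 1) \<longlonglongrightarrow> l * R - 1" by (intro tendsto_intros l r)
  ultimately have lR: "l * R = 1" using LIMSEQ_unique by fastforce
  have s: "- \<theta> < 0" using \<theta> by simp
  let ?p = "\<Prod>i. bd_xi la mu 1 (Suc i) / (bd_xi la mu 1 (Suc i) - (- \<theta>))"
  have "R = 1 / ?p" unfolding R_def Z.F_neg(1)[OF s] by (rule Re_complex_of_real)
  then have "l = ?p" using lR Z.F_neg(2)[OF s] by (simp add: field_simps)
  then show "v \<longlonglongrightarrow> ?p" using l by simp
qed

section \<open>The extended-real series as summability conditions\<close>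

lemma KK_nonneg: "0 \<le> KK n"
  unfolding bd_K_def using pp_pos by (intro sum_nonneg) (auto intro: less_imp_le)

lemma KK_ge_1: "1 \<le> KK n"
  unfolding bd_K_def using member_le_sum[of 0 "{..n}" pp] pp_pos by (auto intro: less_imp_le)

lemma bd_C_eq: "bd_C la mu = (\<Sum>n. ennreal (resist n * KK n))"
  unfolding bd_C_def resist_def[symmetric] using resist_pos KK_nonneg
  by (simp add: ennreal_mult less_imp_le)

lemma bd_C_finite_iff: "bd_C la mu < \<infinity> \<longleftrightarrow> summable (\<lambda>n. resist n * KK n)"
proof -
  have nn: "0 \<le> resist n * KK n" for n using resist_pos[of n] KK_nonneg[of n] by simp
  show ?thesis
    unfolding bd_C_eq using summable_suminf_not_top[OF nn] ennreal_suminf_neq_top[OF _ nn]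
    by (auto simp: less_top)
qed

lemma summable_resist:
  assumes "summable (\<lambda>n. resist n * KK n)"
  shows "summable resist"
proof (rule summable_comparison_test'[OF assms, of 0])
  show "norm (resist n) \<le> resist n * KK n" for n
    using mult_left_mono[OF KK_ge_1[of n], of "resist n"] resist_pos[of n] by simp
qed

lemma bd_Linf_eq: "summable resist \<Longrightarrow> enn2real (bd_Linf la mu) = suminf resist"
  unfolding bd_Linf_def resist_def[symmetric] using resist_pos
  by (simp add: suminf_ennreal2 less_imp_le suminf_nonneg)

lemma bd_Kinf_eq: "summable pp \<Longrightarrow> bd_Kinf la mu = ennreal (suminf pp)"
  unfolding bd_Kinf_def using pp_pos by (simp add: suminf_ennreal2 less_imp_le)

lemma KK_le_suminf: "summable pp \<Longrightarrow> KK n \<le> suminf pp"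
  unfolding bd_K_def using pp_pos by (intro sum_le_suminf) (auto intro: less_imp_le)

lemma bd_D_eq:
  assumes "summable pp"
  shows "bd_D la mu = (\<Sum>n. ennreal (resist n * (suminf pp - KK n)))"
proof -
  have "ennreal (resist n) * (ennreal (suminf pp) - ennreal (KK n)) = ennreal (resist n * (suminf pp - KK n))" for n
    using resist_pos[of n] KK_nonneg[of n] KK_le_suminf[OF assms, of n]
    by (simp add: ennreal_minus ennreal_mult less_imp_le)
  then show ?thesis unfolding bd_D_def bd_Kinf_eq[OF assms] resist_def[symmetric] by simp
qed

text \<open>C < infinity makes the resistances summable; a finite total mass would then bound the
  terms of D by a multiple of the resistances.\<close>

lemma not_summable_pp:
  assumes "bd_C la mu < \<infinity>" "bd_D la mu = \<infinity>"
  shows "\<not> summable pp"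
proof
  assume S: "summable pp"
  have r: "summable resist" using assms(1) bd_C_finite_iff summable_resist by blast
  have nn: "0 \<le> resist n * (suminf pp - KK n)" for n
    using resist_pos[of n] KK_le_suminf[OF S, of n] by simp
  have "summable (\<lambda>n. resist n * (suminf pp - KK n))"
  proof (rule summable_comparison_test'[OF summable_mult2[OF r, of "suminf pp"], of 0])
    fix n
    show "norm (resist n * (suminf pp - KK n)) \<le> resist n * suminf pp"
      using nn[of n] KK_nonneg[of n] resist_pos[of n] by (simp add: algebra_simps)
  qed
  then have "bd_D la mu \<noteq> \<infinity>" unfolding bd_D_eq[OF S] using ennreal_suminf_neq_top[OF _ nn] by simp
  with assms(2) show False by simp
qed

lemma entrance_summability:
  assumes C: "bd_C la mu = \<infinity>" and D: "bd_D la mu < \<infinity>"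
  shows "summable pp" "\<not> summable resist" "summable (\<lambda>n. pp (Suc n) * (\<Sum>k\<le>n. resist k))"
proof -
  show S: "summable pp"
  proof (rule ccontr)
    \<comment> \<open>In \<open>ennreal\<close>, infinity minus a finite number is infinity, so
      every single term of D would be infinite.\<close>
    assume "\<not> summable pp"
    then have "bd_Kinf la mu = \<top>"
      unfolding bd_Kinf_def using summable_suminf_not_top[of pp] pp_pos by (meson less_imp_le)
    then have "ennreal (resist n) * (bd_Kinf la mu - ennreal (KK n)) = \<top>" for n
      using resist_pos[of n] by (simp add: ennreal_mult_top)
    then have "bd_D la mu = (\<Sum>n. \<top>)" unfolding bd_D_def resist_def[symmetric] by simp
    moreover have "\<top> \<le> (\<Sum>n. \<top> :: ennreal)"
      using sum_le_suminf[of "\<lambda>_. \<top> :: ennreal" "{0::nat}"] by simp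
    ultimately show False using D by (simp add: top_unique)
  qed
  show "\<not> summable resist"
  proof
    assume r: "summable resist"
    have "summable (\<lambda>n. resist n * KK n)"
    proof (rule summable_comparison_test'[OF summable_mult2[OF r, of "suminf pp"], of 0])
      show "norm (resist n * KK n) \<le> resist n * suminf pp" for n
        using KK_nonneg[of n] KK_le_suminf[OF S, of n] resist_pos[of n] by (simp add: abs_mult mult_left_mono)
    qed
    then show False using C bd_C_finite_iff by simp
  qed
  have nn: "0 \<le> resist n * (suminf pp - KK n)" for n
    using resist_pos[of n] KK_le_suminf[OF S, of n] by simp
  have s: "summable (\<lambda>n. resist n * (suminf pp - KK n))"
    using D summable_suminf_not_top[OF nn] unfolding bd_D_eq[OF S] by simp
  \<comment> \<open>Both sides sum resist m * pp k over m < k <= N. In the limit this turns D into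
    the exit condition of the dual system.\<close>
  have swap: "(\<Sum>n<N. pp (Suc n) * (\<Sum>k\<le>n. resist k)) = (\<Sum>m<N. resist m * (KK N - KK m))" for N
  proof (induction N)
    case (Suc N)
    have K: "KK (Suc N) = KK N + pp (Suc N)" by (simp add: bd_K_def)
    have "(\<Sum>m<Suc N. resist m * (KK (Suc N) - KK m))
       = (\<Sum>m<Suc N. resist m * (KK N - KK m) + resist m * pp (Suc N))"
      by (intro sum.cong refl) (simp add: K algebra_simps)
    also have "\<dots> = (\<Sum>m<N. resist m * (KK N - KK m)) + pp (Suc N) * (\<Sum>m\<le>N. resist m)"
      unfolding sum.distrib by (simp add: sum_distrib_left mult.commute lessThan_Suc_atMost[symmetric] distrib_left)
    finally show ?case using Suc by simp
  qed simp
  show "summable (\<lambda>n. pp (Suc n) * (\<Sum>k\<le>n. resist k))"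
  proof (rule summableI_nonneg_bounded)
    show "0 \<le> pp (Suc n) * (\<Sum>k\<le>n. resist k)" for n
      using pp_pos resist_pos by (intro mult_nonneg_nonneg sum_nonneg) (auto intro: less_imp_le)
    fix N
    have "(\<Sum>m<N. resist m * (KK N - KK m)) \<le> (\<Sum>m<N. resist m * (suminf pp - KK m))"
      using KK_le_suminf[OF S] resist_pos by (intro sum_mono mult_left_mono) (auto intro: less_imp_le)
    also have "\<dots> \<le> (\<Sum>m. resist m * (suminf pp - KK m))"
      by (rule sum_le_suminf[OF s]) (use nn in auto)
    finally show "(\<Sum>n<N. pp (Suc n) * (\<Sum>k\<le>n. resist k)) \<le> (\<Sum>m. resist m * (suminf pp - KK m))"
      unfolding swap .
  qed
qed

end

section \<open>Passage transforms of the birth-death process\<close>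

lemma bd_q_row_sum:
  "(\<Sum>k\<le>Suc i. bd_q la mu i k * f k)
     = la i * f (Suc i) - (la i + mu i) * f i + (case i of 0 \<Rightarrow> 0 | Suc j \<Rightarrow> mu i * f j)"
proof (cases i)
  case 0
  then show ?thesis by (simp add: bd_q_def algebra_simps)
next
  case (Suc j)
  have "(\<Sum>k<j. bd_q la mu i k * f k) = 0"
    by (rule sum.neutral) (use Suc in \<open>auto simp: bd_q_def\<close>)
  moreover have "{..Suc i} = insert (Suc i) (insert i (insert j {..<j}))"
    using Suc by auto
  ultimately show ?thesis using Suc by (simp add: bd_q_def algebra_simps)
qed

lemma bd_q_column_sum:
  "(\<Sum>k\<le>Suc j. f k * bd_q la mu k j)
     = mu (Suc j) * f (Suc j) - (la j + mu j) * f j + (case j of 0 \<Rightarrow> 0 | Suc i \<Rightarrow> la i * f i)"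
proof (cases j)
  case 0
  then show ?thesis by (simp add: bd_q_def algebra_simps)
next
  case (Suc i)
  have "(\<Sum>k<i. f k * bd_q la mu k j) = 0"
    by (rule sum.neutral) (use Suc in \<open>auto simp: bd_q_def\<close>)
  moreover have "{..Suc j} = insert (Suc j) (insert j (insert i {..<i}))"
    using Suc by auto
  ultimately show ?thesis using Suc by (simp add: bd_q_def algebra_simps)
qed

text \<open>Cancels a factor \<open>u n n N\<close> that is bounded away from 0 without being known
  to converge.\<close>

lemma bounded_below_null_imp_0:
  fixes u :: "nat \<Rightarrow> real"
  assumes "(\<lambda>N. x * u N) \<longlonglongrightarrow> 0" "0 < c" "eventually (\<lambda>N. c \<le> u N) sequentially"
  shows "x = 0"
proof -
  have "(\<lambda>N. \<bar>x * u N\<bar>) \<longlonglongrightarrow> 0" using tendsto_rabs[OF assms(1)] by simp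
  moreover have "eventually (\<lambda>N. \<bar>x\<bar> * c \<le> \<bar>x * u N\<bar>) sequentially"
    using assms(3) by eventually_elim (use assms(2) in \<open>auto simp: abs_mult intro!: mult_left_mono\<close>)
  ultimately have "\<bar>x\<bar> * c \<le> 0"
    using tendsto_lowerbound[of "\<lambda>N. \<bar>x * u N\<bar>" 0 sequentially "\<bar>x\<bar> * c"] by simp
  then show ?thesis using assms(2) by (simp add: mult_le_0_iff)
qed

locale bd_process = bd_rates +
  fixes P :: "real \<Rightarrow> nat \<Rightarrow> nat \<Rightarrow> real" and M :: "nat \<Rightarrow> 'a measure"
    and X :: "nat \<Rightarrow> real \<Rightarrow> 'a \<Rightarrow> int" and \<theta> :: real
  assumes tf: "transition_function P" and backward: "kolmogorov_backward la mu P"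
    and forward: "kolmogorov_forward la mu P"
    and proc: "\<And>i. markov_process_from (M i) (X i) P i" and \<theta>: "0 < \<theta>"
begin

lemma markov: "markov_from (M i) (X i) P i"
  by standard (rule tf proc)+

lemmas P_nonneg = markov_from.P_nonneg[OF markov]
lemmas P_le_1 = markov_from.P_le_1[OF markov]

lemma P_abs: "0 \<le> t \<Longrightarrow> \<bar>P t i j\<bar> \<le> 1"
  using P_nonneg P_le_1 by simp

section \<open>Resolvent equations up to null sequences\<close>

abbreviation q where "q \<equiv> bd_q la mu"

definition rowsum :: "nat \<Rightarrow> real" where "rowsum i = (\<Sum>k\<le>Suc i. \<bar>q i k\<bar>)"

lemma generator_bound: "0 \<le> t \<Longrightarrow> \<bar>\<Sum>k\<le>Suc i. q i k * P t k j\<bar> \<le> rowsum i"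
  unfolding rowsum_def
  by (rule order_trans[OF sum_abs sum_mono]) (auto simp: abs_mult P_abs intro!: mult_left_le)

lemma P_lipschitz: "0 \<le> t \<Longrightarrow> t \<le> u \<Longrightarrow> \<bar>P u i j - P t i j\<bar> \<le> rowsum i * (u - t)"
proof -
  assume t: "0 \<le> t" "t \<le> u"
  have "norm (P u i j - P t i j) \<le> rowsum i * norm (u - t)"
  proof (rule field_differentiable_bound[where S="{0..}" and f="\<lambda>t. P t i j" and f'="\<lambda>t. \<Sum>k\<le>Suc i. q i k * P t k j"])
    show "((\<lambda>t. P t i j) has_real_derivative (\<Sum>k\<le>Suc i. q i k * P v k j)) (at v within {0..})" if "v \<in> {0..}" for v
      using backward that unfolding kolmogorov_backward_def by simp
    show "norm (\<Sum>k\<le>Suc i. q i k * P v k j) \<le> rowsum i" if "v \<in> {0..}" for v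
      using generator_bound that by simp
  qed (use t in auto)
  then show ?thesis using t by simp
qed

abbreviation u :: "nat \<Rightarrow> nat \<Rightarrow> nat \<Rightarrow> real" where "u i j N \<equiv> abel \<theta> (\<lambda>t. P t i j) N"

lemma P_0: "P 0 i j = of_bool (i = j)"
  using tf by (simp add: transition_function_def)

lemma resolvent_backward:
  "(\<lambda>N. \<theta> * u i j N - of_bool (i = j) - (\<Sum>k\<le>Suc i. q i k * u k j N)) \<longlonglongrightarrow> 0"
proof -
  have "(\<lambda>N. \<theta> * u i j N - P 0 i j - abel \<theta> (\<lambda>t. \<Sum>k\<le>Suc i. q i k * P t k j) N) \<longlonglongrightarrow> 0"
  proof (rule abel_derivative[OF \<theta>, where b=1 and b'="rowsum i" and c="\<Sum>k\<le>Suc i. \<bar>q i k\<bar> * rowsum k"])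
    show "((\<lambda>t. P t i j) has_real_derivative (\<Sum>k\<le>Suc i. q i k * P t k j)) (at t within {0..})" if "0 \<le> t" for t
      using backward that unfolding kolmogorov_backward_def by blast
    show "\<bar>(\<Sum>k\<le>Suc i. q i k * P v k j) - (\<Sum>k\<le>Suc i. q i k * P t k j)\<bar> \<le> (\<Sum>k\<le>Suc i. \<bar>q i k\<bar> * rowsum k) * (v - t)"
      if "0 \<le> t" "t \<le> v" for t v
      unfolding sum_subtractf[symmetric] right_diff_distrib[symmetric] sum_distrib_right
      by (rule order_trans[OF sum_abs sum_mono])
         (simp add: abs_mult mult.assoc mult_left_mono P_lipschitz[OF that])
  qed (use P_abs generator_bound in auto)
  then show ?thesis
    unfolding P_0 by (subst (asm) abel_lincomb[OF \<theta>, where b=1]) (use P_abs in auto)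
qed

text \<open>The derivative is the column sum from the forward equation, but the Lipschitz bound that
  \<open>abel_derivative\<close> requires still comes from the backward equation, uniformly in the
  target state: hence \<open>rowsum i\<close>.\<close>

lemma resolvent_forward:
  "(\<lambda>N. \<theta> * u i j N - of_bool (i = j) - (\<Sum>k\<le>Suc j. u i k N * q k j)) \<longlonglongrightarrow> 0"
proof -
  have "(\<lambda>N. \<theta> * u i j N - P 0 i j - abel \<theta> (\<lambda>t. \<Sum>k\<le>Suc j. q k j * P t i k) N) \<longlonglongrightarrow> 0"
  proof (rule abel_derivative[OF \<theta>, where b=1 and b'="\<Sum>k\<le>Suc j. \<bar>q k j\<bar>" and c="\<Sum>k\<le>Suc j. \<bar>q k j\<bar> * rowsum i"])
    show "((\<lambda>t. P t i j) has_real_derivative (\<Sum>k\<le>Suc j. q k j * P t i k)) (at t within {0..})" if "0 \<le> t" for t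
      using forward that unfolding kolmogorov_forward_def by (simp add: mult.commute)
    show "\<bar>\<Sum>k\<le>Suc j. q k j * P t i k\<bar> \<le> (\<Sum>k\<le>Suc j. \<bar>q k j\<bar>)" if "0 \<le> t" for t
      by (rule order_trans[OF sum_abs sum_mono]) (auto simp: abs_mult P_abs that intro!: mult_left_le)
    show "\<bar>(\<Sum>k\<le>Suc j. q k j * P v i k) - (\<Sum>k\<le>Suc j. q k j * P t i k)\<bar> \<le> (\<Sum>k\<le>Suc j. \<bar>q k j\<bar> * rowsum i) * (v - t)"
      if "0 \<le> t" "t \<le> v" for t v
      unfolding sum_subtractf[symmetric] right_diff_distrib[symmetric] sum_distrib_right
      by (rule order_trans[OF sum_abs sum_mono])
         (simp add: abs_mult mult.assoc mult_left_mono P_lipschitz[OF that])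
  qed (use P_abs in auto)
  then show ?thesis
    unfolding P_0 by (subst (asm) abel_lincomb[OF \<theta>, where b=1]) (use P_abs in \<open>auto simp: mult.commute\<close>)
qed

lemma u_nonneg: "0 \<le> u i j N"
proof -
  have "0 \<le> (\<Sum>m. exp (- \<theta> * mesh N) ^ m * P (real m * mesh N) i j)"
    using summable_abel(1)[OF \<theta>, of "\<lambda>t. P t i j" 1 N] P_abs P_nonneg mesh_pos[of N]
    by (intro suminf_nonneg summable_norm_cancel[of "\<lambda>m. exp (- \<theta> * mesh N) ^ m * P (real m * mesh N) i j"]) auto
  then show ?thesis using mesh_pos[of N] by (simp add: abel_def)
qed

text \<open>In the backward equation at i = j the off-diagonal terms are nonnegative; dropping them
  gives d * u j j N >= 1 - o(1). Spending 1/2 on the error yields 1 / (2d).\<close>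

lemma u_lower: "\<exists>c>0. eventually (\<lambda>N. c \<le> u j j N) sequentially"
proof -
  define d where "d = \<theta> + la j + mu j"
  have "0 \<le> mu j" using mu by (cases "j = 0") (auto intro: less_imp_le)
  then have d: "0 < d" unfolding d_def using \<theta> la[of j] by simp
  have "eventually (\<lambda>N. - (1/2) < \<theta> * u j j N - of_bool (j = j) - (\<Sum>k\<le>Suc j. q j k * u k j N)) sequentially"
    by (rule order_tendstoD(1)[OF resolvent_backward]) simp
  then have "eventually (\<lambda>N. 1 / (2 * d) \<le> u j j N) sequentially"
  proof eventually_elim
    case (elim N)
    have "- (la j + mu j) * u j j N \<le> (\<Sum>k\<le>Suc j. q j k * u k j N)"
    proof -
      have "0 \<le> la j * u (Suc j) j N" using u_nonneg la[of j] by simp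
      moreover have "0 \<le> (case j of 0 \<Rightarrow> 0 | Suc i \<Rightarrow> mu j * u i j N)"
        using u_nonneg mu(1)[of j] by (cases j) auto
      ultimately show ?thesis unfolding bd_q_row_sum by (simp only: minus_mult_left[symmetric])
    qed
    with elim have "1 / 2 \<le> d * u j j N" by (simp add: d_def algebra_simps)
    then show ?case using d by (simp add: field_simps)
  qed
  with d show ?thesis by (intro exI[of _ "1 / (2 * d)"]) simp
qed

section \<open>Recursions for the passage transforms\<close>

definition H :: "nat \<Rightarrow> nat \<Rightarrow> real" where "H i n = hit_laplace (M i) (X i) n (- \<theta>)"

lemma H_u: "(\<lambda>N. u i n N - H i n * u n n N) \<longlonglongrightarrow> 0"
  and H_nonneg: "0 \<le> H i n" and H_le_1: "H i n \<le> 1"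
  unfolding H_def using markov_from.abel_hit[OF markov \<theta>] by auto

lemma H_refl: "H n n = 1"
proof -
  obtain c where "0 < c" "eventually (\<lambda>N. c \<le> u n n N) sequentially" using u_lower by blast
  moreover have "(\<lambda>N. (1 - H n n) * u n n N) \<longlonglongrightarrow> 0"
    using H_u[of n n] by (simp add: algebra_simps)
  ultimately have "1 - H n n = 0" by (intro bounded_below_null_imp_0)
  then show ?thesis by simp
qed

text \<open>Substitute \<open>H k n * u n n N\<close> for \<open>u k n N\<close> in the backward
  resolvent equation. The identity term is absent since i differs from n, and the common factor
  cancels.\<close>

lemma H_backward:
  assumes "i \<noteq> n"
  shows "\<theta> * H i n = (\<Sum>k\<le>Suc i. q i k * H k n)"
proof -
  obtain c where c: "0 < c" "eventually (\<lambda>N. c \<le> u n n N) sequentially" using u_lower by blast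
  have "(\<lambda>N. (\<theta> * u i n N - (\<Sum>k\<le>Suc i. q i k * u k n N)) - \<theta> * (u i n N - H i n * u n n N)
      + (\<Sum>k\<le>Suc i. q i k * (u k n N - H k n * u n n N))) \<longlonglongrightarrow> 0 - \<theta> * 0 + (\<Sum>k\<le>Suc i. q i k * 0)"
    using resolvent_backward[of i n] assms by (intro tendsto_intros H_u) simp
  moreover have "(\<theta> * u i n N - (\<Sum>k\<le>Suc i. q i k * u k n N)) - \<theta> * (u i n N - H i n * u n n N)
      + (\<Sum>k\<le>Suc i. q i k * (u k n N - H k n * u n n N)) = (\<theta> * H i n - (\<Sum>k\<le>Suc i. q i k * H k n)) * u n n N" for N
    by (simp only: right_diff_distrib sum_subtractf left_diff_distrib sum_distrib_right mult.assoc)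
  ultimately have "(\<lambda>N. (\<theta> * H i n - (\<Sum>k\<le>Suc i. q i k * H k n)) * u n n N) \<longlonglongrightarrow> 0" by simp
  then have "\<theta> * H i n - (\<Sum>k\<le>Suc i. q i k * H k n) = 0"
    using c by (rule bounded_below_null_imp_0)
  then show ?thesis by simp
qed

text \<open>Below the target the recursion determines everything from state 0, so
  \<open>H i n\<close> is \<open>H 0 n\<close> times Q_i(-\<theta>) up to and including i = n, where
  its value is 1.\<close>

lemma H_up: "H 0 n = 1 / bdQ la mu 0 n (- \<theta>)"
proof -
  have "H i n = bdQ la mu 0 i (- \<theta>) * H 0 n" if "i \<le> n" for i
    using that
  proof (induction i rule: less_induct)
    case (less i)
    consider "i = 0" | "i = Suc 0" | j where "i = Suc (Suc j)" by (metis nat.exhaust)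
    then show ?case
    proof cases
      case 2
      then have "0 \<noteq> n" using less by auto
      from H_backward[OF this] show ?thesis
        unfolding bd_q_row_sum using 2 la[of 0] by (simp add: field_simps)
    next
      case 3
      then have "Suc j \<noteq> n" using less by auto
      from H_backward[OF this] have e: "la (Suc j) * H i n = (la (Suc j) + mu (Suc j) + \<theta>) * H (Suc j) n - mu (Suc j) * H j n"
        unfolding bd_q_row_sum using 3 by (simp add: algebra_simps)
      have h: "H (Suc j) n = bdQ la mu 0 (Suc j) (- \<theta>) * H 0 n" "H j n = bdQ la mu 0 j (- \<theta>) * H 0 n"
        using less.IH[of "Suc j"] less.IH[of j] less.prems 3 by (simp_all del: bdQ.simps)
      define A B where "A = bdQ la mu 0 (Suc j) (- \<theta>)" and "B = bdQ la mu 0 j (- \<theta>)"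
      have "bdQ la mu 0 i (- \<theta>) = ((la (Suc j) + mu (Suc j) + \<theta>) * A - mu (Suc j) * B) / la (Suc j)"
        unfolding 3 A_def B_def by simp
      moreover have "la (Suc j) * H i n = ((la (Suc j) + mu (Suc j) + \<theta>) * A - mu (Suc j) * B) * H 0 n"
        using e unfolding h A_def[symmetric] B_def[symmetric] by (simp add: algebra_simps)
      ultimately have "la (Suc j) * H i n = la (Suc j) * (bdQ la mu 0 i (- \<theta>) * H 0 n)"
        using la[of "Suc j"] by simp
      then show ?thesis using la[of "Suc j"] by simp
    qed simp
  qed
  from this[of n] have "bdQ la mu 0 n (- \<theta>) * H 0 n = 1" by (simp add: H_refl)
  moreover have "0 < bdQ la mu 0 n (- \<theta>)" using bdQ_nonpos_mono[of "- \<theta>" 0 n] \<theta> by simp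
  ultimately show ?thesis by (simp add: field_simps)
qed

section \<open>Passage down to state 0\<close>

definition v :: "nat \<Rightarrow> real" where "v n = H n 0"
definition w :: "nat \<Rightarrow> real" where "w n = la n * pp n * (v (Suc n) - v n)"

lemma v_Suc: "v (Suc n) = v n + resist n * w n"
  unfolding w_def resist_mult by simp

lemma v_recurrence:
  "\<theta> * v (Suc n) = la (Suc n) * v (Suc (Suc n)) - (la (Suc n) + mu (Suc n)) * v (Suc n) + mu (Suc n) * v n"
  using H_backward[of "Suc n" 0] unfolding bd_q_row_sum v_def by simp

lemma w_Suc: "w (Suc n) = w n + \<theta> * pp (Suc n) * v (Suc n)"
proof -
  have "la (Suc n) * (v (Suc (Suc n)) - v (Suc n)) = mu (Suc n) * (v (Suc n) - v n) + \<theta> * v (Suc n)"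
    using v_recurrence[of n] by (simp add: algebra_simps)
  then have "pp (Suc n) * (la (Suc n) * (v (Suc (Suc n)) - v (Suc n)))
     = pp (Suc n) * (mu (Suc n) * (v (Suc n) - v n) + \<theta> * v (Suc n))" by (rule arg_cong)
  then have "w (Suc n) = pp (Suc n) * mu (Suc n) * (v (Suc n) - v n) + \<theta> * pp (Suc n) * v (Suc n)"
    unfolding w_def by (simp only: distrib_left mult_ac)
  then show ?thesis unfolding pp_balance w_def .
qed

text \<open>Both sides solve the same three-term recursion in \<open>n\<close>, one by the forward and one by the
  backward equation, so no symmetry of \<open>P\<close> has to be known beforehand.\<close>
lemma u_reversible: "(\<lambda>N. u 0 n N - pp n * v n * u 0 0 N) \<longlonglongrightarrow> 0"
proof (induction n rule: less_induct)
  case (less n)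
  consider "n = 0" | "n = Suc 0" | j where "n = Suc (Suc j)" by (metis nat.exhaust)
  then show ?case
  proof cases
    case 1
    then show ?thesis by (simp add: v_def H_refl)
  next
    case 2
    have m: "0 < mu (Suc 0)" using mu by simp
    \<comment> \<open>The backward and forward equations for the entry (0,0) are subtracted: the
      diagonal parts cancel, which leaves la 0 * u 1 0 = mu 1 * u 0 1 up to a null sequence.\<close>
    have "(\<lambda>N. (1 / mu (Suc 0)) * ((\<theta> * u 0 0 N - of_bool ((0::nat) = 0) - (\<Sum>k\<le>Suc 0. q 0 k * u k 0 N))
         - (\<theta> * u 0 0 N - of_bool ((0::nat) = 0) - (\<Sum>k\<le>Suc 0. u 0 k N * q k 0))
         + la 0 * (u (Suc 0) 0 N - H (Suc 0) 0 * u 0 0 N))) \<longlonglongrightarrow> (1 / mu (Suc 0)) * (0 - 0 + la 0 * 0)"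
      by (intro tendsto_intros resolvent_backward resolvent_forward H_u)
    moreover have "(1 / mu (Suc 0)) * ((\<theta> * u 0 0 N - of_bool ((0::nat) = 0) - (\<Sum>k\<le>Suc 0. q 0 k * u k 0 N))
         - (\<theta> * u 0 0 N - of_bool ((0::nat) = 0) - (\<Sum>k\<le>Suc 0. u 0 k N * q k 0))
         + la 0 * (u (Suc 0) 0 N - H (Suc 0) 0 * u 0 0 N)) = u 0 n N - pp n * v n * u 0 0 N" for N
      unfolding bd_q_row_sum bd_q_column_sum 2 v_def pp_Suc using m by (simp add: field_simps)
    ultimately show ?thesis by simp
  next
    case 3
    let ?k = "Suc j"
    have m: "0 < mu n" using mu 3 by simp
    \<comment> \<open>The forward equation in column j + 1, solved for \<open>u 0 n\<close>; the
      identity term vanishes there.\<close>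
    have "(\<lambda>N. (1 / mu n) * ((\<theta> + la ?k + mu ?k) * (u 0 ?k N - pp ?k * v ?k * u 0 0 N)
          - la j * (u 0 j N - pp j * v j * u 0 0 N)
          - (\<theta> * u 0 ?k N - of_bool (0 = ?k) - (\<Sum>k\<le>Suc ?k. u 0 k N * q k ?k))))
        \<longlonglongrightarrow> (1 / mu n) * ((\<theta> + la ?k + mu ?k) * 0 - la j * 0 - 0)"
      by (intro tendsto_intros resolvent_forward less) (use 3 in auto)
    moreover have "(1 / mu n) * ((\<theta> + la ?k + mu ?k) * (u 0 ?k N - pp ?k * v ?k * u 0 0 N)
          - la j * (u 0 j N - pp j * v j * u 0 0 N)
          - (\<theta> * u 0 ?k N - of_bool (0 = ?k) - (\<Sum>k\<le>Suc ?k. u 0 k N * q k ?k)))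
        = u 0 n N - pp n * v n * u 0 0 N" for N
    proof -
      have b: "pp n * mu n = la ?k * pp ?k" "pp ?k * mu ?k = la j * pp j"
        using pp_balance[of ?k] pp_balance[of j] 3 by auto
      have "pp ?k * (\<theta> * v ?k) = pp ?k * (la ?k * v n - (la ?k + mu ?k) * v ?k + mu ?k * v j)"
        using v_recurrence[of j] 3 by simp
      then have "(\<theta> + la ?k + mu ?k) * (pp ?k * v ?k) = (la ?k * pp ?k) * v n + (pp ?k * mu ?k) * v j"
        by (simp add: algebra_simps)
      then have r: "(\<theta> + la ?k + mu ?k) * (pp ?k * v ?k) = mu n * (pp n * v n) + la j * (pp j * v j)"
      proof -
        have "(la ?k * pp ?k) * v n = mu n * (pp n * v n)" unfolding b(1)[symmetric] by (simp add: mult_ac)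
        moreover have "(pp ?k * mu ?k) * v j = la j * (pp j * v j)" unfolding b(2) by (simp add: mult_ac)
        ultimately show ?thesis
          using \<open>(\<theta> + la ?k + mu ?k) * (pp ?k * v ?k) = (la ?k * pp ?k) * v n + (pp ?k * mu ?k) * v j\<close> by argo
      qed
      have "(\<theta> + la ?k + mu ?k) * (u 0 ?k N - pp ?k * v ?k * u 0 0 N)
          - la j * (u 0 j N - pp j * v j * u 0 0 N)
          - (\<theta> * u 0 ?k N - of_bool (0 = ?k) - (\<Sum>k\<le>Suc ?k. u 0 k N * q k ?k))
        = mu n * u 0 n N - ((\<theta> + la ?k + mu ?k) * (pp ?k * v ?k) - la j * (pp j * v j)) * u 0 0 N"
        unfolding bd_q_column_sum using 3 by (simp add: algebra_simps)
      also have "\<dots> = mu n * (u 0 n N - pp n * v n * u 0 0 N)"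
        unfolding r by (simp add: algebra_simps)
      finally show ?thesis using m by simp
    qed
    ultimately show ?thesis by simp
  qed
qed

text \<open>The rows of P are substochastic, so the sums of \<open>u 0 k N\<close> over k stay below
  a quantity tending to 1 / \<theta>. By \<open>u_reversible\<close> they are close to the sum of pp
  k * v k times \<open>u 0 0 N\<close>, and the last factor is at least c.\<close>

lemma pp_v_sum_bounded: "\<exists>B. \<forall>n. (\<Sum>k\<le>n. pp k * v k) \<le> B"
proof -
  obtain c where c: "0 < c" "eventually (\<lambda>N. c \<le> u 0 0 N) sequentially" using u_lower by blast
  have "(\<Sum>k\<le>n. pp k * v k) \<le> 1 / (\<theta> * c)" for n
  proof -
    have s0: "0 \<le> (\<Sum>k\<le>n. pp k * v k)"
      using pp_pos H_nonneg by (intro sum_nonneg mult_nonneg_nonneg) (simp_all add: v_def less_imp_le)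
    have le: "(\<Sum>k\<le>n. u 0 k N) \<le> mesh N / (1 - exp (- \<theta> * mesh N))" for N
    proof -
      have "(\<Sum>k\<le>n. 1 * u 0 k N) = abel \<theta> (\<lambda>t. \<Sum>k\<le>n. 1 * P t 0 k) N"
        by (rule abel_lincomb[OF \<theta>, where b=1, symmetric]) (use P_abs in auto)
      moreover have "\<bar>abel \<theta> (\<lambda>t. \<Sum>k\<le>n. 1 * P t 0 k) N\<bar> \<le> 1 * (mesh N / (1 - exp (- \<theta> * mesh N)))"
      proof (rule abel_le[OF \<theta>])
        fix t :: real assume t: "0 \<le> t"
        have "(\<Sum>k\<le>n. P t 0 k) \<le> 1" using tf t by (simp add: transition_function_def)
        moreover have "0 \<le> (\<Sum>k\<le>n. P t 0 k)" using P_nonneg t by (intro sum_nonneg) auto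
        ultimately show "\<bar>\<Sum>k\<le>n. 1 * P t 0 k\<bar> \<le> 1" by simp
      qed
      ultimately show ?thesis by simp
    qed
    have "(\<lambda>N. mesh N / (1 - exp (- \<theta> * mesh N)) - (\<Sum>k\<le>n. u 0 k N - pp k * v k * u 0 0 N)) \<longlonglongrightarrow> 1 / \<theta> - (\<Sum>k\<le>n. 0)"
      by (intro tendsto_intros mesh_ratio_tendsto[OF \<theta>] u_reversible)
    then have lim: "(\<lambda>N. mesh N / (1 - exp (- \<theta> * mesh N)) - (\<Sum>k\<le>n. u 0 k N - pp k * v k * u 0 0 N)) \<longlonglongrightarrow> 1 / \<theta>"
      by simp
    have "eventually (\<lambda>N. (\<Sum>k\<le>n. pp k * v k) * c \<le> mesh N / (1 - exp (- \<theta> * mesh N)) - (\<Sum>k\<le>n. u 0 k N - pp k * v k * u 0 0 N)) sequentially"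
      using c(2)
    proof eventually_elim
      case (elim N)
      have "(\<Sum>k\<le>n. pp k * v k) * c \<le> (\<Sum>k\<le>n. pp k * v k) * u 0 0 N"
        using s0 elim by (rule mult_left_mono[rotated])
      also have "\<dots> = (\<Sum>k\<le>n. u 0 k N) - (\<Sum>k\<le>n. u 0 k N - pp k * v k * u 0 0 N)"
        by (simp add: sum_subtractf sum_distrib_right)
      finally show ?case using le[of N] by linarith
    qed
    then have "(\<Sum>k\<le>n. pp k * v k) * c \<le> 1 / \<theta>"
      using tendsto_lowerbound[OF lim] by simp
    then show ?thesis using c(1) \<theta> by (simp add: field_simps)
  qed
  then show ?thesis by blast
qed

text \<open>With divergent total mass, a bounded sum of pp k * v k keeps v from staying above any e
  > 0. To get a limit from this, v must be eventually monotone, which follows from the monotonicity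
  of its flux.\<close>

lemma v_tendsto_0:
  assumes "\<not> summable pp"
  shows "v \<longlonglongrightarrow> 0"
proof -
  obtain B where B: "\<And>n. (\<Sum>k\<le>n. pp k * v k) \<le> B" using pp_v_sum_bounded by blast
  have v0: "0 \<le> v n" for n by (simp add: v_def H_nonneg)
  have small: "\<not> (\<forall>n\<ge>m. e \<le> v n)" if e: "0 < e" for m e
  proof
    assume H: "\<forall>n\<ge>m. e \<le> v n"
    have "\<not> summable (\<lambda>k. pp (k + m))" using assms summable_iff_shift by blast
    then obtain n where n: "B / e < (\<Sum>k<n. pp (k + m))"
      using summableI_nonneg_bounded[of "\<lambda>k. pp (k + m)" "B / e"] pp_pos by (meson less_imp_le not_le)
    have "(\<Sum>k<n. pp (k + m) * e) \<le> (\<Sum>k<n. pp (k + m) * v (k + m))"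
      using H pp_pos by (intro sum_mono mult_left_mono) (auto intro: less_imp_le)
    also have "\<dots> = (\<Sum>k=m..<n+m. pp k * v k)"
      using sum.shift_bounds_nat_ivl[of "\<lambda>k. pp k * v k" 0 m n] by (simp add: lessThan_atLeast0)
    also have "\<dots> \<le> (\<Sum>k\<le>n+m. pp k * v k)"
      using v0 pp_pos by (intro sum_mono2 mult_nonneg_nonneg) (auto simp: less_imp_le)
    also have "\<dots> \<le> B" by (rule B)
    finally have "(\<Sum>k<n. pp (k + m)) * e \<le> B" by (simp add: sum_distrib_right)
    then show False using n e by (simp add: field_simps)
  qed
  have w_mono: "w m \<le> w n" if "m \<le> n" for m n
    using that
  proof (induction n rule: dec_induct)
    case (step n)
    have "0 \<le> \<theta> * pp (Suc n) * v (Suc n)" using \<theta> pp_pos[of "Suc n"] v0 by simp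
    then show ?case using step w_Suc[of n] by linarith
  qed simp
  show ?thesis
  \<comment> \<open>A flux that becomes nonnegative makes v nondecreasing from there on, hence
    eventually 0 by \<open>small\<close>; otherwise v decreases throughout.\<close>
  proof (cases "\<exists>N. 0 \<le> w N")
    case True
    then obtain N where N: "0 \<le> w N" by blast
    have inc: "v m \<le> v n" if "N \<le> m" "m \<le> n" for m n
      using that(2)
    proof (induction n rule: dec_induct)
      case (step n)
      have "0 \<le> w n" using N w_mono[of N n] that step by simp
      then show ?case using step v_Suc[of n] resist_pos[of n] by (simp add: add_increasing2)
    qed simp
    have "v m = 0" if "N \<le> m" for m
    proof (rule ccontr)
      assume "v m \<noteq> 0"
      then have "0 < v m" using v0[of m] by simp
      then show False using small[of "v m" m] inc that by blast
    qed
    then have "eventually (\<lambda>n. 0 = v n) sequentially" by (auto simp: eventually_sequentially)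
    then show ?thesis by (rule Lim_transform_eventually[OF tendsto_const])
  next
    case False
    have "decseq v"
      unfolding decseq_Suc_iff
    proof
      fix n
      have "w n < 0" using False by (simp add: not_le)
      then have "resist n * w n \<le> 0" using resist_pos[of n] by (simp add: mult_nonneg_nonpos)
      then show "v (Suc n) \<le> v n" using v_Suc[of n] by simp
    qed
    then obtain l where l: "v \<longlonglongrightarrow> l" "\<forall>n. l \<le> v n" using decseq_convergent[of v 0] v0 by blast
    have "0 \<le> l" using l(1) v0 by (intro LIMSEQ_le_const) auto
    moreover have "\<not> 0 < l" using small[of l 0] l(2) by blast
    ultimately show ?thesis using l(1) by simp
  qed
qed

text \<open>Since Q_n(-\<theta>) >= 1, its flux is at least \<theta> times K_n, so Q_n(-\<theta>)
  dominates \<theta> times the partial sums of C.\<close>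

lemma H_up_tendsto_0:
  assumes "\<not> summable (\<lambda>n. resist n * KK n)"
  shows "(\<lambda>n. H 0 n) \<longlonglongrightarrow> 0"
proof -
  define Q where "Q n = bdQ la mu 0 n (- \<theta>)" for n
  have Q1: "1 \<le> Q n" for n using bdQ_nonpos_mono[of "- \<theta>" 0 n] \<theta> by (simp add: Q_def)
  define f where "f n = la n * pp n * (Q (Suc n) - Q n)" for n
  have f: "\<theta> * KK n \<le> f n" for n
  proof (induction n)
    case 0
    show ?case using bdQ_0_flux[of "- \<theta>"] mu(2) by (simp add: f_def Q_def bd_K_def)
  next
    case (Suc n)
    have "\<theta> * pp (Suc n) * 1 \<le> \<theta> * pp (Suc n) * Q (Suc n)"
      using Q1 \<theta> pp_pos[of "Suc n"] by (intro mult_left_mono) auto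
    moreover have "f (Suc n) = f n + \<theta> * pp (Suc n) * Q (Suc n)"
      using bdQ_flux[of n 0 "- \<theta>"] unfolding f_def Q_def add_0_right by simp
    ultimately show ?case using Suc by (simp add: bd_K_def algebra_simps)
  qed
  have Qs: "Q (Suc n) = Q n + resist n * f n" for n unfolding f_def resist_mult by simp
  have lb: "\<theta> * (\<Sum>k<n. resist k * KK k) \<le> Q n" for n
  proof (induction n)
    case 0
    show ?case using Q1[of 0] by simp
  next
    case (Suc n)
    have "resist n * (\<theta> * KK n) \<le> resist n * f n" using f resist_pos[of n] by (intro mult_left_mono) auto
    then show ?case using Suc unfolding Qs by (simp add: algebra_simps)
  qed
  have "filterlim (\<lambda>n. \<Sum>k<n. resist k * KK k) at_top sequentially"
    by (rule not_summable_at_top[OF _ assms]) (use KK_nonneg resist_pos in \<open>auto intro: less_imp_le mult_nonneg_nonneg\<close>)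
  then have "filterlim (\<lambda>n. \<theta> * (\<Sum>k<n. resist k * KK k)) at_top sequentially"
    by (rule filterlim_tendsto_pos_mult_at_top[OF tendsto_const \<theta>])
  then have "filterlim Q at_top sequentially"
    by (rule filterlim_at_top_mono) (use lb in auto)
  then have "(\<lambda>n. 1 / Q n) \<longlonglongrightarrow> 0"
    by (rule real_tendsto_divide_at_top[OF tendsto_const])
  then show ?thesis unfolding H_up Q_def .
qed

end

theorem theorem2:
  fixes la mu :: "nat \<Rightarrow> real"
    and P :: "real \<Rightarrow> nat \<Rightarrow> nat \<Rightarrow> real"
    and M :: "nat \<Rightarrow> 'a measure"
    and X :: "nat \<Rightarrow> real \<Rightarrow> 'a \<Rightarrow> int"
    and s :: real
  assumes la_pos: "\<And>i. 0 < la i"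
    and mu_pos: "\<And>i. 1 \<le> i \<Longrightarrow> 0 < mu i"
    and mu0: "0 \<le> mu 0"
    and P_tf: "transition_function P"
    and backward: "kolmogorov_backward la mu P"
    and forward: "kolmogorov_forward la mu P"
    and proc: "\<And>i. markov_process_from (M i) (X i) P i"
    and s_neg: "s < 0"
  shows
   "(bd_C la mu < \<infinity> \<and> bd_D la mu = \<infinity> \<longrightarrow>
       (\<lambda>n. hit_laplace (M 0) (X 0) n s) \<longlonglongrightarrow>
         1 / (1 + mu 0 * enn2real (bd_Linf la mu)) *
           (\<Prod>i. bd_xi la mu 0 (Suc i) / (bd_xi la mu 0 (Suc i) - s))) \<and>
    (bd_C la mu = \<infinity> \<longrightarrow> (\<lambda>n. hit_laplace (M 0) (X 0) n s) \<longlonglongrightarrow> 0) \<and>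
    (bd_C la mu < \<infinity> \<and> bd_D la mu = \<infinity> \<longrightarrow> (\<lambda>n. hit_laplace (M n) (X n) 0 s) \<longlonglongrightarrow> 0) \<and>
    (bd_C la mu = \<infinity> \<and> bd_D la mu < \<infinity> \<longrightarrow>
       (\<lambda>n. hit_laplace (M n) (X n) 0 s) \<longlonglongrightarrow>
         (\<Prod>i. bd_xi la mu 1 (Suc i) / (bd_xi la mu 1 (Suc i) - s))) \<and>
    (bd_C la mu < \<infinity> \<and> bd_D la mu = \<infinity> \<longrightarrow> reciprocal_entire_simple_pos_zeros (bd_xi la mu 0)) \<and>
    (bd_C la mu = \<infinity> \<and> bd_D la mu < \<infinity> \<longrightarrow> reciprocal_entire_simple_pos_zeros (bd_xi la mu 1))"
proof -
  interpret bd_process la mu P M X "- s"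
    by standard (use assms in auto)
  have H_eq: "hit_laplace (M i) (X i) n s = H i n" for i n by (simp add: H_def)
  have H_v: "(\<lambda>n. H n 0) = v" by (simp add: v_def fun_eq_iff)
  have exit: "(\<lambda>n. H 0 n) \<longlonglongrightarrow> 1 / (1 + mu 0 * enn2real (bd_Linf la mu)) *
           (\<Prod>i. bd_xi la mu 0 (Suc i) / (bd_xi la mu 0 (Suc i) - s))"
    "reciprocal_entire_simple_pos_zeros (bd_xi la mu 0)" if "bd_C la mu < \<infinity>"
  proof -
    have C: "summable (\<lambda>n. resist n * KK n)" using that bd_C_finite_iff by blast
    show "reciprocal_entire_simple_pos_zeros (bd_xi la mu 0)" by (rule exit_case(1)[OF C])
    show "(\<lambda>n. H 0 n) \<longlonglongrightarrow> 1 / (1 + mu 0 * enn2real (bd_Linf la mu)) *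
           (\<Prod>i. bd_xi la mu 0 (Suc i) / (bd_xi la mu 0 (Suc i) - s))"
      using exit_case(2)[OF C s_neg] unfolding H_up bd_Linf_eq[OF summable_resist[OF C]] minus_minus .
  qed
  have entrance: "v \<longlonglongrightarrow> (\<Prod>i. bd_xi la mu 1 (Suc i) / (bd_xi la mu 1 (Suc i) - s))"
    "reciprocal_entire_simple_pos_zeros (bd_xi la mu 1)"
    if "bd_C la mu = \<infinity>" "bd_D la mu < \<infinity>"
  proof -
    note S = entrance_summability[OF that]
    have v: "0 \<le> v n" "v n \<le> 1" "v 0 = 1" for n by (simp_all add: v_def H_nonneg H_le_1 H_refl)
    note E = entrance_case[OF S(3,2,1) \<theta> v v_Suc w_Suc]
    show "reciprocal_entire_simple_pos_zeros (bd_xi la mu 1)" by (rule E(1))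
    show "v \<longlonglongrightarrow> (\<Prod>i. bd_xi la mu 1 (Suc i) / (bd_xi la mu 1 (Suc i) - s))"
      using E(2) unfolding minus_minus .
  qed
  have natural: "(\<lambda>n. H 0 n) \<longlonglongrightarrow> 0" if "bd_C la mu = \<infinity>"
    using H_up_tendsto_0 that bd_C_finite_iff by fastforce
  show ?thesis
    unfolding H_eq H_v using exit entrance natural v_tendsto_0 not_summable_pp by blast
qed

end
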